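(* Let $n_0,h,t,d$ be positive integers and let $S$ be a numerical semigroup minimally generated by the generalized arithmetic sequence $n_0$, $n_i=hn_0+it$ for $i=1,\ldots,d$. Then $S$ is of homogeneous type.
   Context: A numerical semigroup is a submonoid of $(\mathbb N,+)$ with finite complement. Let $\Bbbk$ be a field. For $S$ minimally generated by $n_0,\ldots,n_d$, let $P=\Bbbk[x_0,\ldots,x_d]$ and $R=\Bbbk[S]=\Bbbk[t^{n_0},\ldots,t^{n_d}]$ (here $t$ is a variable), a $P$-module via $x_i\mapsto t^{n_i}$, with $R\cong P/I_S$. $G(S)$ is the associated graded ring of $R$ with respect to the ideal $(t^{n_0},\ldots,t^{n_d})$; $G(S)\cong P/(I_S)_*$, where $(I_S)_*$ is generated by the lowest-degree homogeneous components (standard grading) of the nonzero elements of $I_S$. $S$ is of homogeneous type if $\beta_i(R)=\beta_i(G(S))$ for all $i\ge1$, where $\beta_i(M)=\dim_\Bbbk\mathrm{Tor}_i^P(M,\Bbbk)$. *)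

theory Defs
  imports
    "HOL-Library.Poly_Mapping"
    "HOL-Computational_Algebra.Polynomial"
    "HOL-Algebra.QuotRing"
    "HOL-Algebra.Ideal_Product"
    "Jordan_Normal_Form.Matrix_Kernel"
    "Jordan_Normal_Form.DL_Rank"
begin

section \<open>Numerical semigroups\<close>

definition numerical_semigroup :: "nat set \<Rightarrow> bool" where
  "numerical_semigroup S \<longleftrightarrow>
     0 \<in> S \<and> (\<forall>a\<in>S. \<forall>b\<in>S. a + b \<in> S) \<and> finite (UNIV - S)"

definition generated_submonoid :: "(nat \<Rightarrow> nat) \<Rightarrow> nat set \<Rightarrow> nat set" where
  "generated_submonoid n J = range (\<lambda>c. \<Sum>i\<in>J. c i * n i)"

definition minimally_generated :: "nat set \<Rightarrow> nat \<Rightarrow> (nat \<Rightarrow> nat) \<Rightarrow> bool" where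
  "minimally_generated S d n \<longleftrightarrow>
     S = generated_submonoid n {..d} \<and> (\<forall>J. J \<subset> {..d} \<longrightarrow> generated_submonoid n J \<noteq> S)"

section \<open>The polynomial ring in the variables with index at most d\<close>

type_synonym 'k mpoly = "(nat \<Rightarrow>\<^sub>0 nat) \<Rightarrow>\<^sub>0 'k"

text \<open>The type has countably many variables, indexed by the natural numbers; a monomial is its
  exponent vector.  The ring \<open>P = k[x\<^sub>0, \<dots>, x\<^sub>d]\<close> is the following subring.\<close>

definition polys :: "nat \<Rightarrow> ('k::zero) mpoly set" where
  "polys d = {p. \<forall>m \<in> Poly_Mapping.keys p. Poly_Mapping.keys m \<subseteq> {..d}}"

text \<open>The value at \<open>x\<^sub>i = a i\<close> of a polynomial in an algebra \<open>A\<close> with structure map \<open>\<eta>\<close>, and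
  the \<open>P\<close>-module obtained from \<open>A\<close> by restriction of scalars along this evaluation.\<close>

definition eval_at ::
    "nat \<Rightarrow> ('a, 'x) ring_scheme \<Rightarrow> ('k::zero \<Rightarrow> 'a) \<Rightarrow> (nat \<Rightarrow> 'a) \<Rightarrow> 'k mpoly \<Rightarrow> 'a" where
  "eval_at d A \<eta> a p =
     finsum A (\<lambda>m. \<eta> (Poly_Mapping.lookup p m) \<otimes>\<^bsub>A\<^esub>
                   finprod A (\<lambda>i. a i [^]\<^bsub>A\<^esub> Poly_Mapping.lookup m i) {..d})
              (Poly_Mapping.keys p)"

definition restrict_scalars ::
    "nat \<Rightarrow> 'a ring \<Rightarrow> ('k::zero \<Rightarrow> 'a) \<Rightarrow> (nat \<Rightarrow> 'a) \<Rightarrow> ('k mpoly, 'a) module" where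
  "restrict_scalars d A \<eta> a =
     \<lparr>carrier = carrier A, mult = mult A, one = \<one>\<^bsub>A\<^esub>, zero = \<zero>\<^bsub>A\<^esub>, add = add A,
      smult = (\<lambda>p x. eval_at d A \<eta> a p \<otimes>\<^bsub>A\<^esub> x)\<rparr>"

section \<open>Betti numbers\<close>

definition free_module :: "nat \<Rightarrow> nat \<Rightarrow> ('k::zero) mpoly vec set" where
  "free_module d r = {v \<in> carrier_vec r. \<forall>j<r. v $ j \<in> polys d}"

definition augmentation ::
    "('k mpoly, 'a) module \<Rightarrow> nat \<Rightarrow> (nat \<Rightarrow> 'a) \<Rightarrow> 'k mpoly vec \<Rightarrow> 'a" where
  "augmentation M r g v = finsum M (\<lambda>j. (v $ j) \<odot>\<^bsub>M\<^esub> g j) {..<r}"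

text \<open>A resolution
  \<open>\<dots> \<rightarrow> P^(b 2) \<rightarrow> P^(b 1) \<rightarrow> P^(b 0) \<rightarrow> M \<rightarrow> 0\<close>
  of a \<open>P\<close>-module by finitely generated free modules: \<open>D i\<close> is the matrix of
  \<open>P^(b (i + 1)) \<rightarrow> P^(b i)\<close>, and \<open>g j\<close> is the image in \<open>M\<close> of the \<open>j\<close>-th basis vector.\<close>

definition free_resolution ::
    "nat \<Rightarrow> ('k::comm_ring_1 mpoly, 'a) module \<Rightarrow>
     (nat \<Rightarrow> nat) \<Rightarrow> (nat \<Rightarrow> 'a) \<Rightarrow> (nat \<Rightarrow> 'k mpoly mat) \<Rightarrow> bool" where
  "free_resolution d M b g D \<longleftrightarrow>
     (\<forall>j < b 0. g j \<in> carrier M) \<and>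
     (\<forall>i. D i \<in> carrier_mat (b i) (b (Suc i)) \<and> elements_mat (D i) \<subseteq> polys d) \<and>
     augmentation M (b 0) g ` free_module d (b 0) = carrier M \<and>
     {v \<in> free_module d (b 0). augmentation M (b 0) g v = \<zero>\<^bsub>M\<^esub>} =
       (\<lambda>w. D 0 *\<^sub>v w) ` free_module d (b 1) \<and>
     (\<forall>i. {v \<in> free_module d (b (Suc i)). D i *\<^sub>v v = 0\<^sub>v (b i)} =
       (\<lambda>w. D (Suc i) *\<^sub>v w) ` free_module d (b (Suc (Suc i))))"

text \<open>Here \<open>k = P / (x\<^sub>0, \<dots>, x\<^sub>d)\<close>, so tensoring the resolution with \<open>k\<close> gives the complex of
  vector spaces \<open>k^(b i)\<close> whose matrices consist of the constant terms of the entries of the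
  \<open>D i\<close>.\<close>

definition tensor_k :: "('k::zero) mpoly mat \<Rightarrow> 'k mat" where
  "tensor_k A = map_mat (\<lambda>p. Poly_Mapping.lookup p 0) A"

text \<open>The dimension of the \<open>i\<close>-th homology (kernel modulo image) of that complex, i.e. of
  \<open>Tor\<^sub>i(M, k)\<close>.\<close>

definition tor_dim :: "(nat \<Rightarrow> nat) \<Rightarrow> (nat \<Rightarrow> ('k::field) mpoly mat) \<Rightarrow> nat \<Rightarrow> nat" where
  "tor_dim b D i =
     (case i of 0 \<Rightarrow> b 0 | Suc j \<Rightarrow> kernel_dim (tensor_k (D j)))
       - vec_space.rank (b i) (tensor_k (D i))"

text \<open>As \<open>P\<close> is Noetherian, a finitely generated module has such a resolution, and the homology
  does not depend on the resolution.\<close>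

definition betti :: "nat \<Rightarrow> ('k::field mpoly, 'a) module \<Rightarrow> nat \<Rightarrow> nat" where
  "betti d M i = (THE \<beta>. \<exists>b g D. free_resolution d M b g D \<and> \<beta> = tor_dim b D i)"

section \<open>The semigroup ring and its associated graded ring\<close>

definition semigroup_ring :: "nat set \<Rightarrow> ('k::field) poly ring" where
  "semigroup_ring S =
     \<lparr>carrier = {f. \<forall>s. coeff f s \<noteq> 0 \<longrightarrow> s \<in> S}, mult = (*), one = 1, zero = 0, add = (+)\<rparr>"

primrec ideal_power :: "'a ring \<Rightarrow> 'a set \<Rightarrow> nat \<Rightarrow> 'a set" where
  "ideal_power R I 0 = carrier R"
| "ideal_power R I (Suc j) = ideal_prod R I (ideal_power R I j)"

text \<open>An element of the direct sum of the \<open>I^j / I^(j+1)\<close> is a function sending \<open>j\<close> to its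
  component of degree \<open>j\<close>, which is a coset of \<open>I^(j+1)\<close>.  The coset product and the sum in the
  multiplication are those of the quotient ring \<open>R / I^(j+1)\<close>; the former is applied to cosets of
  \<open>I^(i+1)\<close> and \<open>I^(j-i+1)\<close> contained in \<open>I^i\<close> and \<open>I^(j-i)\<close>, whose products all lie in one coset
  of \<open>I^(j+1)\<close>.\<close>

definition assoc_graded :: "'a ring \<Rightarrow> 'a set \<Rightarrow> (nat \<Rightarrow> 'a set) ring" where
  "assoc_graded R I =
     \<lparr>carrier =
        {f. (\<forall>j. \<exists>a \<in> ideal_power R I j. f j = ideal_power R I (Suc j) +>\<^bsub>R\<^esub> a) \<and>
            finite {j. f j \<noteq> ideal_power R I (Suc j)}},
      mult = (\<lambda>f g j. finsum (R Quot ideal_power R I (Suc j))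
        (\<lambda>i. rcoset_mult R (ideal_power R I (Suc j)) (f i) (g (j - i))) {..j}),
      one = (\<lambda>j. if j = 0 then ideal_power R I (Suc 0) +>\<^bsub>R\<^esub> \<one>\<^bsub>R\<^esub>
                 else ideal_power R I (Suc j)),
      zero = (\<lambda>j. ideal_power R I (Suc j)),
      add = (\<lambda>f g j. f j <+>\<^bsub>R\<^esub> g j)\<rparr>"

definition graded_class :: "'a ring \<Rightarrow> 'a set \<Rightarrow> nat \<Rightarrow> 'a \<Rightarrow> nat \<Rightarrow> 'a set" where
  "graded_class R I l a =
     (\<lambda>j. if j = l then ideal_power R I (Suc l) +>\<^bsub>R\<^esub> a else ideal_power R I (Suc j))"

definition semigroup_ring_module ::
    "nat \<Rightarrow> (nat \<Rightarrow> nat) \<Rightarrow> nat set \<Rightarrow> ('k::field mpoly, 'k poly) module" where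
  "semigroup_ring_module d n S =
     restrict_scalars d (semigroup_ring S) (\<lambda>c. [:c:]) (\<lambda>i. monom 1 (n i))"

definition generator_ideal :: "nat \<Rightarrow> (nat \<Rightarrow> nat) \<Rightarrow> nat set \<Rightarrow> ('k::field) poly set" where
  "generator_ideal d n S = genideal (semigroup_ring S) ((\<lambda>i. monom 1 (n i)) ` {..d})"

text \<open>The variable \<open>x\<^sub>i\<close> acts on the associated graded ring as the class of \<open>t^(n i)\<close> in \<open>I / I^2\<close>.\<close>

definition tangent_cone_module ::
    "nat \<Rightarrow> (nat \<Rightarrow> nat) \<Rightarrow> nat set \<Rightarrow> ('k::field mpoly, nat \<Rightarrow> 'k poly set) module" where
  "tangent_cone_module d n S =
     (let R = semigroup_ring S; I = generator_ideal d n S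
      in restrict_scalars d (assoc_graded R I)
           (\<lambda>c. graded_class R I 0 [:c:]) (\<lambda>i. graded_class R I 1 (monom 1 (n i))))"

text \<open>The predicate is meant for \<open>S\<close> minimally generated by \<open>n 0, \<dots>, n d\<close>; the type argument
  is the field of coefficients.\<close>

definition homogeneous_type ::
    "('k::field) itself \<Rightarrow> nat \<Rightarrow> (nat \<Rightarrow> nat) \<Rightarrow> nat set \<Rightarrow> bool" where
  "homogeneous_type (_ :: 'k itself) d n S \<longleftrightarrow>
     (\<forall>i\<ge>1. betti d (semigroup_ring_module d n S :: ('k mpoly, 'k poly) module) i =
             betti d (tangent_cone_module d n S :: ('k mpoly, nat \<Rightarrow> 'k poly set) module) i)"

end

theory Submission
  imports Defs
begin

text \<open>Write \<open>N = n\<^sub>0\<close> and let \<open>order s\<close> be the largest length of a factorization of \<open>s\<close>.  The Rees-type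
  ring spanned by the \<open>t\<^sup>s u\<^sup>j\<close> with \<open>s \<in> S\<close> and \<open>j \<le> order s\<close> maps onto \<open>R\<close> (put \<open>u = 1\<close>) and
  onto \<open>G(S)\<close> (kill the \<open>t\<^sup>s u\<^sup>j\<close> with \<open>j < order s\<close>).  The Apery set of \<open>S\<close> with respect to \<open>N\<close>
  gives a basis of both images over \<open>k[x\<^sub>0]\<close>, because \<open>order (w + c N) = order w + c\<close> for \<open>w\<close> in the
  Apery set.  In this basis, multiplication by \<open>x\<^sub>l\<close>, \<open>l \<ge> 1\<close>, is a matrix \<open>X\<^sub>l\<close> over \<open>k[x\<^sub>0]\<close>, and
  the Koszul complex of the commuting operators \<open>x\<^sub>l - X\<^sub>l\<close> is a free resolution over \<open>P\<close>.  The
  matrices of \<open>R\<close> and of \<open>G(S)\<close> differ only in entries divisible by \<open>x\<^sub>0\<close>: if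
  \<open>n\<^sub>l + w\<close> is again in the Apery set, its order is \<open>order w + 1\<close>, so the product survives in
  \<open>G(S)\<close>.  Hence the two resolutions agree after tensoring with \<open>k\<close>.\<close>

subsection \<open>Homology of complexes of vector spaces\<close>

text \<open>\<open>betti\<close> is defined through an arbitrary free resolution, so exhibiting one
  for each module is not enough: the comparison theorem, by lifting and null homotopy, has to show
  that \<open>tor_dim\<close> agrees for all of them. The Koszul resolutions need not be minimal,
  since the matrices may have nonzero constant entries; so homology after tensoring is compared, not
  ranks. The Apery set is indexed by \<open>W < N\<close>: the element with index \<open>W\<close>
  is congruent to \<open>W * t\<close> modulo \<open>N\<close>, and \<open>t\<close> is a unit
  modulo \<open>N\<close>. Writing \<open>W\<close> with as few summands from \<open>1..d\<close> as
  possible takes \<open>W / d\<close> rounded up many of them, which yields both the element and its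
  order. When indices are added, each summand saved returns as \<open>h\<close> copies of
  \<open>N\<close> and each wrap past \<open>N\<close> as \<open>t\<close> copies;
  \<open>h \<ge> 1\<close> then makes the order superadditive. The matrices are not shown to commute
  by computing with this table: they describe multiplications in a commutative ring with respect to
  a basis, and that forces it. In the Rees-type ring both modules are handled by one argument, in
  which only the submodule that is divided out changes.\<close>

definition inj_mat :: "'a::semiring_0 mat \<Rightarrow> bool" where
  "inj_mat A \<longleftrightarrow>
     (\<forall>v\<in>carrier_vec (dim_col A). A *\<^sub>v v = 0\<^sub>v (dim_row A) \<longrightarrow> v = 0\<^sub>v (dim_col A))"

lemma zero_mat_mult_vec: "v \<in> carrier_vec q \<Longrightarrow> 0\<^sub>m p q *\<^sub>v v = 0\<^sub>v p"
  by (auto simp: vec_eq_iff)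

lemma mult_mat_zero_vec: "A \<in> carrier_mat p q \<Longrightarrow> A *\<^sub>v 0\<^sub>v q = 0\<^sub>v p"
  by (auto intro: eq_vecI)

lemma inj_matI:
  assumes "A \<in> carrier_mat a b"
    and "\<And>v. v \<in> carrier_vec b \<Longrightarrow> A *\<^sub>v v = 0\<^sub>v a \<Longrightarrow> v = 0\<^sub>v b"
  shows "inj_mat A"
  using assms by (auto simp: inj_mat_def)

lemma inj_matD:
  assumes "inj_mat A" "A \<in> carrier_mat a b" "v \<in> carrier_vec b" "A *\<^sub>v v = 0\<^sub>v a"
  shows "v = 0\<^sub>v b"
  using assms by (auto simp: inj_mat_def)

text \<open>If \<open>a < b\<close>, padding with zero rows gives a singular square matrix, and a
  kernel vector of it is also one of \<open>A\<close>.\<close>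

lemma inj_mat_dim_le:
  fixes A :: "'a::field mat"
  assumes A: "A \<in> carrier_mat a b" and inj: "inj_mat A"
  shows "b \<le> a"
proof (rule ccontr)
  assume "\<not> b \<le> a"
  then have ab: "a < b" by simp
  define M where "M = mat b b (\<lambda>(i, j). if i < a then A $$ (i, j) else 0)"
  have M: "M \<in> carrier_mat b b" by (simp add: M_def)
  \<comment> \<open>Row \<open>a\<close> of \<open>M\<close> is a padding row, hence zero.\<close>
  have "transpose_mat M *\<^sub>v unit_vec b a = 0\<^sub>v b"
    by (rule eq_vecI) (use ab in \<open>auto simp: M_def scalar_prod_right_unit\<close>)
  moreover have "unit_vec b a \<noteq> (0\<^sub>v b :: 'a vec)" using ab by (simp add: unit_vec_nonzero)
  ultimately have "det (transpose_mat M) = 0"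
    using det_0_iff_vec_prod_zero_field[of "transpose_mat M" b] M unit_vec_carrier[of b a]
    by (metis transpose_carrier_mat)
  then have "det M = 0" using M by (simp add: det_transpose)
  then obtain v where v: "v \<in> carrier_vec b" "v \<noteq> 0\<^sub>v b" "M *\<^sub>v v = 0\<^sub>v b"
    using det_0_iff_vec_prod_zero_field[OF M] by auto
  have "A *\<^sub>v v = 0\<^sub>v a"
  proof (rule eq_vecI)
    fix i assume "i < dim_vec (0\<^sub>v a :: 'a vec)"
    then have i: "i < a" by simp
    have "(M *\<^sub>v v) $ i = 0" using v(3) i ab by simp
    moreover have "row M i = row A i" using A i ab by (intro eq_vecI) (auto simp: M_def)
    ultimately show "(A *\<^sub>v v) $ i = 0\<^sub>v a $ i" using A M i ab by simp
  qed (use A in simp)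
  then show False using inj_matD[OF inj A] v by blast
qed

lemma factor_columns:
  fixes A D :: "'a::comm_semiring_0 mat"
  assumes A: "A \<in> carrier_mat r q" and D: "D \<in> carrier_mat r c"
    and ex: "\<And>j. j < q \<Longrightarrow> \<exists>w\<in>carrier_vec c. Q w \<and> D *\<^sub>v w = col A j"
  obtains X where "X \<in> carrier_mat c q" "\<And>j. j < q \<Longrightarrow> Q (col X j)" "D * X = A"
proof -
  obtain f where f: "\<And>j. j < q \<Longrightarrow> f j \<in> carrier_vec c \<and> Q (f j) \<and> D *\<^sub>v f j = col A j"
    using ex by metis
  define X where "X = mat c q (\<lambda>(i, j). f j $ i)"
  have X: "X \<in> carrier_mat c q" by (simp add: X_def)
  have col: "col X j = f j" if "j < q" for j
    using f[OF that] that by (intro eq_vecI) (auto simp: X_def)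
  show ?thesis
  proof (rule that[OF X])
    show "Q (col X j)" if "j < q" for j using f col that by simp
    show "D * X = A"
    proof (rule mat_col_eqI)
      fix j assume "j < dim_col A"
      then have j: "j < q" using A by simp
      show "col (D * X) j = col A j"
        using col_mult2[OF D X j] f[OF j] col[OF j] by simp
    qed (use A D X in auto)
  qed
qed

text \<open>Induction on the codimension \<open>a - b\<close>: a column outside the column space is
  appended until the matrix is square and invertible. The first \<open>b\<close> rows of a left
  inverse of the longer matrix form a left inverse of \<open>A\<close>.\<close>

lemma left_inverse_exists:
  fixes A :: "'a::field mat"
  assumes "A \<in> carrier_mat a b" and "inj_mat A"
  shows "\<exists>L\<in>carrier_mat b a. L * A = 1\<^sub>m b"
  using assms
proof (induction "a - b" arbitrary: b A)
  case 0
  then have b: "b = a" using inj_mat_dim_le[OF 0(2,3)] by simp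
  have A: "A \<in> carrier_mat a a" using 0 b by simp
  have "det A \<noteq> 0"
    using det_0_iff_vec_prod_zero_field[OF A] inj_matD[OF 0(3) A] by auto
  from det_non_zero_imp_unit[OF A this, of "()"] show ?case
    unfolding b Units_def by (auto simp: ring_mat_def)
next
  case (Suc k)
  note A = Suc(3) and inj = Suc(4)
  have ba: "b < a" using Suc(2) by simp
  \<comment> \<open>If every vector were attained, \<open>A\<close> would have a right inverse
    \<open>Z\<close>. That matrix is injective and has more columns than rows, contradicting
    \<open>inj_mat_dim_le\<close>.\<close>
  obtain v where v: "v \<in> carrier_vec a" "\<And>w. w \<in> carrier_vec b \<Longrightarrow> A *\<^sub>v w \<noteq> v"
  proof (rule ccontr)
    assume "\<not> thesis"
    then have sur: "\<And>v. v \<in> carrier_vec a \<Longrightarrow> \<exists>w\<in>carrier_vec b. A *\<^sub>v w = v"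
      using that by blast
    obtain Z where Z: "Z \<in> carrier_mat b a" "A * Z = 1\<^sub>m a"
      by (rule factor_columns[of "1\<^sub>m a" a a A b "\<lambda>_. True"]) (use A sur in auto)
    have "inj_mat Z"
    proof (rule inj_matI[OF Z(1)])
      fix v assume v: "v \<in> carrier_vec a" "Z *\<^sub>v v = 0\<^sub>v b"
      have "v = A *\<^sub>v (Z *\<^sub>v v)" using assoc_mult_mat_vec[OF A Z(1) v(1)] Z(2) v(1) by simp
      then show "v = 0\<^sub>v a" using mult_mat_zero_vec[OF A] v by simp
    qed
    then show False using inj_mat_dim_le[OF Z(1)] ba by simp
  qed
  define A' where "A' = mat a (Suc b) (\<lambda>(i, j). if j < b then A $$ (i, j) else v $ i)"
  have A': "A' \<in> carrier_mat a (Suc b)" by (simp add: A'_def)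
  have colA': "col A' j = (if j < b then col A j else v)" if "j < Suc b" for j
    using that A v(1) by (intro eq_vecI) (auto simp: A'_def)
  have mv: "A' *\<^sub>v w = A *\<^sub>v vec b (\<lambda>i. w $ i) + w $ b \<cdot>\<^sub>v v" if "w \<in> carrier_vec (Suc b)" for w
    using that A v(1)
    by (intro eq_vecI)
       (auto simp: A'_def scalar_prod_def row_def lessThan_Suc atLeast0LessThan mult.commute intro!: sum.cong)
  have inj': "inj_mat A'"
  proof (rule inj_matI[OF A'])
    fix w assume w: "w \<in> carrier_vec (Suc b)" "A' *\<^sub>v w = 0\<^sub>v a"
    define u where "u = vec b (\<lambda>i. w $ i)"
    have u: "u \<in> carrier_vec b" by (simp add: u_def)
    have eq: "A *\<^sub>v u + w $ b \<cdot>\<^sub>v v = 0\<^sub>v a" using mv[OF w(1)] w(2) by (simp add: u_def)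
    have wb: "w $ b = 0"
    proof (rule ccontr)
      assume nz: "w $ b \<noteq> 0"
      have "A *\<^sub>v ((- 1 / w $ b) \<cdot>\<^sub>v u) = v"
      proof (rule eq_vecI)
        fix i assume "i < dim_vec v"
        then have i: "i < a" using v by simp
        have "(A *\<^sub>v u + w $ b \<cdot>\<^sub>v v) $ i = 0" using eq i by simp
        then have "(A *\<^sub>v u) $ i + w $ b * v $ i = 0" using i A v by simp
        then have "w $ b * v $ i = - (A *\<^sub>v u) $ i" by (simp add: eq_neg_iff_add_eq_0 add.commute)
        moreover have "v $ i = (w $ b * v $ i) / w $ b" using nz by simp
        ultimately have "v $ i = (- 1 / w $ b) * (A *\<^sub>v u) $ i" by simp
        moreover have "i < dim_vec (A *\<^sub>v u)" using A i by simp
        ultimately show "(A *\<^sub>v ((- 1 / w $ b) \<cdot>\<^sub>v u)) $ i = v $ i"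
          unfolding mult_mat_vec[OF A u] using index_smult_vec(1) by metis
      qed (use A v in simp)
      then show False using v(2)[of "(- 1 / w $ b) \<cdot>\<^sub>v u"] u by simp
    qed
    then have "w $ b \<cdot>\<^sub>v v = 0\<^sub>v a" using v(1) by (simp add: vec_eq_iff)
    then have "A *\<^sub>v u = 0\<^sub>v a" using eq A u by simp
    then have "u = 0\<^sub>v b" using inj_matD[OF inj A u] by simp
    then have "w $ i = 0" if "i < b" for i
      using that by (metis index_vec index_zero_vec(1) u_def)
    then show "w = 0\<^sub>v (Suc b)" using wb w(1) by (auto simp: vec_eq_iff less_Suc_eq)
  qed
  have "k = a - Suc b" using Suc(2) by simp
  from Suc(1)[OF this A' inj'] obtain L where L: "L \<in> carrier_mat (Suc b) a" "L * A' = 1\<^sub>m (Suc b)"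
    by blast
  define L' where "L' = mat b a (\<lambda>(i, j). L $$ (i, j))"
  have "L' * A = 1\<^sub>m b"
  proof (rule eq_matI)
    fix i j assume ij: "i < dim_row (1\<^sub>m b)" "j < dim_col (1\<^sub>m b)"
    have "row L' i = row L i" using L ij by (intro eq_vecI) (auto simp: L'_def)
    then have "(L' * A) $$ (i, j) = (L * A') $$ (i, j)"
      using ij L(1) A A' colA'[of j] by (simp add: L'_def)
    moreover have "(L * A') $$ (i, j) = 1\<^sub>m (Suc b) $$ (i, j)" by (simp only: L(2))
    ultimately show "(L' * A) $$ (i, j) = 1\<^sub>m b $$ (i, j)" using ij by simp
  qed (use A in \<open>auto simp: L'_def\<close>)
  moreover have "L' \<in> carrier_mat b a" by (simp add: L'_def)
  ultimately show ?case by blast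
qed

text \<open>The columns of \<open>K\<close> are a basis of \<open>W\<close>.\<close>

lemma (in vec_space) subspace_matrix:
  assumes W: "submodule class_ring W V" and fd: "vectorspace.fin_dim class_ring (vs W)"
  obtains K where "K \<in> carrier_mat n (vectorspace.dim class_ring (vs W))" "inj_mat K"
    "(\<lambda>v. K *\<^sub>v v) ` carrier_vec (vectorspace.dim class_ring (vs W)) = W"
proof -
  interpret Ws: vectorspace class_ring "vs W"
    using W by (simp add: subspace_is_vs subspace_def vectorspace_axioms)
  obtain \<beta> where \<beta>: "finite \<beta>" "Ws.basis \<beta>" using Ws.finite_basis_exists[OF fd] by blast
  have \<beta>W: "\<beta> \<subseteq> W" using \<beta>(2) by (simp add: Ws.basis_def)
  have WV: "W \<subseteq> carrier_vec n" using W by (simp add: submodule_def)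
  have li: "lin_indpt \<beta>" and sp: "span \<beta> = W"
    using \<beta>(2) span_li_not_depend[OF \<beta>W W] by (auto simp: Ws.basis_def)
  obtain xs where xs: "set xs = \<beta>" "distinct xs" using finite_distinct_list[OF \<beta>(1)] by blast
  define K where "K = mat_of_cols n xs"
  have d: "Ws.dim = length xs" using Ws.dim_basis[OF \<beta>] xs by (metis distinct_card)
  have cx: "cols K = xs" using xs \<beta>W WV by (simp add: K_def)
  have K: "K \<in> carrier_mat n (length xs)" by (simp add: K_def)
  have "inj_mat K"
    using lin_depI[OF K] li xs cx by (intro inj_matI[OF K]) auto
  moreover have "(\<lambda>v. K *\<^sub>v v) ` carrier_vec (length xs) = W"
  proof -
    have "col_space K = W" by (simp add: col_space_def cx xs sp)
    then show ?thesis using col_space_eq[OF K] K by force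
  qed
  ultimately show ?thesis using that[of K] K d by simp
qed

lemma kernel_matrix:
  fixes A :: "'a::field mat"
  assumes A: "A \<in> carrier_mat nr nc"
  obtains K where "K \<in> carrier_mat nc (kernel_dim A)" "inj_mat K"
    "(\<lambda>v. K *\<^sub>v v) ` carrier_vec (kernel_dim A) = mat_kernel A"
proof -
  interpret kernel nr nc A by unfold_locales (rule A)
  obtain \<beta> where "finite \<beta>" "basis \<beta>" using kernel_basis_exists[OF A] by blast
  then have fd: "Ker.fin_dim" unfolding Ker.fin_dim_def Ker.basis_def by auto
  have "submodule class_ring (mat_kernel A) NC.V"
    by (unfold_locales)
       (insert A mult_add_distrib_mat_vec[OF A] mult_mat_vec[OF A] mat_kernel[OF A],
        auto simp: class_ring_simps module_vec_simps)
  from NC.subspace_matrix[OF this fd] show ?thesis using that unfolding kernel_dim by blast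
qed

lemma image_matrix:
  fixes B :: "'a::field mat"
  assumes B: "B \<in> carrier_mat n q"
  obtains U where "U \<in> carrier_mat n (vec_space.rank n B)" "inj_mat U"
    "(\<lambda>v. U *\<^sub>v v) ` carrier_vec (vec_space.rank n B) = (\<lambda>v. B *\<^sub>v v) ` carrier_vec q"
proof -
  interpret vec_space "TYPE('a)" n .
  have c: "set (cols B) \<subseteq> carrier_vec n" using B cols_dim by blast
  have "(\<lambda>v. B *\<^sub>v v) ` carrier_vec q = span (set (cols B))"
    using col_space_eq[OF B] B by (force simp: col_space_def)
  moreover have "submodule class_ring (span (set (cols B))) V"
    using span_is_submodule[of "set (cols B)"] c by simp
  moreover have "vectorspace.fin_dim class_ring (span_vs (set (cols B)))"
    using fin_dim_span[of "set (cols B)"] c by simp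
  ultimately show ?thesis
    using subspace_matrix[of "span (set (cols B))"] that unfolding rank_def by metis
qed

text \<open>By \<open>ker\<close> and \<open>im\<close>, \<phi> induces an injection on homology.
  The resulting inequality between the differences \<open>kernel_dim - rank\<close> is written with
  sums to avoid truncated subtraction.\<close>

lemma homology_dim_le:
  fixes A A' B B' \<phi> :: "'a::field mat"
  assumes A: "A \<in> carrier_mat p n" and B: "B \<in> carrier_mat n q"
    and A': "A' \<in> carrier_mat p' n'" and B': "B' \<in> carrier_mat n' q'"
    and \<phi>: "\<phi> \<in> carrier_mat n' n"
    and AB: "A * B = 0\<^sub>m p q" and AB': "A' * B' = 0\<^sub>m p' q'"
    and ker: "\<And>v. v \<in> mat_kernel A \<Longrightarrow> \<phi> *\<^sub>v v \<in> mat_kernel A'"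
    and im: "\<And>v w. v \<in> mat_kernel A \<Longrightarrow> w \<in> carrier_vec q' \<Longrightarrow> \<phi> *\<^sub>v v = B' *\<^sub>v w \<Longrightarrow>
               \<exists>u\<in>carrier_vec q. v = B *\<^sub>v u"
  shows "kernel_dim A + vec_space.rank n' B' \<le> kernel_dim A' + vec_space.rank n B"
proof -
  let ?k = "kernel_dim A" and ?k' = "kernel_dim A'"
  let ?r = "vec_space.rank n B" and ?r' = "vec_space.rank n' B'"
  obtain K where K: "K \<in> carrier_mat n ?k" "inj_mat K" "(\<lambda>v. K *\<^sub>v v) ` carrier_vec ?k = mat_kernel A"
    by (rule kernel_matrix[OF A])
  obtain K' where K': "K' \<in> carrier_mat n' ?k'" "inj_mat K'"
      "(\<lambda>v. K' *\<^sub>v v) ` carrier_vec ?k' = mat_kernel A'"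
    by (rule kernel_matrix[OF A'])
  obtain U where U: "U \<in> carrier_mat n ?r" "inj_mat U"
      "(\<lambda>v. U *\<^sub>v v) ` carrier_vec ?r = (\<lambda>v. B *\<^sub>v v) ` carrier_vec q"
    by (rule image_matrix[OF B])
  obtain U' where U': "U' \<in> carrier_mat n' ?r'" "inj_mat U'"
      "(\<lambda>v. U' *\<^sub>v v) ` carrier_vec ?r' = (\<lambda>v. B' *\<^sub>v v) ` carrier_vec q'"
    by (rule image_matrix[OF B'])
  have B_ker: "B *\<^sub>v w \<in> mat_kernel A" if "w \<in> carrier_vec q" for w
    using AB assoc_mult_mat_vec[OF A B that] that A B by (intro mat_kernelI[OF A]) (auto simp: zero_mat_mult_vec)
  have B'_ker: "B' *\<^sub>v w \<in> mat_kernel A'" if "w \<in> carrier_vec q'" for w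
    using AB' assoc_mult_mat_vec[OF A' B' that] that A' B' by (intro mat_kernelI[OF A']) (auto simp: zero_mat_mult_vec)
  have U_ker: "U *\<^sub>v w \<in> mat_kernel A" if "w \<in> carrier_vec ?r" for w
    using U(3) that B_ker by (metis (no_types, lifting) imageE imageI)
  have U'_ker: "U' *\<^sub>v w \<in> mat_kernel A'" if "w \<in> carrier_vec ?r'" for w
    using U'(3) that B'_ker by (metis (no_types, lifting) imageE imageI)
  have colmul: "col M j = M *\<^sub>v unit_vec c j" if "M \<in> carrier_mat a c" "j < c" for M :: "'a mat" and a c j
    using that by (intro eq_vecI) (auto simp: scalar_prod_right_unit)
  obtain Y where Y: "Y \<in> carrier_mat ?k ?r" "K * Y = U"
  proof (rule factor_columns[OF U(1) K(1), where Q = "\<lambda>_. True"])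
    fix j assume j: "j < ?r"
    have "col U j \<in> mat_kernel A" using U_ker[of "unit_vec ?r j"] colmul[OF U(1) j] by simp
    then show "\<exists>w\<in>carrier_vec ?k. True \<and> K *\<^sub>v w = col U j" unfolding K(3)[symmetric] by force
  qed
  have "inj_mat Y"
  proof (rule inj_matI[OF Y(1)])
    fix v assume v: "v \<in> carrier_vec ?r" "Y *\<^sub>v v = 0\<^sub>v ?k"
    have "U *\<^sub>v v = 0\<^sub>v n" using assoc_mult_mat_vec[OF K(1) Y(1) v(1)] v(2) Y(2) mult_mat_zero_vec[OF K(1)] by simp
    then show "v = 0\<^sub>v ?r" using inj_matD[OF U(2) U(1) v(1)] by simp
  qed
  then obtain L where L: "L \<in> carrier_mat ?r ?k" "L * Y = 1\<^sub>m ?r"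
    using left_inverse_exists[OF Y(1)] by blast
  obtain X where X: "X \<in> carrier_mat ?k' ?k" "K' * X = \<phi> * K"
  proof (rule factor_columns[of "\<phi> * K" n' ?k K' ?k' "\<lambda>_. True"])
    fix j assume j: "j < ?k"
    have "col K j \<in> mat_kernel A" using K(3) colmul[OF K(1) j] by (metis imageI unit_vec_carrier)
    then have "col (\<phi> * K) j \<in> mat_kernel A'" using ker col_mult2[OF \<phi> K(1) j] by simp
    then show "\<exists>w\<in>carrier_vec ?k'. True \<and> K' *\<^sub>v w = col (\<phi> * K) j"
      unfolding K'(3)[symmetric] by force
  qed (use \<phi> K K' in auto)
  obtain X' where X': "X' \<in> carrier_mat ?k' ?r'" "K' * X' = U'"
  proof (rule factor_columns[OF U'(1) K'(1), where Q = "\<lambda>_. True"])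
    fix j assume j: "j < ?r'"
    have "col U' j \<in> mat_kernel A'" using U'_ker[of "unit_vec ?r' j"] colmul[OF U'(1) j] by simp
    then show "\<exists>w\<in>carrier_vec ?k'. True \<and> K' *\<^sub>v w = col U' j"
      unfolding K'(3)[symmetric] by force
  qed
  \<comment> \<open>\<open>M\<close> sends \<open>(y, z)\<close> to
    \<open>(X y + X' z, L y)\<close>, with \<open>y\<close> the coordinates of a cycle and
    \<open>z\<close> those of a boundary on the primed side. If both entries vanish, the cycle is
    mapped to a boundary, so it is a boundary itself: \<open>y = Y x\<close> with
    \<open>x = L y = 0\<close>.\<close>
  define M where "M = four_block_mat X X' L (0\<^sub>m ?r ?r')"
  have M: "M \<in> carrier_mat (?k' + ?r) (?k + ?r')"
    using X X' L by (simp add: M_def)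
  have "inj_mat M"
  proof (rule inj_matI[OF M])
    fix v assume v: "v \<in> carrier_vec (?k + ?r')" "M *\<^sub>v v = 0\<^sub>v (?k' + ?r)"
    define y where "y = vec_first v ?k"
    define z where "z = vec_last v ?r'"
    have yz: "y \<in> carrier_vec ?k" "z \<in> carrier_vec ?r'" "v = y @\<^sub>v z"
      using v(1) by (auto simp: y_def z_def)
    have "M *\<^sub>v v = (X *\<^sub>v y + X' *\<^sub>v z) @\<^sub>v (L *\<^sub>v y + 0\<^sub>m ?r ?r' *\<^sub>v z)"
      unfolding M_def yz(3) by (rule four_block_mat_mult_vec) (use X X' L yz in auto)
    moreover have "0\<^sub>v (?k' + ?r) = 0\<^sub>v ?k' @\<^sub>v (0\<^sub>v ?r :: 'a vec)"
      by (auto simp: vec_eq_iff)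
    ultimately have "X *\<^sub>v y + X' *\<^sub>v z = 0\<^sub>v ?k' \<and> L *\<^sub>v y + 0\<^sub>m ?r ?r' *\<^sub>v z = 0\<^sub>v ?r"
      using v(2) append_vec_eq[of "X *\<^sub>v y + X' *\<^sub>v z" ?k' "0\<^sub>v ?k'"] X X' yz by simp
    then have 1: "X *\<^sub>v y + X' *\<^sub>v z = 0\<^sub>v ?k'" and 2: "L *\<^sub>v y = 0\<^sub>v ?r"
      using L yz by (auto simp: zero_mat_mult_vec)
    have "K' *\<^sub>v (X *\<^sub>v y + X' *\<^sub>v z) = \<phi> *\<^sub>v (K *\<^sub>v y) + U' *\<^sub>v z"
      using X X' K K' \<phi> U' yz
      by (simp add: mult_add_distrib_mat_vec[OF K'(1)] flip: assoc_mult_mat_vec)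
    then have 3: "\<phi> *\<^sub>v (K *\<^sub>v y) + U' *\<^sub>v z = 0\<^sub>v n'" using 1 mult_mat_zero_vec[OF K'(1)] by simp
    have Ky: "K *\<^sub>v y \<in> mat_kernel A" using K(3) yz(1) by blast
    have "\<phi> *\<^sub>v (K *\<^sub>v y) = U' *\<^sub>v (- z)"
      using 3 \<phi> U' yz K by (auto simp: vec_eq_iff eq_neg_iff_add_eq_0)
    moreover have "U' *\<^sub>v (- z) \<in> (\<lambda>v. B' *\<^sub>v v) ` carrier_vec q'"
      using U'(3) yz(2) by (metis imageI uminus_carrier_vec)
    ultimately obtain w where "w \<in> carrier_vec q'" "\<phi> *\<^sub>v (K *\<^sub>v y) = B' *\<^sub>v w" by auto
    from im[OF Ky this] obtain u where u: "u \<in> carrier_vec q" "K *\<^sub>v y = B *\<^sub>v u" by blast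
    then obtain x where x: "x \<in> carrier_vec ?r" "K *\<^sub>v y = U *\<^sub>v x"
      using U(3) by (metis (no_types, lifting) imageE imageI)
    have "K *\<^sub>v (y - Y *\<^sub>v x) = 0\<^sub>v n"
      using x Y K yz mult_minus_distrib_mat_vec[OF K(1) yz(1), of "Y *\<^sub>v x"]
        assoc_mult_mat_vec[OF K(1) Y(1) x(1)] U by simp
    then have "y - Y *\<^sub>v x = 0\<^sub>v ?k" using inj_matD[OF K(2) K(1)] Y x yz by simp
    then have y: "y = Y *\<^sub>v x" using Y x yz by (auto simp: vec_eq_iff)
    have "x = L *\<^sub>v y" using assoc_mult_mat_vec[OF L(1) Y(1) x(1)] L(2) x(1) y by simp
    then have "y = 0\<^sub>v ?k" using 2 y mult_mat_zero_vec[OF Y(1)] by simp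
    then have "U' *\<^sub>v z = 0\<^sub>v n'"
      using 3 U' yz mult_mat_zero_vec[OF K(1)] mult_mat_zero_vec[OF \<phi>] by simp
    then have "z = 0\<^sub>v ?r'" using inj_matD[OF U'(2) U'(1)] yz by simp
    then show "v = 0\<^sub>v (?k + ?r')" using \<open>y = 0\<^sub>v ?k\<close> yz(3) by (auto simp: vec_eq_iff)
  qed
  from inj_mat_dim_le[OF M this] show ?thesis .
qed

subsection \<open>Evaluation of polynomials\<close>

abbreviation lookup where "lookup \<equiv> Poly_Mapping.lookup"
abbreviation keys where "keys \<equiv> Poly_Mapping.keys"
abbreviation single where "single \<equiv> Poly_Mapping.single"

lemma poly_mapping_eq_sum_single: "p = (\<Sum>m\<in>keys p. single m (lookup p m))"
  by (rule poly_mapping_eqI) (auto simp: lookup_sum lookup_single when_def in_keys_iff)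

lemma poly_mapping_additive_induct [case_names zero single add]:
  assumes "P 0" "\<And>m c. P (single m c)" "\<And>p q. P p \<Longrightarrow> P q \<Longrightarrow> P (p + q)"
  shows "P (p :: _ \<Rightarrow>\<^sub>0 'b::comm_monoid_add)"
proof -
  have "P (\<Sum>m\<in>A. single m (lookup p m))" if "finite A" for A
    using that by (induction A) (auto intro: assms)
  then show ?thesis by (subst poly_mapping_eq_sum_single) simp
qed

definition mconst :: "'k::zero \<Rightarrow> 'k mpoly" where "mconst c = single 0 c"
definition mvar :: "nat \<Rightarrow> 'k::zero_neq_one mpoly" where "mvar i = single (single i 1) 1"

lemma polysD: "p \<in> polys d \<Longrightarrow> m \<in> keys p \<Longrightarrow> keys m \<subseteq> {..d}"
  by (auto simp: polys_def)

lemma polys_subset_keys: "keys p \<subseteq> keys q \<Longrightarrow> q \<in> polys d \<Longrightarrow> p \<in> polys d"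
  by (auto simp: polys_def)

lemma polys_mono: "p \<in> polys d \<Longrightarrow> d \<le> e \<Longrightarrow> p \<in> polys e"
  by (fastforce simp: polys_def)

lemma polys_zero [simp]: "0 \<in> polys d" by (simp add: polys_def)

lemma polys_one [simp]: "1 \<in> polys d" by (simp add: polys_def)

lemma polys_const [simp]: "mconst c \<in> polys d" by (simp add: polys_def mconst_def)

lemma polys_var [simp]: "i \<le> d \<Longrightarrow> mvar i \<in> polys d" by (simp add: polys_def mvar_def)

lemma polys_add: "p \<in> polys d \<Longrightarrow> q \<in> polys d \<Longrightarrow> p + q \<in> polys d"
  using Poly_Mapping.keys_add[of p q] by (fastforce simp: polys_def)

lemma polys_uminus: "p \<in> polys d \<Longrightarrow> - p \<in> polys (d::nat)" for p :: "'k::ab_group_add mpoly"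
  by (rule polys_subset_keys) (auto simp: in_keys_iff)

lemma polys_diff: "p \<in> polys d \<Longrightarrow> q \<in> polys d \<Longrightarrow> p - q \<in> polys d"
  for p q :: "'k::ab_group_add mpoly"
  unfolding diff_conv_add_uminus by (intro polys_add polys_uminus)

lemma polys_mult:
  fixes p q :: "'k::semiring_0 mpoly"
  assumes "p \<in> polys d" "q \<in> polys d"
  shows "p * q \<in> polys d"
  unfolding polys_def
proof clarify
  fix m i assume "m \<in> keys (p * q)" and i: "i \<in> keys m"
  then obtain a b where ab: "a \<in> keys p" "b \<in> keys q" "m = a + b"
    using keys_mult by blast
  then have "i \<in> keys a \<union> keys b" using i Poly_Mapping.keys_add[of a b] by auto
  then show "i \<le> d" using polysD[OF assms(1) ab(1)] polysD[OF assms(2) ab(2)] by auto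
qed

lemma polys_sum: "(\<And>i. i \<in> I \<Longrightarrow> f i \<in> polys d) \<Longrightarrow> sum f I \<in> polys d"
  for f :: "_ \<Rightarrow> 'k::comm_monoid_add mpoly"
  by (induction I rule: infinite_finite_induct) (auto intro: polys_add)

lemma polys_power: "p \<in> polys d \<Longrightarrow> p ^ n \<in> polys d" for p :: "'k::comm_semiring_1 mpoly"
  by (induction n) (auto intro: polys_mult)

lemmas polys_intros = polys_add polys_uminus polys_diff polys_mult polys_sum polys_power

definition mon :: "(nat \<Rightarrow> 'a::comm_monoid_mult) \<Rightarrow> (nat \<Rightarrow>\<^sub>0 nat) \<Rightarrow> 'a" where
  "mon a m = (\<Prod>i\<in>keys m. a i ^ lookup m i)"

lemma mon_superset:
  assumes "finite I" "keys m \<subseteq> I"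
  shows "mon a m = (\<Prod>i\<in>I. a i ^ lookup m i)"
  unfolding mon_def using assms by (intro prod.mono_neutral_left) (auto simp: in_keys_iff)

lemma mon_0 [simp]: "mon a 0 = 1" by (simp add: mon_def)

lemma mon_single [simp]: "mon a (single i k) = a i ^ k"
  by (cases "k = 0") (simp_all add: mon_def)

lemma mon_add: "mon a (m + n) = mon a m * mon a n"
proof -
  let ?I = "keys m \<union> keys n"
  have "mon a (m + n) = (\<Prod>i\<in>?I. a i ^ lookup (m + n) i)"
    by (rule mon_superset) (auto simp: Poly_Mapping.keys_add)
  also have "\<dots> = (\<Prod>i\<in>?I. a i ^ lookup m i) * (\<Prod>i\<in>?I. a i ^ lookup n i)"
    by (simp add: lookup_add power_add prod.distrib)
  finally show ?thesis by (simp flip: mon_superset)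
qed

text \<open>Counterpart of \<open>eval_at\<close> in a type of class \<open>comm_semiring_1\<close>,
  where the arithmetic of type classes is available. \<open>eval_at_image\<close> leads back to
  \<open>eval_at\<close>.\<close>

definition meval :: "('k::zero \<Rightarrow> 'a::comm_semiring_1) \<Rightarrow> (nat \<Rightarrow> 'a) \<Rightarrow> 'k mpoly \<Rightarrow> 'a" where
  "meval \<eta> a p = (\<Sum>m\<in>keys p. \<eta> (lookup p m) * mon a m)"

lemma meval_superset:
  assumes "\<eta> 0 = 0" "finite I" "keys p \<subseteq> I"
  shows "meval \<eta> a p = (\<Sum>m\<in>I. \<eta> (lookup p m) * mon a m)"
  unfolding meval_def using assms by (intro sum.mono_neutral_left) (auto simp: in_keys_iff)

lemma meval_single: "\<eta> 0 = 0 \<Longrightarrow> meval \<eta> a (single m c) = \<eta> c * mon a m"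
  by (cases "c = 0") (simp_all add: meval_def)

lemma meval_const: "\<eta> 0 = 0 \<Longrightarrow> meval \<eta> a (mconst c) = \<eta> c"
  by (simp add: mconst_def meval_single)

lemma meval_var: "\<eta> 0 = 0 \<Longrightarrow> \<eta> 1 = 1 \<Longrightarrow> meval \<eta> a (mvar i) = a i"
  by (simp add: mvar_def meval_single)

lemma meval_hom:
  fixes \<eta> :: "'k::comm_ring_1 \<Rightarrow> 'a::comm_ring_1"
  assumes "comm_ring_hom \<eta>"
  shows "comm_ring_hom (meval \<eta> a)"
proof -
  interpret comm_ring_hom \<eta> by fact
  have add: "meval \<eta> a (p + q) = meval \<eta> a p + meval \<eta> a q" for p q
  proof -
    let ?I = "keys p \<union> keys q"
    have "meval \<eta> a (p + q) = (\<Sum>m\<in>?I. \<eta> (lookup (p + q) m) * mon a m)"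
      by (rule meval_superset) (auto simp: Poly_Mapping.keys_add)
    also have "\<dots> = (\<Sum>m\<in>?I. \<eta> (lookup p m) * mon a m) + (\<Sum>m\<in>?I. \<eta> (lookup q m) * mon a m)"
      by (simp add: lookup_add hom_add algebra_simps sum.distrib)
    finally show ?thesis by (simp flip: meval_superset)
  qed
  have "meval \<eta> a (p * q) = meval \<eta> a p * meval \<eta> a q" for p q
  proof (induction p rule: poly_mapping_additive_induct)
    case (single m c)
    show ?case
      by (induction q rule: poly_mapping_additive_induct)
         (simp_all add: meval_single mult_single mon_add hom_mult add algebra_simps, simp add: meval_def)
  qed (simp_all add: add algebra_simps, simp add: meval_def)
  with add show ?thesis
    by unfold_locales (simp_all add: meval_single meval_def flip: single_one)
qed

lemma single_eq_prod_mvar: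
  "single m c = mconst c * mon mvar m" for c :: "'k::comm_ring_1"
proof -
  have pw: "mvar i ^ k = (single (single i k) 1 :: 'k mpoly)" for i k
    by (induction k) (simp_all add: mvar_def mult_single flip: single_add)
  have "(\<Prod>i\<in>I. mvar i ^ lookup m i) = (single (\<Sum>i\<in>I. single i (lookup m i)) 1 :: 'k mpoly)"
    if "finite I" for I
    using that by (induction I) (simp_all add: pw mult_single)
  then have "mon mvar m = (single m 1 :: 'k mpoly)"
    unfolding mon_def using poly_mapping_eq_sum_single[of m] by simp
  then show ?thesis by (simp add: mconst_def mult_single)
qed

lemma mpoly_hom_eqI:
  fixes f g :: "'k::comm_ring_1 mpoly \<Rightarrow> 'a::comm_ring_1"
  assumes "comm_ring_hom f" "comm_ring_hom g"
    and const: "\<And>c. f (mconst c) = g (mconst c)"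
    and var: "\<And>i. i \<le> d \<Longrightarrow> f (mvar i) = g (mvar i)"
    and p: "p \<in> polys d"
  shows "f p = g p"
proof -
  interpret f: comm_ring_hom f by fact
  interpret g: comm_ring_hom g by fact
  have "f (single m c) = g (single m c)" if "m \<in> keys p" for m c
  proof -
    have "f (mon mvar m) = g (mon mvar m)"
      unfolding mon_def f.hom_prod g.hom_prod
      using polysD[OF p that] by (intro prod.cong) (auto simp: f.hom_power g.hom_power var)
    then show ?thesis by (simp add: single_eq_prod_mvar f.hom_mult g.hom_mult const)
  qed
  then show ?thesis
    by (subst (1 2) poly_mapping_eq_sum_single) (simp add: f.hom_sum g.hom_sum)
qed

lemma meval_closed:
  fixes \<eta> :: "'k::comm_ring_1 \<Rightarrow> 'a::comm_ring_1"
  assumes "0 \<in> Q" "1 \<in> Q" "\<And>x y. x \<in> Q \<Longrightarrow> y \<in> Q \<Longrightarrow> x + y \<in> Q"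
    "\<And>x y. x \<in> Q \<Longrightarrow> y \<in> Q \<Longrightarrow> x * y \<in> Q" "\<And>c. \<eta> c \<in> Q" "\<And>i. i \<le> d \<Longrightarrow> a i \<in> Q"
    and p: "p \<in> polys d"
  shows "meval \<eta> a p \<in> Q"
proof -
  have sum: "sum f I \<in> Q" if "\<And>i. i \<in> I \<Longrightarrow> f i \<in> Q" for f and I :: "(nat \<Rightarrow>\<^sub>0 nat) set"
    using that by (induction I rule: infinite_finite_induct) (auto intro: assms)
  have prod: "prod f I \<in> Q" if "\<And>i. i \<in> I \<Longrightarrow> f i \<in> Q" for f and I :: "nat set"
    using that by (induction I rule: infinite_finite_induct) (auto intro: assms)
  have pow: "x ^ k \<in> Q" if "x \<in> Q" for x k
    using that by (induction k) (auto intro: assms)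
  show ?thesis
    unfolding meval_def mon_def using polysD[OF p]
    by (intro sum assms(4) prod pow assms(5,6)) auto
qed

lemma lookup_mult_0: "lookup (p * q) 0 = lookup p 0 * lookup q 0" for p q :: "'k::comm_ring_1 mpoly"
proof -
  have *: "m + n = 0 \<longleftrightarrow> m = 0 \<and> n = 0" for m n :: "nat \<Rightarrow>\<^sub>0 nat"
    by (auto simp: poly_mapping_eq_iff lookup_add fun_eq_iff)
  show ?thesis
  proof (induction p rule: poly_mapping_additive_induct)
    case (single m c)
    show ?case
      by (induction q rule: poly_mapping_additive_induct)
         (auto simp: mult_single lookup_single when_def * lookup_add algebra_simps)
  qed (simp_all add: lookup_add algebra_simps)
qed

lemma const_term_hom: "comm_ring_hom (\<lambda>p :: 'k::comm_ring_1 mpoly. lookup p 0)"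
  by unfold_locales (simp_all add: lookup_add lookup_mult_0)

subsection \<open>Polynomials as polynomials in the last variable\<close>

text \<open>Splits off one variable. The exactness proof for the Koszul complex adjoins the
  variables one at a time and argues with coefficients in the last one.\<close>

definition mcoeffs :: "nat \<Rightarrow> 'k::comm_ring_1 mpoly \<Rightarrow> 'k mpoly poly" where
  "mcoeffs l = meval (\<lambda>c. [:mconst c:]) (\<lambda>i. if i = l then [:0, 1:] else [:mvar i:])"

lemma mconst_hom: "comm_ring_hom (mconst :: 'k::comm_ring_1 \<Rightarrow> 'k mpoly)"
  by unfold_locales (simp_all add: mconst_def mult_single single_add)

lemma pCons_hom: "comm_ring_hom (\<lambda>c :: 'a::comm_ring_1. [:c:])"
  by unfold_locales (simp_all add: one_pCons)

lemma pCons_mconst_hom: "comm_ring_hom (\<lambda>c :: 'k::comm_ring_1. [:mconst c:])"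
proof -
  interpret comm_ring_hom "mconst :: 'k \<Rightarrow> 'k mpoly" by (rule mconst_hom)
  show ?thesis by unfold_locales (simp_all add: one_pCons hom_distribs)
qed

lemma mcoeffs_hom: "comm_ring_hom (mcoeffs l)"
  unfolding mcoeffs_def by (rule meval_hom[OF pCons_mconst_hom])

lemma mconst_0 [simp]: "mconst 0 = (0 :: 'k::comm_ring_1 mpoly)" by (simp add: mconst_def)
lemma mconst_1 [simp]: "mconst 1 = (1 :: 'k::comm_ring_1 mpoly)" by (simp add: mconst_def)

lemma mcoeffs_const: "mcoeffs l (mconst c) = [:mconst c:]"
  by (simp add: mcoeffs_def meval_const)

lemma mcoeffs_var: "mcoeffs l (mvar i) = (if i = l then [:0, 1:] else [:mvar i:])"
  unfolding mcoeffs_def by (subst meval_var) (simp_all add: one_pCons)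

lemma mcoeffs_lower: "p \<in> polys j \<Longrightarrow> j < l \<Longrightarrow> mcoeffs l p = [:p:]"
  by (rule mpoly_hom_eqI[OF mcoeffs_hom pCons_hom, of _ j]) (auto simp: mcoeffs_const mcoeffs_var)

lemma poly_mcoeffs: "poly (mcoeffs l p) (mvar l) = p"
proof -
  interpret comm_ring_hom "mcoeffs l :: 'a mpoly \<Rightarrow> _" by (rule mcoeffs_hom)
  show ?thesis
  \<comment> \<open>Any bound on the indices of the variables that occur in \<open>p\<close> will
    do.\<close>
  proof (rule mpoly_hom_eqI[where g = "\<lambda>p. p" and d = "Max (\<Union>(keys ` keys p))"])
    show "comm_ring_hom (\<lambda>p :: 'a mpoly. poly (mcoeffs l p) (mvar l))"
      by unfold_locales (simp_all add: hom_distribs)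
    show "comm_ring_hom (\<lambda>p :: 'a mpoly. p)" by unfold_locales simp_all
    show "p \<in> polys (Max (\<Union>(keys ` keys p)))"
      unfolding polys_def by (auto intro!: Max_ge)
  qed (auto simp: mcoeffs_const mcoeffs_var)
qed

lemma coeff_mcoeffs_polys:
  assumes "p \<in> polys (Suc j)"
  shows "coeff (mcoeffs (Suc j) p) c \<in> polys j"
proof -
  have "mcoeffs (Suc j) p \<in> {P. \<forall>c. coeff P c \<in> polys j}"
    unfolding mcoeffs_def
    by (rule meval_closed[OF _ _ _ _ _ _ assms])
       (auto simp: coeff_pCons coeff_mult split: nat.split intro!: polys_intros)
  then show ?thesis by simp
qed

subsection \<open>Free modules\<close>

definition pmat :: "nat \<Rightarrow> 'k::zero mpoly mat \<Rightarrow> bool" where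
  "pmat d A \<longleftrightarrow> (\<forall>i<dim_row A. \<forall>j<dim_col A. A $$ (i, j) \<in> polys d)"

lemma elements_mat_subset_polys: "elements_mat A \<subseteq> polys d \<longleftrightarrow> pmat d A"
proof
  assume "elements_mat A \<subseteq> polys d"
  then show "pmat d A" unfolding pmat_def by (meson carrier_matI elements_matI subsetD)
next
  assume *: "pmat d A"
  show "elements_mat A \<subseteq> polys d"
  proof
    fix x assume "x \<in> elements_mat A"
    from elements_matD[OF this] * show "x \<in> polys d" by (auto simp: pmat_def)
  qed
qed

lemma pmatD: "pmat d A \<Longrightarrow> i < dim_row A \<Longrightarrow> j < dim_col A \<Longrightarrow> A $$ (i, j) \<in> polys d"
  by (simp add: pmat_def)

lemma pmat_mono: "pmat d A \<Longrightarrow> d \<le> e \<Longrightarrow> pmat e A"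
  unfolding pmat_def by (meson polys_mono)

lemma pmat_four_block:
  assumes "A \<in> carrier_mat r1 c1" "B \<in> carrier_mat r1 c2" "C \<in> carrier_mat r2 c1" "D \<in> carrier_mat r2 c2"
    and "pmat d A" "pmat d B" "pmat d C" "pmat d D"
  shows "pmat d (four_block_mat A B C D)"
  using assms by (auto simp: pmat_def)

lemma pmat_mult:
  fixes A B :: "'k::comm_ring_1 mpoly mat"
  assumes "pmat d A" "pmat d B" "dim_col A = dim_row B"
  shows "pmat d (A * B)"
  using assms by (auto simp: pmat_def scalar_prod_def intro!: polys_sum polys_mult)

lemma pmat_diff:
  fixes A B :: "'k::comm_ring_1 mpoly mat"
  assumes "pmat d A" "pmat d B" "dim_row A = dim_row B" "dim_col A = dim_col B"
  shows "pmat d (A - B)"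
  using assms by (simp add: pmat_def polys_diff)

lemma pmat_zero [simp]: "pmat d (0\<^sub>m r c)" by (simp add: pmat_def)

lemma pmat_one [simp]: "pmat d (1\<^sub>m r :: 'k::comm_ring_1 mpoly mat)" by (simp add: pmat_def)

lemma pmat_uminus: "pmat d A \<Longrightarrow> pmat d (- A)" for A :: "'k::comm_ring_1 mpoly mat"
  by (simp add: pmat_def polys_uminus)

lemma pmat_smult: "p \<in> polys d \<Longrightarrow> pmat d A \<Longrightarrow> pmat d (p \<cdot>\<^sub>m A)"
  for A :: "'k::comm_ring_1 mpoly mat"
  by (simp add: pmat_def polys_mult)

lemma free_moduleI:
  "v \<in> carrier_vec r \<Longrightarrow> (\<And>i. i < r \<Longrightarrow> v $ i \<in> polys d) \<Longrightarrow> v \<in> free_module d r"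
  by (simp add: free_module_def)

lemma free_module_carrier: "v \<in> free_module d r \<Longrightarrow> v \<in> carrier_vec r"
  by (simp add: free_module_def)

lemma free_module_dim: "v \<in> free_module d r \<Longrightarrow> dim_vec v = r"
  by (auto simp: free_module_def)

lemma free_moduleD: "v \<in> free_module d r \<Longrightarrow> i < r \<Longrightarrow> v $ i \<in> polys d"
  by (simp add: free_module_def)

lemma free_module_mono: "v \<in> free_module d r \<Longrightarrow> d \<le> e \<Longrightarrow> v \<in> free_module e r"
  by (auto simp: free_module_def intro: polys_mono)

lemma free_module_zero [simp]: "0\<^sub>v r \<in> free_module d r"
  by (simp add: free_module_def)

lemma free_module_unit [simp]: "unit_vec r j \<in> free_module d r"
  by (cases "j < r") (auto simp: free_module_def unit_vec_def)

lemma free_module_add: "v \<in> free_module d r \<Longrightarrow> w \<in> free_module d r \<Longrightarrow> v + w \<in> free_module d r"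
  by (auto simp: free_module_def polys_add)

lemma free_module_diff: "v \<in> free_module d r \<Longrightarrow> w \<in> free_module d r \<Longrightarrow> v - w \<in> free_module d r"
  for v :: "'k::comm_ring_1 mpoly vec"
  by (auto simp: free_module_def polys_diff)

lemma free_module_uminus: "v \<in> free_module d r \<Longrightarrow> - v \<in> free_module d r"
  for v :: "'k::comm_ring_1 mpoly vec"
  by (auto simp: free_module_def polys_uminus)

lemma free_module_smult: "v \<in> free_module d r \<Longrightarrow> p \<in> polys d \<Longrightarrow> p \<cdot>\<^sub>v v \<in> free_module d r"
  for v :: "'k::comm_ring_1 mpoly vec"
  by (auto simp: free_module_def polys_mult)

lemma free_module_append:
  "v \<in> free_module d r \<Longrightarrow> w \<in> free_module d s \<Longrightarrow> v @\<^sub>v w \<in> free_module d (r + s)"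
  by (auto simp: free_module_def)

lemma free_module_split:
  assumes "v \<in> free_module d (r + s)"
  obtains a c where "a \<in> free_module d r" "c \<in> free_module d s" "v = a @\<^sub>v c"
proof
  show "vec_first v r \<in> free_module d r" "vec_last v s \<in> free_module d s"
    using assms by (auto simp: free_module_def vec_first_def vec_last_def)
  show "v = vec_first v r @\<^sub>v vec_last v s" using assms by (simp add: free_module_def)
qed

lemma free_module_mult_mat:
  fixes A :: "'k::comm_ring_1 mpoly mat"
  assumes "A \<in> carrier_mat r c" "pmat d A" "v \<in> free_module d c"
  shows "A *\<^sub>v v \<in> free_module d r"
  using assms
  by (auto simp: free_module_def pmat_def scalar_prod_def intro!: polys_sum polys_mult)

lemma mult_mat_vec_sum:
  fixes A :: "'a::comm_ring_1 mat"
  assumes A: "A \<in> carrier_mat r c" and w: "\<And>k. k \<in> I \<Longrightarrow> w k \<in> carrier_vec c"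
  shows "A *\<^sub>v vec c (\<lambda>i. \<Sum>k\<in>I. a k * w k $ i) = vec r (\<lambda>i. \<Sum>k\<in>I. a k * (A *\<^sub>v w k) $ i)"
proof (rule eq_vecI)
  fix i assume "i < dim_vec (vec r (\<lambda>i. \<Sum>k\<in>I. a k * (A *\<^sub>v w k) $ i))"
  then have i: "i < r" by simp
  have "(A *\<^sub>v vec c (\<lambda>i. \<Sum>k\<in>I. a k * w k $ i)) $ i
      = (\<Sum>j<c. A $$ (i, j) * (\<Sum>k\<in>I. a k * w k $ j))"
    using A i by (simp add: scalar_prod_def atLeast0LessThan)
  also have "\<dots> = (\<Sum>k\<in>I. \<Sum>j<c. A $$ (i, j) * (a k * w k $ j))"
    by (simp add: sum_distrib_left) (rule sum.swap)
  also have "\<dots> = (\<Sum>k\<in>I. a k * (\<Sum>j<c. A $$ (i, j) * w k $ j))"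
    by (simp add: sum_distrib_left mult.left_commute)
  also have "\<dots> = (\<Sum>k\<in>I. a k * (A *\<^sub>v w k) $ i)"
  proof (rule sum.cong[OF refl])
    fix k assume "k \<in> I"
    from w[OF this] have "(A *\<^sub>v w k) $ i = (\<Sum>j<c. A $$ (i, j) * w k $ j)"
      using A i by (auto simp: scalar_prod_def atLeast0LessThan)
    then show "a k * (\<Sum>j<c. A $$ (i, j) * w k $ j) = a k * (A *\<^sub>v w k) $ i" by simp
  qed
  finally show "(A *\<^sub>v vec c (\<lambda>i. \<Sum>k\<in>I. a k * w k $ i)) $ i
      = vec r (\<lambda>i. \<Sum>k\<in>I. a k * (A *\<^sub>v w k) $ i) $ i" using i by simp
qed (use A in simp)

subsection \<open>Coefficient vectors with respect to the last variable\<close>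

definition cvec :: "nat \<Rightarrow> nat \<Rightarrow> 'k::comm_ring_1 mpoly vec \<Rightarrow> 'k mpoly vec" where
  "cvec l c v = map_vec (\<lambda>p. coeff (mcoeffs l p) c) v"

lemma cvec_index [simp]: "i < dim_vec v \<Longrightarrow> cvec l c v $ i = coeff (mcoeffs l (v $ i)) c"
  and cvec_dim [simp]: "dim_vec (cvec l c v) = dim_vec v"
  by (simp_all add: cvec_def)

lemma cvec_free: "v \<in> free_module (Suc j) r \<Longrightarrow> cvec (Suc j) c v \<in> free_module j r"
  by (auto simp: free_module_def cvec_def coeff_mcoeffs_polys)

text \<open>The entries of \<open>A\<close> do not involve the variable \<open>mvar l\<close>, so
  they act on each coefficient separately.\<close>

lemma cvec_mult:
  assumes A: "A \<in> carrier_mat r s" "pmat j A" and v: "v \<in> carrier_vec s" and "j < l"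
  shows "cvec l c (A *\<^sub>v v) = A *\<^sub>v cvec l c v"
proof (rule eq_vecI)
  interpret comm_ring_hom "mcoeffs l :: 'a mpoly \<Rightarrow> _" by (rule mcoeffs_hom)
  fix i assume "i < dim_vec (A *\<^sub>v cvec l c v)"
  then have i: "i < r" using A by simp
  have low: "mcoeffs l (A $$ (i, k)) = [:A $$ (i, k):]" if "k < s" for k
    using that i A \<open>j < l\<close> by (intro mcoeffs_lower[of _ j] pmatD) auto
  have "cvec l c (A *\<^sub>v v) $ i = coeff (mcoeffs l (\<Sum>k<s. A $$ (i, k) * v $ k)) c"
    using A v i by (auto simp: scalar_prod_def atLeast0LessThan)
  also have "\<dots> = (\<Sum>k<s. A $$ (i, k) * coeff (mcoeffs l (v $ k)) c)"
    by (simp add: hom_distribs low coeff_sum)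
  also have "\<dots> = (A *\<^sub>v cvec l c v) $ i"
    using A v i by (auto simp: scalar_prod_def atLeast0LessThan intro!: sum.cong)
  finally show "cvec l c (A *\<^sub>v v) $ i = (A *\<^sub>v cvec l c v) $ i" .
qed (use A in simp)

lemma cvec_eventually_zero:
  assumes "v \<in> carrier_vec r"
  obtains N where "\<And>c. c \<ge> N \<Longrightarrow> cvec l c v = 0\<^sub>v r"
proof
  define N where "N = Suc (\<Sum>i<r. degree (mcoeffs l (v $ i)))"
  show "cvec l c v = 0\<^sub>v r" if "c \<ge> N" for c
  proof (rule eq_vecI)
    fix i assume i: "i < dim_vec (0\<^sub>v r :: 'a mpoly vec)"
    have "degree (mcoeffs l (v $ i)) \<le> (\<Sum>i<r. degree (mcoeffs l (v $ i)))"
      using i by (intro member_le_sum) auto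
    then show "cvec l c v $ i = 0\<^sub>v r $ i"
      using that i assms by (auto simp: N_def intro!: coeff_eq_0)
  qed (use assms in auto)
qed

lemma cvec_expand:
  assumes v: "v \<in> carrier_vec r" and N: "\<And>c. c \<ge> N \<Longrightarrow> cvec l c v = 0\<^sub>v r"
  shows "v = vec r (\<lambda>i. \<Sum>c<N. mvar l ^ c * cvec l c v $ i)"
proof (rule eq_vecI)
  fix i assume "i < dim_vec (vec r (\<lambda>i. \<Sum>c<N. mvar l ^ c * cvec l c v $ i))"
  then have i: "i < r" by simp
  let ?P = "mcoeffs l (v $ i)"
  have z: "coeff ?P c = 0" if "c \<ge> N" for c
    using N[OF that] i v by (metis carrier_vecD cvec_index index_zero_vec(1))
  have "v $ i = (\<Sum>c\<le>degree ?P. coeff ?P c * mvar l ^ c)"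
    unfolding poly_altdef[symmetric] poly_mcoeffs by (rule refl)
  \<comment> \<open>A common range for the two bounds \<open>N\<close> and \<open>degree ?P\<close>,
    either of which may be the larger one.\<close>
  also have "\<dots> = (\<Sum>c<N + Suc (degree ?P). coeff ?P c * mvar l ^ c)"
  proof (rule sum.mono_neutral_left)
    show "\<forall>c\<in>{..<N + Suc (degree ?P)} - {..degree ?P}. coeff ?P c * mvar l ^ c = 0"
    proof
      fix c assume "c \<in> {..<N + Suc (degree ?P)} - {..degree ?P}"
      then have "coeff ?P c = 0" by (intro coeff_eq_0) simp
      then show "coeff ?P c * mvar l ^ c = 0" by (simp only: mult_zero_left)
    qed
  qed auto
  also have "\<dots> = (\<Sum>c<N. coeff ?P c * mvar l ^ c)"
  proof (rule sum.mono_neutral_right)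
    show "\<forall>c\<in>{..<N + Suc (degree ?P)} - {..<N}. coeff ?P c * mvar l ^ c = 0"
    proof
      fix c assume "c \<in> {..<N + Suc (degree ?P)} - {..<N}"
      then have "coeff ?P c = 0" by (intro z) simp
      then show "coeff ?P c * mvar l ^ c = 0" by (simp only: mult_zero_left)
    qed
  qed auto
  finally show "v $ i = vec r (\<lambda>i. \<Sum>c<N. mvar l ^ c * cvec l c v $ i) $ i"
    using i v by (auto simp: mult.commute)
qed (use v in auto)

subsection \<open>The Koszul complex of commuting operators\<close>

text \<open>The complex built from the first \<open>j\<close> operators \<open>x\<^sub>l - X\<^sub>l\<close> is the mapping cone of the
  last of them, acting on the complex built from the first \<open>j - 1\<close>.  Homological degree is
  shifted by one: index \<open>i\<close> stands for degree \<open>i - 1\<close>, so that index \<open>0\<close> is the zero module and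
  the recursion needs no separate case for the last cone term.\<close>

fun koszul_rank :: "nat \<Rightarrow> nat \<Rightarrow> nat \<Rightarrow> nat" where
  "koszul_rank m 0 i = (if i = 1 then m else 0)"
| "koszul_rank m (Suc j) 0 = 0"
| "koszul_rank m (Suc j) (Suc i) = koszul_rank m j (Suc i) + koszul_rank m j i"

text \<open>Each term of the complex is a direct sum of copies of the module of rank
  \<open>m\<close>; \<open>Y\<close> acts on every copy separately.\<close>

fun koszul_act :: "nat \<Rightarrow> 'a::zero mat \<Rightarrow> nat \<Rightarrow> nat \<Rightarrow> 'a mat" where
  "koszul_act m Y 0 i = (if i = 1 then Y else 0\<^sub>m 0 0)"
| "koszul_act m Y (Suc j) 0 = 0\<^sub>m 0 0"
| "koszul_act m Y (Suc j) (Suc i) =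
     four_block_mat (koszul_act m Y j (Suc i)) (0\<^sub>m (koszul_rank m j (Suc i)) (koszul_rank m j i))
       (0\<^sub>m (koszul_rank m j i) (koszul_rank m j (Suc i))) (koszul_act m Y j i)"

definition koszul_map :: "nat \<Rightarrow> (nat \<Rightarrow> 'a::comm_ring_1) \<Rightarrow> (nat \<Rightarrow> 'a mat) \<Rightarrow> nat \<Rightarrow> nat \<Rightarrow> nat \<Rightarrow> 'a mat" where
  "koszul_map m x X j l i = x l \<cdot>\<^sub>m 1\<^sub>m (koszul_rank m j i) - koszul_act m (X l) j i"

text \<open>Index \<open>i\<close> belongs to the map from term \<open>Suc i\<close> to term
  \<open>i\<close>. The minus sign in the last block makes the two contributions of
  \<open>koszul_map\<close> to the square cancel.\<close>

fun koszul_diff :: "nat \<Rightarrow> (nat \<Rightarrow> 'a::comm_ring_1) \<Rightarrow> (nat \<Rightarrow> 'a mat) \<Rightarrow> nat \<Rightarrow> nat \<Rightarrow> 'a mat" where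
  "koszul_diff m x X 0 i = 0\<^sub>m (koszul_rank m 0 i) (koszul_rank m 0 (Suc i))"
| "koszul_diff m x X (Suc j) 0 = 0\<^sub>m 0 (koszul_rank m (Suc j) 1)"
| "koszul_diff m x X (Suc j) (Suc i) =
     four_block_mat (koszul_diff m x X j (Suc i)) (koszul_map m x X j (Suc j) (Suc i))
       (0\<^sub>m (koszul_rank m j i) (koszul_rank m j (Suc (Suc i)))) (- koszul_diff m x X j i)"

lemma koszul_rank_0 [simp]: "koszul_rank m j 0 = 0" by (cases j) simp_all

lemma koszul_rank_1 [simp]: "koszul_rank m j (Suc 0) = m" by (induction j) simp_all

lemma koszul_act_carrier: "Y \<in> carrier_mat m m \<Longrightarrow> koszul_act m Y j i \<in> carrier_mat (koszul_rank m j i) (koszul_rank m j i)"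
  by (induction m Y j i rule: koszul_act.induct) auto

lemma koszul_act_pmat:
  assumes Y: "Y \<in> carrier_mat m m" and "pmat e Y"
  shows "pmat e (koszul_act m Y j i)"
proof (induction j arbitrary: i)
  case 0
  show ?case using assms(2) by (cases "i = 1") simp_all
next
  case (Suc j)
  note c = koszul_act_carrier[OF Y]
  show ?case
  proof (cases i)
    case (Suc i')
    show ?thesis
      unfolding Suc koszul_act.simps
      by (rule pmat_four_block[OF c zero_carrier_mat zero_carrier_mat c Suc.IH pmat_zero pmat_zero Suc.IH])
  qed simp
qed

lemma koszul_act_mult:
  fixes Y Y' :: "'a::semiring_0 mat"
  assumes Y: "Y \<in> carrier_mat m m" and Y': "Y' \<in> carrier_mat m m"
  shows "koszul_act m Y j i * koszul_act m Y' j i = koszul_act m (Y * Y') j i"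
proof (induction j arbitrary: i)
  case 0
  show ?case by (cases "i = 1") simp_all
next
  case (Suc j)
  show ?case
  proof (cases i)
    case 0
    then show ?thesis by simp
  next
    case (Suc i')
    note c = koszul_act_carrier[OF Y, of j "Suc i'"] koszul_act_carrier[OF Y, of j i']
      and c' = koszul_act_carrier[OF Y', of j "Suc i'"] koszul_act_carrier[OF Y', of j i']
    show ?thesis
      unfolding Suc koszul_act.simps
        mult_four_block_mat[OF c(1) zero_carrier_mat zero_carrier_mat c(2)
              c'(1) zero_carrier_mat zero_carrier_mat c'(2)] Suc.IH[symmetric]
      by (rule cong_four_block_mat) (use c c' in simp_all)
  qed
qed

lemma koszul_map_carrier: "X l \<in> carrier_mat m m \<Longrightarrow> koszul_map m x X j l i \<in> carrier_mat (koszul_rank m j i) (koszul_rank m j i)"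
  unfolding koszul_map_def using koszul_act_carrier[of "X l" m j i] by (intro minus_carrier_mat) auto

lemma scalar_diff_mult_vec:
  fixes Y :: "'a::comm_ring_1 mat"
  assumes Y: "Y \<in> carrier_mat r r" and v: "v \<in> carrier_vec r"
  shows "(x \<cdot>\<^sub>m 1\<^sub>m r - Y) *\<^sub>v v = x \<cdot>\<^sub>v v - Y *\<^sub>v v"
proof -
  have "(x \<cdot>\<^sub>m 1\<^sub>m r - Y) *\<^sub>v v = (x \<cdot>\<^sub>m 1\<^sub>m r) *\<^sub>v v - Y *\<^sub>v v"
    by (rule minus_mult_distrib_mat_vec[OF _ Y v]) simp
  also have "(x \<cdot>\<^sub>m 1\<^sub>m r) *\<^sub>v v = x \<cdot>\<^sub>v v"
    using v by (intro eq_vecI) auto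
  finally show ?thesis .
qed

lemma scalar_diff_commute:
  fixes A :: "'a::comm_ring_1 mat"
  assumes A: "A \<in> carrier_mat r c" and Y: "Y \<in> carrier_mat r r" and Y': "Y' \<in> carrier_mat c c"
    and comm: "A * Y' = Y * A"
  shows "A * (x \<cdot>\<^sub>m 1\<^sub>m c - Y') = (x \<cdot>\<^sub>m 1\<^sub>m r - Y) * A"
proof -
  have "A * (x \<cdot>\<^sub>m 1\<^sub>m c - Y') = A * (x \<cdot>\<^sub>m 1\<^sub>m c) - A * Y'"
    by (rule mult_minus_distrib_mat[OF A _ Y']) simp
  also have "A * (x \<cdot>\<^sub>m 1\<^sub>m c) = (x \<cdot>\<^sub>m 1\<^sub>m r) * A"
    using mult_smult_distrib[OF A one_carrier_mat, of x] mult_smult_assoc_mat[OF one_carrier_mat A, of x] A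
    by simp
  also have "(x \<cdot>\<^sub>m 1\<^sub>m r) * A - A * Y' = (x \<cdot>\<^sub>m 1\<^sub>m r - Y) * A"
    unfolding comm by (rule minus_mult_distrib_mat[OF _ Y A, symmetric]) simp
  finally show ?thesis .
qed

lemma uminus_zero_mat: "- 0\<^sub>m r c = (0\<^sub>m r c :: 'a::group_add mat)"
  by (intro eq_matI) auto

lemma add_uminus_mat: "M \<in> carrier_mat r c \<Longrightarrow> M + - M = (0\<^sub>m r c :: 'a::group_add mat)"
  by (intro eq_matI) auto

lemma mat_no_rows_eq: "A \<in> carrier_mat 0 c \<Longrightarrow> B \<in> carrier_mat 0 c \<Longrightarrow> A = B"
  by (intro eq_matI) auto

lemma upper_block_mult:
  fixes A :: "'a::semiring_0 mat"
  assumes A: "A \<in> carrier_mat r1 c1" and B: "B \<in> carrier_mat r1 c2" and D: "D \<in> carrier_mat r2 c2"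
    and A': "A' \<in> carrier_mat c1 e1" and B': "B' \<in> carrier_mat c1 e2" and D': "D' \<in> carrier_mat c2 e2"
  shows "four_block_mat A B (0\<^sub>m r2 c1) D * four_block_mat A' B' (0\<^sub>m c2 e1) D'
    = four_block_mat (A * A') (A * B' + B * D') (0\<^sub>m r2 e1) (D * D')"
  unfolding mult_four_block_mat[OF A B zero_carrier_mat D A' B' zero_carrier_mat D']
  by (rule cong_four_block_mat) (use A B D A' B' D' in simp_all)

lemma koszul_map_mult_vec:
  assumes "X l \<in> carrier_mat m m" "v \<in> carrier_vec (koszul_rank m j i)"
  shows "koszul_map m x X j l i *\<^sub>v v = x l \<cdot>\<^sub>v v - koszul_act m (X l) j i *\<^sub>v v"
  unfolding koszul_map_def by (rule scalar_diff_mult_vec[OF koszul_act_carrier[OF assms(1)] assms(2)])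

context
  fixes m :: nat and x :: "nat \<Rightarrow> 'a::comm_ring_1" and X :: "nat \<Rightarrow> 'a mat"
  assumes X: "\<And>l. X l \<in> carrier_mat m m"
begin

lemma koszul_diff_carrier: "koszul_diff m x X j i \<in> carrier_mat (koszul_rank m j i) (koszul_rank m j (Suc i))"
proof (induction j arbitrary: i)
  case 0
  show ?case by simp
next
  case (Suc j)
  show ?case
  proof (cases i)
    case 0
    then show ?thesis by simp
  next
    case (Suc i')
    then show ?thesis
      using four_block_carrier_mat[OF Suc.IH[of "Suc i'"] uminus_carrier_mat[OF Suc.IH[of i']]] by simp
  qed
qed

lemma koszul_act_koszul_map_commute:
  assumes comm: "X k * X l = X l * X k"
  shows "koszul_act m (X k) j i * koszul_map m x X j l i = koszul_map m x X j l i * koszul_act m (X k) j i"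
  unfolding koszul_map_def
  by (rule scalar_diff_commute[OF koszul_act_carrier[OF X] koszul_act_carrier[OF X] koszul_act_carrier[OF X]])
     (simp add: koszul_act_mult[OF X X] comm)

context
  assumes comm: "\<And>k l. X k * X l = X l * X k"
begin

text \<open>The commutation of the matrices enters in the upper right block, where
  \<open>X l\<close> meets the operator added last.\<close>

lemma koszul_diff_koszul_act: "koszul_diff m x X j i * koszul_act m (X l) j (Suc i) = koszul_act m (X l) j i * koszul_diff m x X j i"
proof (induction j arbitrary: i)
  case 0
  have "X l * 0\<^sub>m m 0 = 0\<^sub>m m 0" using X[of l] by simp
  then show ?case using X[of l] by (cases "i = 0") auto
next
  case (Suc j)
  note cX = koszul_act_carrier[OF X] and cD = koszul_diff_carrier
  have cp: "koszul_map m x X j l i \<in> carrier_mat (koszul_rank m j i) (koszul_rank m j i)" for j l i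
    by (rule koszul_map_carrier[OF X])
  show ?case
  proof (cases i)
    case 0
    show ?thesis
      unfolding 0
      using mat_no_rows_eq[of _ "koszul_rank m (Suc j) (Suc 0)"] mult_carrier_mat[OF cD[of "Suc j" 0] cX[of l]]
        mult_carrier_mat[OF cX[of l "Suc j" 0] cD] unfolding koszul_rank_0 by metis
  next
    case (Suc i')
    let ?A = "koszul_act m (X l) j" and ?D = "koszul_diff m x X j" and ?p = "koszul_map m x X j (Suc j)"
    have L: "koszul_diff m x X (Suc j) i * koszul_act m (X l) (Suc j) (Suc i)
      = four_block_mat (?D (Suc i') * ?A (Suc (Suc i')))
          (?D (Suc i') * 0\<^sub>m (koszul_rank m j (Suc (Suc i'))) (koszul_rank m j (Suc i')) + ?p (Suc i') * ?A (Suc i'))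
          (0\<^sub>m (koszul_rank m j i') (koszul_rank m j (Suc (Suc i')))) (- ?D i' * ?A (Suc i'))"
      unfolding Suc koszul_diff.simps koszul_act.simps
      by (rule upper_block_mult[OF cD cp uminus_carrier_mat[OF cD] cX zero_carrier_mat cX])
    have R: "koszul_act m (X l) (Suc j) i * koszul_diff m x X (Suc j) i
      = four_block_mat (?A (Suc i') * ?D (Suc i'))
          (?A (Suc i') * ?p (Suc i') + 0\<^sub>m (koszul_rank m j (Suc i')) (koszul_rank m j i') * - ?D i')
          (0\<^sub>m (koszul_rank m j i') (koszul_rank m j (Suc (Suc i')))) (?A i' * - ?D i')"
      unfolding Suc koszul_diff.simps koszul_act.simps
      by (rule upper_block_mult[OF cX zero_carrier_mat cX cD cp uminus_carrier_mat[OF cD]])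
    have d: "- ?D i' * ?A (Suc i') = ?A i' * - ?D i'"
      using Suc.IH[of i'] cD[of j i'] cX[of l j "Suc i'"] cX[of l j i'] by simp
    have "?p (Suc i') * ?A (Suc i') = ?A (Suc i') * ?p (Suc i')"
      by (rule koszul_act_koszul_map_commute[OF comm, symmetric])
    then have b: "?D (Suc i') * 0\<^sub>m (koszul_rank m j (Suc (Suc i'))) (koszul_rank m j (Suc i')) + ?p (Suc i') * ?A (Suc i')
      = ?A (Suc i') * ?p (Suc i') + 0\<^sub>m (koszul_rank m j (Suc i')) (koszul_rank m j i') * - ?D i'"
      using cD[of j i'] cD[of j "Suc i'"] cX[of l j "Suc i'"] cp[of j "Suc j" "Suc i'"]
        mult_carrier_mat[OF cX[of l j "Suc i'"] cp[of j "Suc j" "Suc i'"]]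
      by (simp add: uminus_zero_mat)
    show ?thesis
      unfolding L R by (rule cong_four_block_mat[OF Suc.IH b refl d])
  qed
qed

lemma koszul_diff_koszul_map: "koszul_diff m x X j i * koszul_map m x X j l (Suc i) = koszul_map m x X j l i * koszul_diff m x X j i"
  unfolding koszul_map_def
  by (rule scalar_diff_commute[OF koszul_diff_carrier koszul_act_carrier[OF X] koszul_act_carrier[OF X] koszul_diff_koszul_act])

text \<open>The diagonal blocks vanish by induction; the two terms of the upper right block cancel
  because \<open>koszul_map\<close> is a chain map.\<close>

lemma koszul_diff_koszul_diff: "koszul_diff m x X j i * koszul_diff m x X j (Suc i) = 0\<^sub>m (koszul_rank m j i) (koszul_rank m j (Suc (Suc i)))"
proof (induction j arbitrary: i)
  case 0
  show ?case by simp
next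
  case (Suc j)
  note cD = koszul_diff_carrier
  have cp: "koszul_map m x X j l i \<in> carrier_mat (koszul_rank m j i) (koszul_rank m j i)" for j l i
    by (rule koszul_map_carrier[OF X])
  show ?case
  proof (cases i)
    case 0
    show ?thesis
      unfolding 0
      using mat_no_rows_eq[OF _ zero_carrier_mat] mult_carrier_mat[OF cD[of "Suc j" 0] cD]
      unfolding koszul_rank_0 by metis
  next
    case (Suc i')
    let ?D = "koszul_diff m x X j" and ?p = "koszul_map m x X j (Suc j)"
    have "?p (Suc i') * ?D (Suc i') \<in> carrier_mat (koszul_rank m j (Suc i')) (koszul_rank m j (Suc (Suc i')))"
      by (rule mult_carrier_mat[OF cp cD])
    then have b: "?D (Suc i') * ?p (Suc (Suc i')) + ?p (Suc i') * - ?D (Suc i')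
        = 0\<^sub>m (koszul_rank m j (Suc i')) (koszul_rank m j (Suc (Suc i')))"
      using cD[of j "Suc i'"] cp[of j "Suc j" "Suc i'"] unfolding koszul_diff_koszul_map
      by (simp add: add_uminus_mat)
    have d: "- ?D i' * - ?D (Suc i') = 0\<^sub>m (koszul_rank m j i') (koszul_rank m j (Suc (Suc i')))"
      using Suc.IH[of i'] cD[of j i'] cD[of j "Suc i'"] by simp
    have "koszul_diff m x X (Suc j) i * koszul_diff m x X (Suc j) (Suc i)
      = four_block_mat (?D (Suc i') * ?D (Suc (Suc i')))
          (?D (Suc i') * ?p (Suc (Suc i')) + ?p (Suc i') * - ?D (Suc i'))
          (0\<^sub>m (koszul_rank m j i') (koszul_rank m j (Suc (Suc (Suc i'))))) (- ?D i' * - ?D (Suc i'))"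
      unfolding Suc koszul_diff.simps
      by (rule upper_block_mult[OF cD cp uminus_carrier_mat[OF cD] cD cp uminus_carrier_mat[OF cD]])
    also have "\<dots> = 0\<^sub>m (koszul_rank m (Suc j) i) (koszul_rank m (Suc j) (Suc (Suc i)))"
      unfolding b d Suc.IH Suc koszul_rank.simps by (rule four_block_zero_mat)
    finally show ?thesis .
  qed
qed

end
end

lemma koszul_map_pmat:
  assumes "X l \<in> carrier_mat m m" "pmat 0 (X l)" "l \<le> e"
  shows "pmat e (koszul_map m mvar X j l i)"
  unfolding koszul_map_def
proof (rule pmat_diff)
  show "pmat e (mvar l \<cdot>\<^sub>m 1\<^sub>m (koszul_rank m j i) :: 'a mpoly mat)"
    by (rule pmat_smult[OF polys_var[OF assms(3)] pmat_one])
  show "pmat e (koszul_act m (X l) j i)" by (rule pmat_mono[OF koszul_act_pmat[OF assms(1,2)]]) simp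
qed (use koszul_act_carrier[OF assms(1), of j i] in simp_all)

lemma koszul_diff_pmat:
  assumes X: "\<And>l. X l \<in> carrier_mat m m" and P: "\<And>l. pmat 0 (X l)"
  shows "pmat j (koszul_diff m mvar X j i)"
proof (induction j arbitrary: i)
  case 0
  show ?case by simp
next
  case (Suc j)
  show ?case
  proof (cases i)
    case 0
    then show ?thesis by simp
  next
    case (Suc i')
    have IH: "pmat (Suc j) (koszul_diff m mvar X j k)" for k by (rule pmat_mono[OF Suc.IH]) simp
    show ?thesis
      unfolding Suc koszul_diff.simps
      by (rule pmat_four_block[OF koszul_diff_carrier[OF X] koszul_map_carrier[OF X] zero_carrier_mat
              uminus_carrier_mat[OF koszul_diff_carrier[OF X]] IH koszul_map_pmat[OF X P order.refl] pmat_zero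
              pmat_uminus[OF IH]])
  qed
qed

text \<open>The augmentation of a free module into the ring \<open>'a\<close>, before anything is
  divided out: basis vector \<open>w\<close> goes to \<open>\<gamma> w\<close>.\<close>

definition lam :: "('k mpoly \<Rightarrow> 'a::comm_ring_1) \<Rightarrow> (nat \<Rightarrow> 'a) \<Rightarrow> nat \<Rightarrow> 'k::comm_ring_1 mpoly vec \<Rightarrow> 'a" where
  "lam ev \<gamma> r v = (\<Sum>w<r. ev (v $ w) * \<gamma> w)"

text \<open>Instead of a quotient module, the submodule \<open>Z\<close> that is divided out is carried along, and
  equality in the quotient becomes membership of the difference in \<open>Z\<close>.\<close>

locale eval_module =
  fixes ev :: "'k::field mpoly \<Rightarrow> 'a::comm_ring_1" and Z :: "'a set" and d :: nat
  assumes ev: "comm_ring_hom ev"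
    and Z_0: "0 \<in> Z"
    and Z_add: "y \<in> Z \<Longrightarrow> z \<in> Z \<Longrightarrow> y + z \<in> Z"
    and Z_mult: "p \<in> polys d \<Longrightarrow> z \<in> Z \<Longrightarrow> ev p * z \<in> Z"
begin

sublocale ev: comm_ring_hom ev by (rule ev)

lemma Z_uminus: "z \<in> Z \<Longrightarrow> - z \<in> Z"
  using Z_mult[OF polys_uminus[OF polys_one], of z] by (simp add: ev.hom_uminus)

lemma Z_diff: "y \<in> Z \<Longrightarrow> z \<in> Z \<Longrightarrow> y - z \<in> Z"
  using Z_add[OF _ Z_uminus, of y z] by simp

lemma Z_sum: "(\<And>i. i \<in> I \<Longrightarrow> f i \<in> Z) \<Longrightarrow> sum f I \<in> Z"
  by (induction I rule: infinite_finite_induct) (simp_all add: Z_0 Z_add)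

lemma Z_diff_trans: "x - y \<in> Z \<Longrightarrow> y - z \<in> Z \<Longrightarrow> x - z \<in> Z"
  using Z_add[of "x - y" "y - z"] by simp

lemma Z_diff_sym: "x - y \<in> Z \<Longrightarrow> y - x \<in> Z"
  using Z_uminus[of "x - y"] by simp

lemma Z_diff_mem: "x - y \<in> Z \<Longrightarrow> y \<in> Z \<Longrightarrow> x \<in> Z"
  using Z_add[of "x - y" y] by simp

lemma lam_add: "v \<in> carrier_vec r \<Longrightarrow> w \<in> carrier_vec r \<Longrightarrow> lam ev \<gamma> r (v + w) = lam ev \<gamma> r v + lam ev \<gamma> r w"
  unfolding lam_def sum.distrib[symmetric]
  by (rule sum.cong) (auto simp: ev.hom_add distrib_right)

lemma lam_diff: "v \<in> carrier_vec r \<Longrightarrow> w \<in> carrier_vec r \<Longrightarrow> lam ev \<gamma> r (v - w) = lam ev \<gamma> r v - lam ev \<gamma> r w"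
  unfolding lam_def sum_subtractf[symmetric]
  by (rule sum.cong) (auto simp: ev.hom_minus left_diff_distrib)

lemma lam_smult: "v \<in> carrier_vec r \<Longrightarrow> lam ev \<gamma> r (p \<cdot>\<^sub>v v) = ev p * lam ev \<gamma> r v"
  unfolding lam_def sum_distrib_left
  by (rule sum.cong) (auto simp: ev.hom_mult mult.assoc)

lemma lam_zero: "lam ev \<gamma> r (0\<^sub>v r) = 0"
  unfolding lam_def by (rule sum.neutral) simp

lemma lam_unit: "j < r \<Longrightarrow> lam ev \<gamma> r (unit_vec r j) = \<gamma> j"
proof -
  assume j: "j < r"
  have "lam ev \<gamma> r (unit_vec r j) = (\<Sum>w<r. if w = j then \<gamma> w else 0)"
    unfolding lam_def by (rule sum.cong) (use j in auto)
  then show ?thesis using j by simp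
qed

lemma lam_mult_mat:
  assumes A: "A \<in> carrier_mat r c" and v: "v \<in> carrier_vec c"
  shows "lam ev \<gamma> r (A *\<^sub>v v) = (\<Sum>j<c. ev (v $ j) * lam ev \<gamma> r (col A j))"
proof -
  have "lam ev \<gamma> r (A *\<^sub>v v) = (\<Sum>w<r. \<Sum>j<c. ev (v $ j) * (ev (A $$ (w, j)) * \<gamma> w))"
    unfolding lam_def
  proof (rule sum.cong[OF refl])
    fix w assume "w \<in> {..<r}"
    then have "(A *\<^sub>v v) $ w = (\<Sum>j<c. A $$ (w, j) * v $ j)"
      using A v by (auto simp: scalar_prod_def atLeast0LessThan)
    then show "ev ((A *\<^sub>v v) $ w) * \<gamma> w = (\<Sum>j<c. ev (v $ j) * (ev (A $$ (w, j)) * \<gamma> w))"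
      by (simp add: ev.hom_sum ev.hom_mult sum_distrib_right mult_ac sum_distrib_left)
  qed
  also have "\<dots> = (\<Sum>j<c. \<Sum>w<r. ev (v $ j) * (ev (A $$ (w, j)) * \<gamma> w))"
    by (rule sum.swap)
  also have "\<dots> = (\<Sum>j<c. ev (v $ j) * lam ev \<gamma> r (col A j))"
    unfolding lam_def sum_distrib_left using A by (intro sum.cong refl) auto
  finally show ?thesis .
qed

lemma lam_mult_mat_cong:
  assumes A: "A \<in> carrier_mat r c" and v: "v \<in> free_module d c"
    and col: "\<And>j. j < c \<Longrightarrow> lam ev \<gamma> r (col A j) - \<gamma>' j \<in> Z"
  shows "lam ev \<gamma> r (A *\<^sub>v v) - lam ev \<gamma>' c v \<in> Z"
proof -
  have "lam ev \<gamma> r (A *\<^sub>v v) - lam ev \<gamma>' c v = (\<Sum>j<c. ev (v $ j) * (lam ev \<gamma> r (col A j) - \<gamma>' j))"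
    unfolding lam_mult_mat[OF A free_module_carrier[OF v]]
    unfolding lam_def[of _ \<gamma>'] by (simp add: sum_subtractf right_diff_distrib)
  also have "\<dots> \<in> Z"
    by (intro Z_sum Z_mult col free_moduleD[OF v]) auto
  finally show ?thesis .
qed

end

lemma append_vec_empty: "w \<in> carrier_vec 0 \<Longrightarrow> v @\<^sub>v w = v"
  by (intro eq_vecI) auto

lemma vec_diff_eq_zero:
  fixes v :: "'a::ab_group_add vec"
  assumes "v \<in> carrier_vec r" "w \<in> carrier_vec r" "v - w = 0\<^sub>v r"
  shows "v = w"
proof (rule eq_vecI)
  fix i assume "i < dim_vec w"
  then have i: "i < r" using assms(2) by simp
  have "v $ i - w $ i = (v - w) $ i" using i assms(2) by simp
  also have "\<dots> = 0" unfolding assms(3) using i by simp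
  finally show "v $ i = w $ i" by simp
qed (use assms(1,2) in simp)

lemma col_mult_unit_vec:
  fixes A B :: "'a::comm_ring_1 mat"
  assumes "A \<in> carrier_mat r s" "B \<in> carrier_mat s c" "j < c"
  shows "col (A * B) j = A *\<^sub>v (B *\<^sub>v unit_vec c j)"
proof -
  have "col B j = B *\<^sub>v unit_vec c j"
    using assms by (intro eq_vecI) (auto simp: scalar_prod_right_unit)
  then show ?thesis using col_mult2[OF assms] by simp
qed

lemma zero_vec_append: "0\<^sub>v (r + s) = 0\<^sub>v r @\<^sub>v 0\<^sub>v s"
  by (intro eq_vecI) auto

lemma vec_add_eq_zero:
  fixes v :: "'a::ab_group_add vec"
  assumes "v \<in> carrier_vec r" "w \<in> carrier_vec r" "v + w = 0\<^sub>v r"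
  shows "w = - v"
proof (rule eq_vecI)
  fix i assume "i < dim_vec (- v)"
  then have i: "i < r" using assms(1) by simp
  have "v $ i + w $ i = (v + w) $ i" using i assms(2) by simp
  also have "\<dots> = 0" unfolding assms(3) using i by simp
  finally show "w $ i = (- v) $ i" using i assms(1) by (simp add: add_eq_0_iff)
qed (use assms(1,2) in simp)

lemma mult_mat_uminus_vec:
  fixes A :: "'a::comm_ring_1 mat"
  assumes "A \<in> carrier_mat r c" "v \<in> carrier_vec c"
  shows "A *\<^sub>v (- v) = - (A *\<^sub>v v)"
  using assms by (intro eq_vecI) (auto simp: scalar_prod_def sum_negf)

lemma vec_diff_add_cancel:
  "v \<in> carrier_vec r \<Longrightarrow> w \<in> carrier_vec r \<Longrightarrow> v - w + w = (v :: 'a::ab_group_add vec)"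
  by (intro eq_vecI) auto

lemma vec_add_uminus_cancel:
  "v \<in> carrier_vec r \<Longrightarrow> w \<in> carrier_vec r \<Longrightarrow> v + w + - w = (v :: 'a::ab_group_add vec)"
  by (intro eq_vecI) auto

lemma mult_mat_smult_vec:
  fixes A :: "'a::comm_ring_1 mat"
  assumes "A \<in> carrier_mat r c" "v \<in> carrier_vec c"
  shows "A *\<^sub>v (k \<cdot>\<^sub>v v) = k \<cdot>\<^sub>v (A *\<^sub>v v)"
  using assms by (intro eq_vecI) (auto simp: scalar_prod_def sum_distrib_left mult.left_commute)

text \<open>One step of Horner's scheme: if a vector has quotient \<open>u\<close> and remainder
  \<open>b\<close> on division by \<open>x - Y\<close>, then \<open>x\<close> times this vector plus
  \<open>a\<close> has quotient \<open>x u + b\<close> and remainder \<open>a + Y b\<close>.\<close>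

lemma division_step:
  fixes Y :: "'a::comm_ring_1 mat"
  assumes Y: "Y \<in> carrier_mat r r" and c: "a \<in> carrier_vec r" "u \<in> carrier_vec r" "b \<in> carrier_vec r"
  shows "a + x \<cdot>\<^sub>v ((x \<cdot>\<^sub>v u - Y *\<^sub>v u) + b)
    = (x \<cdot>\<^sub>v (x \<cdot>\<^sub>v u + b) - Y *\<^sub>v (x \<cdot>\<^sub>v u + b)) + (a + Y *\<^sub>v b)"
proof -
  have Ye: "Y *\<^sub>v (x \<cdot>\<^sub>v u + b) = x \<cdot>\<^sub>v (Y *\<^sub>v u) + Y *\<^sub>v b"
    using mult_add_distrib_mat_vec[OF Y, of "x \<cdot>\<^sub>v u" b] mult_mat_smult_vec[OF Y c(2)] c by simp
  define p q where "p = Y *\<^sub>v u" and "q = Y *\<^sub>v b"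
  have "p \<in> carrier_vec r" "q \<in> carrier_vec r" using Y c by (auto simp: p_def q_def)
  then show ?thesis
    unfolding Ye p_def[symmetric] q_def[symmetric] using c
    by (intro eq_vecI) (auto simp: algebra_simps)
qed

text \<open>\<open>mvar (Suc j) - Y\<close> is monic of degree one in the new variable, and
  \<open>Y\<close> does not involve it; hence there is division with a remainder \<open>v0\<close>
  free of that variable.\<close>

lemma division:
  fixes Y :: "'k::comm_ring_1 mpoly mat"
  assumes Y: "Y \<in> carrier_mat r r" "pmat 0 Y" and v: "v \<in> free_module (Suc j) r"
  obtains u v0 where "u \<in> free_module (Suc j) r" "v0 \<in> free_module j r"
    "v = (mvar (Suc j) \<cdot>\<^sub>v u - Y *\<^sub>v u) + v0"
proof -
  let ?x = "mvar (Suc j) :: 'k mpoly"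
  \<comment> \<open>Stated for arbitrary coefficient sequences \<open>a\<close>, since the induction
    passes to the shifted sequence.\<close>
  have claim: "\<exists>u\<in>free_module (Suc j) r. \<exists>v0\<in>free_module j r.
      vec r (\<lambda>i. \<Sum>c<N. ?x ^ c * a c $ i) = (?x \<cdot>\<^sub>v u - Y *\<^sub>v u) + v0"
    if "\<And>c. a c \<in> free_module j r" for N a
    using that
  proof (induction N arbitrary: a)
    case 0
    show ?case
      by (rule bexI[of _ "0\<^sub>v r"], rule bexI[of _ "0\<^sub>v r"])
         (use mult_mat_zero_vec[OF Y(1)] in \<open>auto intro!: eq_vecI\<close>)
  next
    case (Suc N)
    obtain u b where u: "u \<in> free_module (Suc j) r" and b: "b \<in> free_module j r"
      and eq: "vec r (\<lambda>i. \<Sum>c<N. ?x ^ c * a (Suc c) $ i) = (?x \<cdot>\<^sub>v u - Y *\<^sub>v u) + b"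
      using Suc.IH[of "\<lambda>c. a (Suc c)"] Suc.prems by blast
    have "vec r (\<lambda>i. \<Sum>c<Suc N. ?x ^ c * a c $ i)
        = a 0 + ?x \<cdot>\<^sub>v vec r (\<lambda>i. \<Sum>c<N. ?x ^ c * a (Suc c) $ i)"
      using free_module_dim[OF Suc.prems[of 0]]
      by (intro eq_vecI)
         (simp_all add: sum.lessThan_Suc_shift sum_distrib_left mult.assoc del: sum.lessThan_Suc)
    also have "\<dots> = (?x \<cdot>\<^sub>v (?x \<cdot>\<^sub>v u + b) - Y *\<^sub>v (?x \<cdot>\<^sub>v u + b)) + (a 0 + Y *\<^sub>v b)"
      unfolding eq
      by (rule division_step[OF Y(1)]) (rule free_module_carrier[OF Suc.prems] free_module_carrier[OF u]
          free_module_carrier[OF b])+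
    finally have e: "vec r (\<lambda>i. \<Sum>c<Suc N. ?x ^ c * a c $ i)
      = (?x \<cdot>\<^sub>v (?x \<cdot>\<^sub>v u + b) - Y *\<^sub>v (?x \<cdot>\<^sub>v u + b)) + (a 0 + Y *\<^sub>v b)" .
    have "?x \<cdot>\<^sub>v u + b \<in> free_module (Suc j) r"
      by (intro free_module_add free_module_smult u polys_var free_module_mono[OF b]) auto
    moreover have "a 0 + Y *\<^sub>v b \<in> free_module j r"
      by (intro free_module_add Suc.prems free_module_mult_mat[OF Y(1) pmat_mono[OF Y(2)] b]) simp
    ultimately show ?case using e by blast
  qed
  obtain N where N: "\<And>c. c \<ge> N \<Longrightarrow> cvec (Suc j) c v = 0\<^sub>v r"
    using cvec_eventually_zero[OF free_module_carrier[OF v]] by blast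
  have "\<exists>u\<in>free_module (Suc j) r. \<exists>v0\<in>free_module j r. v = (?x \<cdot>\<^sub>v u - Y *\<^sub>v u) + v0"
    using claim[of "\<lambda>c. cvec (Suc j) c v" N, OF cvec_free[OF v]]
    by (simp only: cvec_expand[OF free_module_carrier[OF v] N, symmetric])
  then show ?thesis using that by blast
qed

text \<open>Preimages of the coefficient vectors are combined with powers of the new variable, which
  commute with \<open>A\<close>.\<close>

lemma assemble:
  fixes A :: "'k::comm_ring_1 mpoly mat"
  assumes A: "A \<in> carrier_mat r s" "pmat j A" and v: "v \<in> free_module (Suc j) r"
    and c: "\<And>c. \<exists>w\<in>free_module j s. cvec (Suc j) c v = A *\<^sub>v w"
  obtains w where "w \<in> free_module (Suc j) s" "v = A *\<^sub>v w"
proof -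
  let ?x = "mvar (Suc j) :: 'k mpoly"
  obtain f where f: "\<And>c. f c \<in> free_module j s" "\<And>c. cvec (Suc j) c v = A *\<^sub>v f c"
    using c by metis
  obtain N where N: "\<And>c. c \<ge> N \<Longrightarrow> cvec (Suc j) c v = 0\<^sub>v r"
    using cvec_eventually_zero[OF free_module_carrier[OF v]] by blast
  define w where "w = vec s (\<lambda>i. \<Sum>c<N. ?x ^ c * f c $ i)"
  have "v = A *\<^sub>v w"
    unfolding w_def mult_mat_vec_sum[OF A(1) free_module_carrier[OF f(1)]] f(2)[symmetric]
    by (rule cvec_expand[OF free_module_carrier[OF v] N])
  moreover have "w \<in> free_module (Suc j) s"
  proof (rule free_moduleI)
    fix i assume i: "i < s"
    have "f c $ i \<in> polys (Suc j)" for c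
      using polys_mono[OF free_moduleD[OF f(1) i]] by simp
    then show "w $ i \<in> polys (Suc j)"
      unfolding w_def index_vec[OF i] by (intro polys_sum polys_mult polys_power polys_var) auto
  qed (simp add: w_def)
  ultimately show ?thesis using that by blast
qed

lemma cvec_carrier: "v \<in> carrier_vec r \<Longrightarrow> cvec l c v \<in> carrier_vec r"
  by (simp add: cvec_def)

lemma cvec_diff:
  assumes "v \<in> carrier_vec r" "w \<in> carrier_vec r"
  shows "cvec l c (v - w) = cvec l c v - cvec l c w"
proof -
  interpret comm_ring_hom "mcoeffs l :: 'a mpoly \<Rightarrow> _" by (rule mcoeffs_hom)
  show ?thesis using assms by (intro eq_vecI) (auto simp: hom_minus)
qed

lemma cvec_smult_mvar:
  assumes "v \<in> carrier_vec r"
  shows "cvec l (Suc c) (mvar l \<cdot>\<^sub>v v) = cvec l c v"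
proof -
  interpret comm_ring_hom "mcoeffs l :: 'a mpoly \<Rightarrow> _" by (rule mcoeffs_hom)
  have "mcoeffs l (mvar l * p) = pCons 0 (mcoeffs l p)" for p :: "'a mpoly"
    unfolding hom_mult mcoeffs_var by simp
  then show ?thesis using assms by (intro eq_vecI) auto
qed

text \<open>Here \<open>polys 0\<close> is \<open>k[x_0]\<close>. By \<open>rel\<close> the matrix
  \<open>X l\<close> describes multiplication by \<open>mvar l\<close> on the elements \<gamma>
  modulo \<open>Z\<close>, and \<open>free\<close> says that these are linearly independent over
  \<open>k[x_0]\<close> modulo \<open>Z\<close>. Zero matrices outside \<open>1..d\<close> let
  commutation hold for all indices.\<close>

locale koszul = eval_module +
  fixes m :: nat and X :: "nat \<Rightarrow> 'a mpoly mat" and \<gamma> :: "nat \<Rightarrow> 'b"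
  assumes X: "X l \<in> carrier_mat m m"
    and P: "pmat 0 (X l)"
    and X_out: "l \<notin> {1..d} \<Longrightarrow> X l = 0\<^sub>m m m"
    and rel: "l \<in> {1..d} \<Longrightarrow> w < m \<Longrightarrow> lam ev \<gamma> m (col (X l) w) - ev (mvar l) * \<gamma> w \<in> Z"
    and free: "v \<in> free_module 0 m \<Longrightarrow> lam ev \<gamma> m v \<in> Z \<Longrightarrow> v = 0\<^sub>v m"
begin

lemma lam_X:
  assumes l: "l \<in> {1..d}" and v: "v \<in> free_module d m"
  shows "lam ev \<gamma> m (X l *\<^sub>v v) - ev (mvar l) * lam ev \<gamma> m v \<in> Z"
proof -
  have "lam ev \<gamma> m (X l *\<^sub>v v) - lam ev (\<lambda>w. ev (mvar l) * \<gamma> w) m v \<in> Z"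
    by (rule lam_mult_mat_cong[OF X v rel[OF l]])
  also have "lam ev (\<lambda>w. ev (mvar l) * \<gamma> w) m v = ev (mvar l) * lam ev \<gamma> m v"
    by (simp add: lam_def sum_distrib_left mult.left_commute)
  finally show ?thesis .
qed

lemma X_free: "v \<in> free_module e m \<Longrightarrow> X l *\<^sub>v v \<in> free_module e m"
  by (rule free_module_mult_mat[OF X pmat_mono[OF P]]) auto

lemma lam_XX:
  assumes k: "k \<in> {1..d}" and l: "l \<in> {1..d}" and v: "v \<in> free_module d m"
  shows "lam ev \<gamma> m (X k *\<^sub>v (X l *\<^sub>v v)) - ev (mvar k) * (ev (mvar l) * lam ev \<gamma> m v) \<in> Z"
proof -
  have "ev (mvar k) * (lam ev \<gamma> m (X l *\<^sub>v v) - ev (mvar l) * lam ev \<gamma> m v) \<in> Z"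
    using k by (intro Z_mult lam_X l v) auto
  then have "ev (mvar k) * lam ev \<gamma> m (X l *\<^sub>v v) - ev (mvar k) * (ev (mvar l) * lam ev \<gamma> m v) \<in> Z"
    by (simp only: right_diff_distrib)
  from Z_diff_trans[OF lam_X[OF k X_free[OF v]] this] show ?thesis .
qed

text \<open>Both products describe multiplication by \<open>mvar k * mvar l\<close> modulo
  \<open>Z\<close>. The difference of two corresponding columns has entries in \<open>k[x_0]\<close>
  and is sent into \<open>Z\<close>, so it is zero by \<open>free\<close>.\<close>

lemma comm: "X k * X l = X l * X k"
proof (cases "k \<in> {1..d} \<and> l \<in> {1..d}")
  case True
  show ?thesis
  proof (rule mat_col_eqI)
    fix w assume "w < dim_col (X l * X k)"
    then have w: "w < m" using X[of k] by simp
    let ?e = "unit_vec m w :: 'a mpoly vec"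
    have e0: "?e \<in> free_module 0 m" and ed: "?e \<in> free_module d m" and ec: "?e \<in> carrier_vec m"
      by simp_all
    let ?u = "X k *\<^sub>v (X l *\<^sub>v ?e) - X l *\<^sub>v (X k *\<^sub>v ?e)"
    have cl: "X k *\<^sub>v (X l *\<^sub>v ?e) \<in> carrier_vec m" "X l *\<^sub>v (X k *\<^sub>v ?e) \<in> carrier_vec m"
      using free_module_carrier X_free e0 by blast+
    have u: "?u \<in> free_module 0 m"
      by (intro free_module_diff X_free e0)
    have "lam ev \<gamma> m (X l *\<^sub>v (X k *\<^sub>v ?e)) - ev (mvar k) * (ev (mvar l) * lam ev \<gamma> m ?e) \<in> Z"
      using lam_XX[of l k, OF _ _ ed] True by (simp add: mult.left_commute)
    from Z_diff_trans[OF lam_XX[of k l, OF _ _ ed] Z_diff_sym[OF this]] True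
    have "lam ev \<gamma> m ?u \<in> Z"
      by (simp add: lam_diff[OF cl])
    from free[OF u this] have "X k *\<^sub>v (X l *\<^sub>v ?e) - X l *\<^sub>v (X k *\<^sub>v ?e) = 0\<^sub>v m" .
    then have "X k *\<^sub>v (X l *\<^sub>v ?e) = X l *\<^sub>v (X k *\<^sub>v ?e)"
      by (rule vec_diff_eq_zero[OF cl])
    then show "col (X k * X l) w = col (X l * X k) w"
      unfolding col_mult_unit_vec[OF X X w] .
  qed (use X[of k] X[of l] in auto)
next
  case False
  then have "X k = 0\<^sub>m m m \<or> X l = 0\<^sub>m m m" using X_out by blast
  then show ?thesis using X[of k] X[of l] by auto
qed

lemma koszul_map_carrier': "koszul_map m mvar X j l i \<in> carrier_mat (koszul_rank m j i) (koszul_rank m j i)"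
  by (rule koszul_map_carrier[OF X])

lemma koszul_map_mult_vec':
  "v \<in> carrier_vec (koszul_rank m j i) \<Longrightarrow> koszul_map m mvar X j l i *\<^sub>v v = mvar l \<cdot>\<^sub>v v - koszul_act m (X l) j i *\<^sub>v v"
  by (rule koszul_map_mult_vec[OF X])

text \<open>Index 1 is homological degree 0, a single copy of the module of rank \<open>m\<close>,
  on which \<open>koszul_act\<close> is just \<open>X l\<close>; and \<open>X l\<close> agrees with
  \<open>mvar l\<close> after augmentation, modulo \<open>Z\<close>.\<close>

lemma lam_koszul_map:
  assumes l: "l \<in> {1..d}" and v: "v \<in> free_module d m"
  shows "lam ev \<gamma> m (koszul_map m mvar X j l 1 *\<^sub>v v) \<in> Z"
proof -
  have kx: "koszul_act m (X l) j 1 *\<^sub>v v = X l *\<^sub>v v" if "v \<in> carrier_vec m" for v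
    using that
  proof (induction j)
    case (Suc j)
    note c1 = koszul_act_carrier[OF X, of l j 1] and c0 = koszul_act_carrier[OF X, of l j 0]
    have "koszul_act m (X l) (Suc j) 1
        = four_block_mat (koszul_act m (X l) j 1) (0\<^sub>m m 0) (0\<^sub>m 0 m) (koszul_act m (X l) j 0)" by simp
    moreover have "\<dots> *\<^sub>v (v @\<^sub>v 0\<^sub>v 0) = koszul_act m (X l) j 1 *\<^sub>v v @\<^sub>v koszul_act m (X l) j 0 *\<^sub>v 0\<^sub>v 0"
      using c1 c0 Suc.prems by (intro mult_mat_vec_split) auto
    moreover have "koszul_act m (X l) j 0 *\<^sub>v 0\<^sub>v 0 \<in> carrier_vec 0"
      using c0 by auto
    ultimately show ?case
      using Suc.IH[OF Suc.prems] append_vec_empty[of "0\<^sub>v 0" v] by (simp only: append_vec_empty zero_carrier_vec)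
  qed simp
  have c: "v \<in> carrier_vec m" by (rule free_module_carrier[OF v])
  have "koszul_map m mvar X j l 1 *\<^sub>v v = mvar l \<cdot>\<^sub>v v - X l *\<^sub>v v"
    using koszul_map_mult_vec'[of v j 1 l] c kx[OF c] by simp
  moreover have "lam ev \<gamma> m (mvar l \<cdot>\<^sub>v v - X l *\<^sub>v v) = ev (mvar l) * lam ev \<gamma> m v - lam ev \<gamma> m (X l *\<^sub>v v)"
    using c free_module_carrier[OF X_free[OF v]] by (subst lam_diff) (auto simp: lam_smult)
  ultimately show ?thesis using Z_diff_sym[OF lam_X[OF l v]] by simp
qed

lemma koszul_diff_carrier': "koszul_diff m mvar X j i \<in> carrier_mat (koszul_rank m j i) (koszul_rank m j (Suc i))"
  by (rule koszul_diff_carrier[OF X])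

lemma koszul_diff_pmat': "pmat j (koszul_diff m mvar X j i)"
  by (rule koszul_diff_pmat[OF X P])

lemma koszul_diff_koszul_act': "koszul_diff m mvar X j i * koszul_act m (X l) j (Suc i) = koszul_act m (X l) j i * koszul_diff m mvar X j i"
  by (rule koszul_diff_koszul_act[OF X comm])

lemma koszul_diff_koszul_map': "koszul_diff m mvar X j i * koszul_map m mvar X j l (Suc i) = koszul_map m mvar X j l i * koszul_diff m mvar X j i"
  by (rule koszul_diff_koszul_map[OF X comm])

lemma koszul_diff_koszul_diff': "koszul_diff m mvar X j i * koszul_diff m mvar X j (Suc i) = 0\<^sub>m (koszul_rank m j i) (koszul_rank m j (Suc (Suc i)))"
  by (rule koszul_diff_koszul_diff[OF X comm])

lemma koszul_diff_Suc_vec: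
  assumes "a \<in> carrier_vec (koszul_rank m j (Suc (Suc i)))" "c \<in> carrier_vec (koszul_rank m j (Suc i))"
  shows "koszul_diff m mvar X (Suc j) (Suc i) *\<^sub>v (a @\<^sub>v c)
    = (koszul_diff m mvar X j (Suc i) *\<^sub>v a + koszul_map m mvar X j (Suc j) (Suc i) *\<^sub>v c) @\<^sub>v (- (koszul_diff m mvar X j i *\<^sub>v c))"
proof -
  have "koszul_diff m mvar X (Suc j) (Suc i) *\<^sub>v (a @\<^sub>v c)
    = (koszul_diff m mvar X j (Suc i) *\<^sub>v a + koszul_map m mvar X j (Suc j) (Suc i) *\<^sub>v c)
      @\<^sub>v (0\<^sub>m (koszul_rank m j i) (koszul_rank m j (Suc (Suc i))) *\<^sub>v a + - koszul_diff m mvar X j i *\<^sub>v c)"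
    unfolding koszul_diff.simps
    by (rule four_block_mat_mult_vec[OF koszul_diff_carrier' koszul_map_carrier' zero_carrier_mat
          uminus_carrier_mat[OF koszul_diff_carrier'] assms])
  also have "0\<^sub>m (koszul_rank m j i) (koszul_rank m j (Suc (Suc i))) *\<^sub>v a + - koszul_diff m mvar X j i *\<^sub>v c
      = - (koszul_diff m mvar X j i *\<^sub>v c)"
    using koszul_diff_carrier'[of j i] assms by (simp add: zero_mat_mult_vec)
  finally show ?thesis .
qed

lemma koszul_diff_koszul_diff_vec:
  assumes "v \<in> carrier_vec (koszul_rank m j (Suc (Suc i)))"
  shows "koszul_diff m mvar X j i *\<^sub>v (koszul_diff m mvar X j (Suc i) *\<^sub>v v) = 0\<^sub>v (koszul_rank m j i)"
  unfolding assoc_mult_mat_vec[OF koszul_diff_carrier' koszul_diff_carrier' assms, symmetric] koszul_diff_koszul_diff'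
  by (rule zero_mat_mult_vec[OF assms])

lemma koszul_diff_koszul_map_vec:
  assumes "v \<in> carrier_vec (koszul_rank m j (Suc i))"
  shows "koszul_diff m mvar X j i *\<^sub>v (koszul_map m mvar X j l (Suc i) *\<^sub>v v)
    = koszul_map m mvar X j l i *\<^sub>v (koszul_diff m mvar X j i *\<^sub>v v)"
  unfolding assoc_mult_mat_vec[OF koszul_diff_carrier' koszul_map_carrier' assms, symmetric]
    assoc_mult_mat_vec[OF koszul_map_carrier' koszul_diff_carrier' assms, symmetric] koszul_diff_koszul_map' ..

lemma lam_koszul_diff:
  assumes "j \<le> d" and w: "w \<in> free_module d (koszul_rank m j 2)"
  shows "lam ev \<gamma> m (koszul_diff m mvar X j 1 *\<^sub>v w) \<in> Z"
  using assms
proof (induction j arbitrary: w)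
  case 0
  then have "koszul_diff m mvar X 0 1 *\<^sub>v w = 0\<^sub>v m"
    using zero_mat_mult_vec[of w 0 m] by (simp add: free_module_carrier)
  then show ?case by (simp add: lam_zero Z_0)
next
  case (Suc j)
  have "w \<in> free_module d (koszul_rank m j (Suc (Suc 0)) + koszul_rank m j (Suc 0))"
    using Suc.prems(2) by (simp add: numeral_2_eq_2)
  then obtain a c where a: "a \<in> free_module d (koszul_rank m j (Suc (Suc 0)))"
    and c: "c \<in> free_module d (koszul_rank m j (Suc 0))" and w: "w = a @\<^sub>v c"
    by (rule free_module_split)
  note cc = free_module_carrier[OF a] free_module_carrier[OF c]
  have z: "- (koszul_diff m mvar X j 0 *\<^sub>v c) \<in> carrier_vec 0"
    using mult_mat_vec_carrier[OF koszul_diff_carrier' cc(2)] by simp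
  have s: "koszul_diff m mvar X j (Suc 0) *\<^sub>v a \<in> carrier_vec m" "koszul_map m mvar X j (Suc j) (Suc 0) *\<^sub>v c \<in> carrier_vec m"
    using mult_mat_vec_carrier[OF koszul_diff_carrier' cc(1)] mult_mat_vec_carrier[OF koszul_map_carrier' cc(2)]
    by simp_all
  have "koszul_diff m mvar X (Suc j) 1 *\<^sub>v w
    = koszul_diff m mvar X j (Suc 0) *\<^sub>v a + koszul_map m mvar X j (Suc j) (Suc 0) *\<^sub>v c"
    using koszul_diff_Suc_vec[OF cc] by (simp only: w append_vec_empty[OF z] One_nat_def)
  moreover have "lam ev \<gamma> m (koszul_diff m mvar X j (Suc 0) *\<^sub>v a) \<in> Z"
    using Suc.IH[of a] Suc.prems(1) a by (simp add: numeral_2_eq_2)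
  moreover have "lam ev \<gamma> m (koszul_map m mvar X j (Suc j) (Suc 0) *\<^sub>v c) \<in> Z"
    using lam_koszul_map[of "Suc j" c j] Suc.prems(1) c by simp
  ultimately show ?case using lam_add[OF s] Z_add by simp
qed

lemma base_injective:
  assumes exact: "\<And>v. v \<in> free_module j r \<Longrightarrow> Q v \<Longrightarrow> \<exists>w\<in>free_module j s. v = A *\<^sub>v w"
    and A: "A \<in> carrier_mat r s" "pmat j A" and v: "v \<in> free_module (Suc j) r"
    and c: "\<And>c. Q (cvec (Suc j) c v)"
  shows "\<exists>w\<in>free_module (Suc j) s. v = A *\<^sub>v w"
  by (rule assemble[OF A v]) (use exact[OF cvec_free[OF v] c] in blast)+

text \<open>Flatness of adjoining a variable: the coefficient vectors of a cycle are cycles over the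
  smaller ring, and their preimages are assembled.\<close>

lemma koszul_diff_exact_lift:
  assumes exact: "\<And>v. v \<in> free_module j (koszul_rank m j (Suc i)) \<Longrightarrow> koszul_diff m mvar X j i *\<^sub>v v = 0\<^sub>v (koszul_rank m j i) \<Longrightarrow>
      \<exists>w\<in>free_module j (koszul_rank m j (Suc (Suc i))). v = koszul_diff m mvar X j (Suc i) *\<^sub>v w"
    and v: "v \<in> free_module (Suc j) (koszul_rank m j (Suc i))" and z: "koszul_diff m mvar X j i *\<^sub>v v = 0\<^sub>v (koszul_rank m j i)"
  shows "\<exists>w\<in>free_module (Suc j) (koszul_rank m j (Suc (Suc i))). v = koszul_diff m mvar X j (Suc i) *\<^sub>v w"
proof (rule base_injective[OF exact koszul_diff_carrier' koszul_diff_pmat' v])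
  fix c
  interpret mc: comm_ring_hom "mcoeffs (Suc j) :: 'a mpoly \<Rightarrow> _" by (rule mcoeffs_hom)
  have "koszul_diff m mvar X j i *\<^sub>v cvec (Suc j) c v = cvec (Suc j) c (koszul_diff m mvar X j i *\<^sub>v v)"
    by (rule cvec_mult[OF koszul_diff_carrier' koszul_diff_pmat' free_module_carrier[OF v], symmetric]) simp
  also have "\<dots> = 0\<^sub>v (koszul_rank m j i)"
    unfolding z by (intro eq_vecI) auto
  finally show "koszul_diff m mvar X j i *\<^sub>v cvec (Suc j) c v = 0\<^sub>v (koszul_rank m j i)" .
qed

text \<open>Injectivity of the new operator on the cokernel of \<open>koszul_diff\<close> at index
  \<open>i\<close>. Since the operator is monic in the new variable, the coefficients of
  \<open>v\<close> can be recognized as boundaries from the highest one downwards.\<close>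

lemma koszul_map_injective:
  assumes v: "v \<in> free_module (Suc j) r" and r: "r = koszul_rank m j i"
    and w: "w \<in> free_module (Suc j) (koszul_rank m j (Suc i))"
    and eq: "koszul_map m mvar X j (Suc j) i *\<^sub>v v = koszul_diff m mvar X j i *\<^sub>v w"
  shows "\<exists>u\<in>free_module (Suc j) (koszul_rank m j (Suc i)). v = koszul_diff m mvar X j i *\<^sub>v u"
proof -
  let ?D = "koszul_diff m mvar X j i" and ?Y = "koszul_act m (X (Suc j)) j" and ?c = "\<lambda>c. cvec (Suc j) c"
  note Yc = koszul_act_carrier[OF X, of "Suc j" j] and YP = koszul_act_pmat[OF X P, of "Suc j" j]
  have v': "v \<in> free_module (Suc j) (koszul_rank m j i)" using v r by simp
  note vc = free_module_carrier[OF v']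
  obtain N where N: "\<And>c. c \<ge> N \<Longrightarrow> ?c c v = 0\<^sub>v (koszul_rank m j i)"
    using cvec_eventually_zero[OF vc] by blast
  \<comment> \<open>Comparing coefficients of degree \<open>Suc c\<close> in \<open>eq\<close>
    expresses the coefficient of degree \<open>c\<close> through the next higher one, up to a
    boundary.\<close>
  have descend: "?c c v = ?D *\<^sub>v (?c (Suc c) w + ?Y (Suc i) *\<^sub>v e)"
    if e: "e \<in> free_module j (koszul_rank m j (Suc i))" "?c (Suc c) v = ?D *\<^sub>v e" for c e
  proof -
    have Ym: "?c (Suc c) (?Y i *\<^sub>v v) = ?Y i *\<^sub>v ?c (Suc c) v"
      by (rule cvec_mult[OF Yc YP vc]) simp
    have "?c (Suc c) (koszul_map m mvar X j (Suc j) i *\<^sub>v v) = ?c c v - ?Y i *\<^sub>v ?c (Suc c) v"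
      unfolding koszul_map_mult_vec'[OF vc]
      by (subst cvec_diff[OF _ mult_mat_vec_carrier[OF Yc vc]])
         (use vc in \<open>simp_all only: cvec_smult_mvar Ym smult_carrier_vec\<close>)
    moreover have "?c (Suc c) (?D *\<^sub>v w) = ?D *\<^sub>v ?c (Suc c) w"
      by (rule cvec_mult[OF koszul_diff_carrier' koszul_diff_pmat' free_module_carrier[OF w]]) simp
    ultimately have 1: "?c c v - ?Y i *\<^sub>v ?c (Suc c) v = ?D *\<^sub>v ?c (Suc c) w"
      using eq by simp
    have "?Y i *\<^sub>v (?D *\<^sub>v e) = ?D *\<^sub>v (?Y (Suc i) *\<^sub>v e)"
      unfolding assoc_mult_mat_vec[OF Yc koszul_diff_carrier' free_module_carrier[OF e(1)], symmetric]
        assoc_mult_mat_vec[OF koszul_diff_carrier' Yc free_module_carrier[OF e(1)], symmetric]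
        koszul_diff_koszul_act' ..
    then have 2: "?c c v - ?D *\<^sub>v (?Y (Suc i) *\<^sub>v e) = ?D *\<^sub>v ?c (Suc c) w"
      using 1 e(2) by simp
    have cc: "?c c v \<in> carrier_vec (koszul_rank m j i)" "?c (Suc c) w \<in> carrier_vec (koszul_rank m j (Suc i))"
      using vc free_module_carrier[OF w] by (simp_all add: cvec_carrier)
    have ye: "?Y (Suc i) *\<^sub>v e \<in> carrier_vec (koszul_rank m j (Suc i))"
      by (rule mult_mat_vec_carrier[OF Yc free_module_carrier[OF e(1)]])
    have "?c c v = (?c c v - ?D *\<^sub>v (?Y (Suc i) *\<^sub>v e)) + ?D *\<^sub>v (?Y (Suc i) *\<^sub>v e)"
      by (rule vec_diff_add_cancel[OF cc(1) mult_mat_vec_carrier[OF koszul_diff_carrier' ye], symmetric])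
    also have "\<dots> = ?D *\<^sub>v (?c (Suc c) w + ?Y (Suc i) *\<^sub>v e)"
      unfolding 2 by (rule mult_add_distrib_mat_vec[OF koszul_diff_carrier' cc(2) ye, symmetric])
    finally show ?thesis .
  qed
  \<comment> \<open>Downward induction starting at \<open>N\<close>, where the coefficient is
    zero.\<close>
  have im: "\<exists>e\<in>free_module j (koszul_rank m j (Suc i)). ?c c v = ?D *\<^sub>v e" if "c \<le> N" for c
    using that
  proof (induction c rule: inc_induct)
    case base
    have "?c N v = ?D *\<^sub>v 0\<^sub>v (koszul_rank m j (Suc i))"
      unfolding mult_mat_zero_vec[OF koszul_diff_carrier'] by (rule N) simp
    then show ?case using free_module_zero by blast
  next
    case (step c)
    then obtain e where e: "e \<in> free_module j (koszul_rank m j (Suc i))" "?c (Suc c) v = ?D *\<^sub>v e" by blast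
    have "?c (Suc c) w + ?Y (Suc i) *\<^sub>v e \<in> free_module j (koszul_rank m j (Suc i))"
      by (intro free_module_add cvec_free w free_module_mult_mat[OF Yc pmat_mono[OF YP] e(1)]) simp
    then show ?case using descend[OF e] by blast
  qed
  have "\<exists>e\<in>free_module j (koszul_rank m j (Suc i)). ?c c v = ?D *\<^sub>v e" for c
  proof (cases "c \<le> N")
    case False
    then have "?c c v = ?D *\<^sub>v 0\<^sub>v (koszul_rank m j (Suc i))"
      unfolding mult_mat_zero_vec[OF koszul_diff_carrier'] by (intro N) simp
    then show ?thesis using free_module_zero by blast
  qed (rule im)
  from assemble[OF koszul_diff_carrier' koszul_diff_pmat' v' this] show ?thesis by blast
qed

text \<open>The long exact sequence of the mapping cone, by hand. For \<open>j = 0\<close> exactness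
  is the independence of \<gamma> over \<open>k[x_0]\<close>. In the step, degree 0 uses division by
  the new operator, degree 1 its injectivity on the cokernel, and the higher degrees the exactness
  already known.\<close>

theorem koszul_exact:
  assumes "j \<le> d"
  shows "(\<forall>v\<in>free_module j m. lam ev \<gamma> m v \<in> Z \<longrightarrow>
      (\<exists>w\<in>free_module j (koszul_rank m j (Suc (Suc 0))). v = koszul_diff m mvar X j (Suc 0) *\<^sub>v w)) \<and>
    (\<forall>i. \<forall>v\<in>free_module j (koszul_rank m j (Suc (Suc i))). koszul_diff m mvar X j (Suc i) *\<^sub>v v = 0\<^sub>v (koszul_rank m j (Suc i)) \<longrightarrow>
      (\<exists>w\<in>free_module j (koszul_rank m j (Suc (Suc (Suc i)))). v = koszul_diff m mvar X j (Suc (Suc i)) *\<^sub>v w))"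
  using assms
proof (induction j)
  case 0
  show ?case
  proof (intro conjI ballI allI impI)
    fix v assume v: "v \<in> free_module 0 m" "lam ev \<gamma> m v \<in> Z"
    have "koszul_diff m mvar X 0 (Suc 0) *\<^sub>v 0\<^sub>v 0 = 0\<^sub>v m"
      using mult_mat_zero_vec[OF koszul_diff_carrier'[of 0 "Suc 0"]] by simp
    then have "v = koszul_diff m mvar X 0 (Suc 0) *\<^sub>v 0\<^sub>v 0"
      using free[OF v] by (simp only:)
    then show "\<exists>w\<in>free_module 0 (koszul_rank m 0 (Suc (Suc 0))). v = koszul_diff m mvar X 0 (Suc 0) *\<^sub>v w"
      using free_module_zero[of 0 0] by (intro bexI[of _ "0\<^sub>v 0"]) simp_all
  next
    fix i and v :: "'a mpoly vec" assume "v \<in> free_module 0 (koszul_rank m 0 (Suc (Suc i)))"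
    then have "v \<in> carrier_vec 0" using free_module_carrier[of v 0 0] by simp
    then have "v = koszul_diff m mvar X 0 (Suc (Suc i)) *\<^sub>v 0\<^sub>v 0"
      by (intro eq_vecI) auto
    then show "\<exists>w\<in>free_module 0 (koszul_rank m 0 (Suc (Suc (Suc i)))). v = koszul_diff m mvar X 0 (Suc (Suc i)) *\<^sub>v w"
      using free_module_zero[of 0 0] by (intro bexI[of _ "0\<^sub>v 0"]) simp_all
  qed
next
  case (Suc j)
  let ?D = "koszul_diff m mvar X j" and ?p = "koszul_map m mvar X j (Suc j)"
  have IH1: "\<exists>w\<in>free_module j (koszul_rank m j (Suc (Suc 0))). v = ?D (Suc 0) *\<^sub>v w"
    if "v \<in> free_module j m" "lam ev \<gamma> m v \<in> Z" "j \<le> d" for v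
    using Suc.IH[OF that(3)] that(1,2) by blast
  have IH2: "\<exists>w\<in>free_module j (koszul_rank m j (Suc (Suc (Suc i)))). v = ?D (Suc (Suc i)) *\<^sub>v w"
    if "v \<in> free_module j (koszul_rank m j (Suc (Suc i)))" "?D (Suc i) *\<^sub>v v = 0\<^sub>v (koszul_rank m j (Suc i))" "j \<le> d" for i v
    using Suc.IH[OF that(3)] that(1,2) by blast
  show ?case
  proof (intro conjI ballI allI impI)
    fix v assume "v \<in> free_module (Suc j) m" "lam ev \<gamma> m v \<in> Z"
    note 1 = this Suc.prems
    have jd: "j \<le> d" and Sjd: "Suc j \<in> {1..d}" using 1(3) by auto
    note Yc = koszul_act_carrier[OF X, of "Suc j" j 1, unfolded One_nat_def koszul_rank_1]
      and YP = koszul_act_pmat[OF X P, of "Suc j" j 1, unfolded One_nat_def]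
    \<comment> \<open>Up to the image of the new operator, \<open>v\<close> may be replaced by the
      remainder \<open>v0\<close>, which lives over \<open>polys j\<close>, so that the induction
      hypothesis applies.\<close>
    obtain u v0 where u: "u \<in> free_module (Suc j) m" and v0: "v0 \<in> free_module j m"
      and v: "v = (mvar (Suc j) \<cdot>\<^sub>v u - koszul_act m (X (Suc j)) j (Suc 0) *\<^sub>v u) + v0"
      by (rule division[OF Yc YP 1(1)])
    have uc: "u \<in> carrier_vec (koszul_rank m j (Suc 0))" using free_module_carrier[OF u] by simp
    have vp: "v = ?p (Suc 0) *\<^sub>v u + v0"
      unfolding v koszul_map_mult_vec'[OF uc] ..
    have pc: "?p (Suc 0) *\<^sub>v u \<in> carrier_vec m"
      using mult_mat_vec_carrier[OF koszul_map_carrier' uc] by simp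
    have "lam ev \<gamma> m (?p (Suc 0) *\<^sub>v u) \<in> Z"
      using lam_koszul_map[OF Sjd free_module_mono[OF u], of j] 1(3) by simp
    moreover have "lam ev \<gamma> m v = lam ev \<gamma> m (?p (Suc 0) *\<^sub>v u) + lam ev \<gamma> m v0"
      unfolding vp by (rule lam_add[OF pc free_module_carrier[OF v0]])
    ultimately have "lam ev \<gamma> m v0 \<in> Z" using Z_diff[OF 1(2)] by fastforce
    then obtain w0 where w0: "w0 \<in> free_module j (koszul_rank m j (Suc (Suc 0)))" "v0 = ?D (Suc 0) *\<^sub>v w0"
      using IH1[OF v0 _ jd] by blast
    have z: "- (?D 0 *\<^sub>v u) \<in> carrier_vec 0"
      using mult_mat_vec_carrier[OF koszul_diff_carrier' uc] by simp
    have d0: "?D (Suc 0) *\<^sub>v w0 \<in> carrier_vec m"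
      using mult_mat_vec_carrier[OF koszul_diff_carrier' free_module_carrier[OF w0(1)]] by simp
    have "koszul_diff m mvar X (Suc j) (Suc 0) *\<^sub>v (w0 @\<^sub>v u) = ?D (Suc 0) *\<^sub>v w0 + ?p (Suc 0) *\<^sub>v u"
      unfolding koszul_diff_Suc_vec[OF free_module_carrier[OF w0(1)] uc] by (rule append_vec_empty[OF z])
    also have "\<dots> = v" unfolding vp w0(2) by (rule comm_add_vec[OF d0 pc])
    finally have "v = koszul_diff m mvar X (Suc j) (Suc 0) *\<^sub>v (w0 @\<^sub>v u)" ..
    moreover have "w0 @\<^sub>v u \<in> free_module (Suc j) (koszul_rank m (Suc j) (Suc (Suc 0)))"
      using free_module_append[OF free_module_mono[OF w0(1)] u] by simp
    ultimately show "\<exists>w\<in>free_module (Suc j) (koszul_rank m (Suc j) (Suc (Suc 0))). v = koszul_diff m mvar X (Suc j) (Suc 0) *\<^sub>v w"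
      by blast
  next
    fix i v'
    assume "v' \<in> free_module (Suc j) (koszul_rank m (Suc j) (Suc (Suc i)))"
      and "koszul_diff m mvar X (Suc j) (Suc i) *\<^sub>v v' = 0\<^sub>v (koszul_rank m (Suc j) (Suc i))"
    note 2 = this Suc.prems
    have jd: "j \<le> d" using 2(3) by simp
    have "v' \<in> free_module (Suc j) (koszul_rank m j (Suc (Suc i)) + koszul_rank m j (Suc i))" using 2(1) by simp
    then obtain a c where a: "a \<in> free_module (Suc j) (koszul_rank m j (Suc (Suc i)))"
      and c: "c \<in> free_module (Suc j) (koszul_rank m j (Suc i))" and v': "v' = a @\<^sub>v c"
      by (rule free_module_split)
    note ac = free_module_carrier[OF a] and cc = free_module_carrier[OF c]
    have Da: "?D (Suc i) *\<^sub>v a \<in> carrier_vec (koszul_rank m j (Suc i))" by (rule mult_mat_vec_carrier[OF koszul_diff_carrier' ac])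
    have pcc: "?p (Suc i) *\<^sub>v c \<in> carrier_vec (koszul_rank m j (Suc i))" by (rule mult_mat_vec_carrier[OF koszul_map_carrier' cc])
    have "(?D (Suc i) *\<^sub>v a + ?p (Suc i) *\<^sub>v c) @\<^sub>v (- (?D i *\<^sub>v c)) = 0\<^sub>v (koszul_rank m j (Suc i)) @\<^sub>v 0\<^sub>v (koszul_rank m j i)"
      using 2(2) unfolding v' koszul_diff_Suc_vec[OF ac cc] by (simp only: koszul_rank.simps zero_vec_append)
    then have e1: "?D (Suc i) *\<^sub>v a + ?p (Suc i) *\<^sub>v c = 0\<^sub>v (koszul_rank m j (Suc i))"
      and e2: "- (?D i *\<^sub>v c) = 0\<^sub>v (koszul_rank m j i)"
      using append_vec_eq[OF add_carrier_vec[OF Da pcc] zero_carrier_vec] by auto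
    have Dc: "?D i *\<^sub>v c \<in> carrier_vec (koszul_rank m j i)" by (rule mult_mat_vec_carrier[OF koszul_diff_carrier' cc])
    have e3: "?D i *\<^sub>v c = 0\<^sub>v (koszul_rank m j i)"
      using e2 Dc by (metis uminus_uminus_vec uminus_zero_vec)
    \<comment> \<open>The second component is a boundary. For \<open>i = 0\<close> the differential
      puts no condition on \<open>c\<close>, but \<open>e1\<close> makes its image under the new
      operator a boundary; for larger \<open>i\<close> the equation \<open>e3\<close> makes
      \<open>c\<close> a cycle.\<close>
    have "\<exists>e\<in>free_module (Suc j) (koszul_rank m j (Suc (Suc i))). c = ?D (Suc i) *\<^sub>v e"
    proof (cases i)
      case 0
      have "?p (Suc i) *\<^sub>v c = ?D (Suc i) *\<^sub>v (- a)"
        using vec_add_eq_zero[OF Da pcc e1] mult_mat_uminus_vec[OF koszul_diff_carrier' ac] by simp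
      from koszul_map_injective[OF c refl free_module_uminus[OF a] this] show ?thesis .
    next
      case (Suc i')
      show ?thesis
        unfolding Suc
        by (rule koszul_diff_exact_lift[OF IH2[OF _ _ jd] c[unfolded Suc] e3[unfolded Suc]])
    qed
    then obtain e where e: "e \<in> free_module (Suc j) (koszul_rank m j (Suc (Suc i)))" and ce: "c = ?D (Suc i) *\<^sub>v e"
      by blast
    note ec = free_module_carrier[OF e]
    have pe: "?p (Suc (Suc i)) *\<^sub>v e \<in> free_module (Suc j) (koszul_rank m j (Suc (Suc i)))"
      by (rule free_module_mult_mat[OF koszul_map_carrier' koszul_map_pmat[OF X P order.refl] e])
    note pec = free_module_carrier[OF pe]
    \<comment> \<open>Removing the cone boundary of \<open>(0, - e)\<close> from \<open>v'\<close>
      leaves \<open>(a + ?p e, 0)\<close>, whose first entry is a cycle.\<close>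
    have "?D (Suc i) *\<^sub>v (a + ?p (Suc (Suc i)) *\<^sub>v e) = 0\<^sub>v (koszul_rank m j (Suc i))"
      unfolding mult_add_distrib_mat_vec[OF koszul_diff_carrier' ac pec] koszul_diff_koszul_map_vec[OF ec] ce[symmetric] by (rule e1)
    then obtain f where f: "f \<in> free_module (Suc j) (koszul_rank m j (Suc (Suc (Suc i))))"
      and af: "a + ?p (Suc (Suc i)) *\<^sub>v e = ?D (Suc (Suc i)) *\<^sub>v f"
      using koszul_diff_exact_lift[OF IH2[OF _ _ jd] free_module_add[OF a pe]] by blast
    note fc = free_module_carrier[OF f]
    have "?D (Suc (Suc i)) *\<^sub>v f + ?p (Suc (Suc i)) *\<^sub>v (- e) = a"
      unfolding af[symmetric] mult_mat_uminus_vec[OF koszul_map_carrier' ec]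
      by (rule vec_add_uminus_cancel[OF ac pec])
    moreover have "- (?D (Suc i) *\<^sub>v (- e)) = c"
      unfolding ce mult_mat_uminus_vec[OF koszul_diff_carrier' ec] by simp
    ultimately have "v' = koszul_diff m mvar X (Suc j) (Suc (Suc i)) *\<^sub>v (f @\<^sub>v - e)"
      unfolding v' koszul_diff_Suc_vec[OF fc uminus_carrier_vec[THEN iffD2, OF ec]] by simp
    moreover have "f @\<^sub>v - e \<in> free_module (Suc j) (koszul_rank m (Suc j) (Suc (Suc (Suc i))))"
      using free_module_append[OF f free_module_uminus[OF e]] by simp
    ultimately show "\<exists>w\<in>free_module (Suc j) (koszul_rank m (Suc j) (Suc (Suc (Suc i)))).
        v' = koszul_diff m mvar X (Suc j) (Suc (Suc i)) *\<^sub>v w"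
      by blast
  qed
qed

end

subsection \<open>Resolutions and their comparison\<close>

lemma matrix_from_columns:
  fixes d :: nat
  assumes "\<And>j. j < c \<Longrightarrow> \<exists>v\<in>free_module d r. Q j v"
  obtains A where "A \<in> carrier_mat r c" "pmat d A" "\<And>j. j < c \<Longrightarrow> Q j (col A j)"
proof -
  obtain f where f: "\<And>j. j < c \<Longrightarrow> f j \<in> free_module d r \<and> Q j (f j)"
    using assms by metis
  define A where "A = mat r c (\<lambda>(i, j). f j $ i)"
  have A: "A \<in> carrier_mat r c" by (simp add: A_def)
  have "col A j = f j" if "j < c" for j
    using f[OF that] that free_module_dim[of "f j" d r] by (intro eq_vecI) (auto simp: A_def)
  moreover have "pmat d A"
    unfolding pmat_def A_def using f free_moduleD by fastforce
  ultimately show ?thesis using that[OF A] f by simp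
qed

text \<open>Projectivity of free modules in matrix form.\<close>

lemma lift_matrix:
  fixes A D :: "'k::comm_ring_1 mpoly mat"
  assumes A: "A \<in> carrier_mat r c" and D: "D \<in> carrier_mat r s"
    and ex: "\<And>j. j < c \<Longrightarrow> \<exists>w\<in>free_module d s. col A j = D *\<^sub>v w"
  obtains X where "X \<in> carrier_mat s c" "pmat d X" "D * X = A"
proof -
  obtain X where X: "X \<in> carrier_mat s c" "pmat d X" and c: "\<And>j. j < c \<Longrightarrow> col A j = D *\<^sub>v col X j"
    by (rule matrix_from_columns[of c d s "\<lambda>j w. col A j = D *\<^sub>v w"]) (use ex in auto)
  have "D * X = A"
  proof (rule mat_col_eqI)
    fix j assume "j < dim_col A"
    then have j: "j < c" using A by simp
    show "col (D * X) j = col A j" unfolding col_mult2[OF D X(1) j] c[OF j] ..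
  qed (use A D X in auto)
  then show ?thesis using that X by blast
qed

lemma pmat_col: "A \<in> carrier_mat r c \<Longrightarrow> pmat d A \<Longrightarrow> j < c \<Longrightarrow> col A j \<in> free_module d r"
  by (auto simp: free_module_def pmat_def)

lemma col_diff_one:
  fixes M :: "'a::ring_1 mat"
  shows "M \<in> carrier_mat r r \<Longrightarrow> j < r \<Longrightarrow> col (M - 1\<^sub>m r) j = col M j - unit_vec r j"
  by (intro eq_vecI) auto

lemma null_homotopy_step:
  fixes D D' x y \<theta>1 \<theta>2 :: "'a::comm_ring_1 mat"
  assumes D: "D \<in> carrier_mat a b" and D': "D' \<in> carrier_mat b c"
    and x: "x \<in> carrier_mat b a" and y: "y \<in> carrier_mat c b"
    and \<theta>1: "\<theta>1 \<in> carrier_mat b b" and \<theta>2: "\<theta>2 \<in> carrier_mat c c"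
    and DD: "D * D' = 0\<^sub>m a c" and comm: "D' * \<theta>2 = \<theta>1 * D'" and y_eq: "D' * y = \<theta>1 - x * D"
  shows "D' * (\<theta>2 - y * D') = 0\<^sub>m b c"
proof -
  have xD: "x * D \<in> carrier_mat b b" using x D by simp
  have "D' * (\<theta>2 - y * D') = \<theta>1 * D' - (D' * y) * D'"
    using mult_minus_distrib_mat[OF D' \<theta>2, of "y * D'"] y D' comm assoc_mult_mat[OF D' y D'] by simp
  also have "\<dots> = \<theta>1 * D' - (\<theta>1 * D' - x * (D * D'))"
    unfolding y_eq minus_mult_distrib_mat[OF \<theta>1 xD D'] assoc_mult_mat[OF x D D'] ..
  also have "\<dots> = 0\<^sub>m b c" unfolding DD using \<theta>1 D' x by (intro eq_matI) auto
  finally show ?thesis .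
qed

context eval_module
begin

text \<open>A free resolution of \<open>B / (B \<inter> Z)\<close>.\<close>

definition res :: "'a set \<Rightarrow> (nat \<Rightarrow> nat) \<Rightarrow> (nat \<Rightarrow> 'a) \<Rightarrow> (nat \<Rightarrow> 'k mpoly mat) \<Rightarrow> bool" where
  "res B b \<gamma> D \<longleftrightarrow>
     (\<forall>j<b 0. \<gamma> j \<in> B) \<and>
     (\<forall>i. D i \<in> carrier_mat (b i) (b (Suc i)) \<and> pmat d (D i)) \<and>
     (\<forall>F\<in>B. \<exists>v\<in>free_module d (b 0). lam ev \<gamma> (b 0) v - F \<in> Z) \<and>
     (\<forall>v\<in>free_module d (b 0). lam ev \<gamma> (b 0) v \<in> Z \<longleftrightarrow> (\<exists>w\<in>free_module d (b 1). v = D 0 *\<^sub>v w)) \<and>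
     (\<forall>i. \<forall>v\<in>free_module d (b (Suc i)). D i *\<^sub>v v = 0\<^sub>v (b i) \<longleftrightarrow>
        (\<exists>w\<in>free_module d (b (Suc (Suc i))). v = D (Suc i) *\<^sub>v w))"

lemma
  assumes "res B b \<gamma> D"
  shows res_gen: "j < b 0 \<Longrightarrow> \<gamma> j \<in> B"
    and res_carrier: "D i \<in> carrier_mat (b i) (b (Suc i))"
    and res_pmat: "pmat d (D i)"
    and res_surj: "F \<in> B \<Longrightarrow> \<exists>v\<in>free_module d (b 0). lam ev \<gamma> (b 0) v - F \<in> Z"
    and res_exact_0: "v \<in> free_module d (b 0) \<Longrightarrow>
      lam ev \<gamma> (b 0) v \<in> Z \<longleftrightarrow> (\<exists>w\<in>free_module d (b 1). v = D 0 *\<^sub>v w)"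
    and res_exact: "v \<in> free_module d (b (Suc i)) \<Longrightarrow> D i *\<^sub>v v = 0\<^sub>v (b i) \<longleftrightarrow>
        (\<exists>w\<in>free_module d (b (Suc (Suc i))). v = D (Suc i) *\<^sub>v w)"
  using assms unfolding res_def by blast+

lemma res_DD:
  assumes "res B b \<gamma> D"
  shows "D i * D (Suc i) = 0\<^sub>m (b i) (b (Suc (Suc i)))"
proof (rule mat_col_eqI)
  note c = res_carrier[OF assms]
  fix j assume "j < dim_col (0\<^sub>m (b i) (b (Suc (Suc i))) :: 'k mpoly mat)"
  then have j: "j < b (Suc (Suc i))" by simp
  have "D (Suc i) *\<^sub>v unit_vec (b (Suc (Suc i))) j \<in> free_module d (b (Suc i))"
    by (rule free_module_mult_mat[OF c res_pmat[OF assms] free_module_unit])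
  then have "D i *\<^sub>v (D (Suc i) *\<^sub>v unit_vec (b (Suc (Suc i))) j) = 0\<^sub>v (b i)"
    using res_exact[OF assms] free_module_unit by blast
  then show "col (D i * D (Suc i)) j = col (0\<^sub>m (b i) (b (Suc (Suc i)))) j"
    unfolding col_mult_unit_vec[OF c c j] using j by simp
qed (use res_carrier[OF assms, of i] res_carrier[OF assms, of "Suc i"] in auto)

text \<open>Comparison theorem: the identity of the resolved module is lifted degree by degree to a
  chain map.\<close>

lemma comparison:
  assumes R: "res B b \<gamma> D" and R': "res B b' \<gamma>' D'"
  obtains \<phi> where "\<And>i. \<phi> i \<in> carrier_mat (b' i) (b i)" "\<And>i. pmat d (\<phi> i)"
    "\<And>j. j < b 0 \<Longrightarrow> lam ev \<gamma>' (b' 0) (col (\<phi> 0) j) - \<gamma> j \<in> Z"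
    "\<And>i. D' i * \<phi> (Suc i) = \<phi> i * D i"
proof -
  note c = res_carrier[OF R] and p = res_pmat[OF R] and c' = res_carrier[OF R'] and p' = res_pmat[OF R']
  \<comment> \<open>The cycles of degree \<open>n\<close> in the second resolution; in degree 0 the
    augmentation modulo \<open>Z\<close> takes the place of the outgoing differential.\<close>
  define K where "K n v = (case n of 0 \<Rightarrow> lam ev \<gamma>' (b' 0) v \<in> Z | Suc k \<Rightarrow> D' k *\<^sub>v v = 0\<^sub>v (b' k))" for n v
  have K: "\<exists>w\<in>free_module d (b' (Suc n)). v = D' n *\<^sub>v w" if "v \<in> free_module d (b' n)" "K n v" for n v
    using that res_exact_0[OF R', of v] res_exact[OF R', of v] by (cases n) (auto simp: K_def)
  \<comment> \<open>The last clause, that \<open>x\<close> carries boundaries to cycles, is what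
    makes the next lift possible.\<close>
  define P where "P n x \<longleftrightarrow> x \<in> carrier_mat (b' n) (b n) \<and> pmat d x \<and>
      (n = 0 \<longrightarrow> (\<forall>j<b 0. lam ev \<gamma>' (b' 0) (col x j) - \<gamma> j \<in> Z)) \<and>
      (\<forall>w\<in>free_module d (b (Suc n)). K n (x *\<^sub>v (D n *\<^sub>v w)))" for n x
  have "\<exists>f. \<forall>n. P n (f n) \<and> D' n * f (Suc n) = f n * D n"
  proof (rule dependent_nat_choice)
    obtain x where x: "x \<in> carrier_mat (b' 0) (b 0)" "pmat d x"
      and lx: "\<And>j. j < b 0 \<Longrightarrow> lam ev \<gamma>' (b' 0) (col x j) - \<gamma> j \<in> Z"
      using matrix_from_columns[of "b 0" d "b' 0" "\<lambda>j v. lam ev \<gamma>' (b' 0) v - \<gamma> j \<in> Z"]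
        res_surj[OF R' res_gen[OF R]] by metis
    have "lam ev \<gamma>' (b' 0) (x *\<^sub>v (D 0 *\<^sub>v w)) \<in> Z" if w: "w \<in> free_module d (b (Suc 0))" for w
    proof -
      have Dw: "D 0 *\<^sub>v w \<in> free_module d (b 0)" by (rule free_module_mult_mat[OF c p w])
      then have "lam ev \<gamma> (b 0) (D 0 *\<^sub>v w) \<in> Z" using res_exact_0[OF R Dw] w by auto
      then show ?thesis using Z_diff_mem[OF lam_mult_mat_cong[OF x(1) Dw lx]] by blast
    qed
    then show "\<exists>x. P 0 x" using x lx unfolding P_def K_def by auto
  next
    fix x n assume P: "P n x"
    then have x: "x \<in> carrier_mat (b' n) (b n)" "pmat d x"
      and Kx: "\<And>w. w \<in> free_module d (b (Suc n)) \<Longrightarrow> K n (x *\<^sub>v (D n *\<^sub>v w))"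
      unfolding P_def by blast+
    have xD: "x * D n \<in> carrier_mat (b' n) (b (Suc n))" by (rule mult_carrier_mat[OF x(1) c])
    obtain y where y: "y \<in> carrier_mat (b' (Suc n)) (b (Suc n))" "pmat d y" "D' n * y = x * D n"
    proof (rule lift_matrix[OF xD c'])
      fix j assume j: "j < b (Suc n)"
      have "x *\<^sub>v (D n *\<^sub>v unit_vec (b (Suc n)) j) \<in> free_module d (b' n)"
        by (intro free_module_mult_mat[OF x] free_module_mult_mat[OF c p] free_module_unit)
      from K[OF this Kx[OF free_module_unit]]
      show "\<exists>w\<in>free_module d (b' (Suc n)). col (x * D n) j = D' n *\<^sub>v w"
        unfolding col_mult_unit_vec[OF x(1) c j] .
    qed
    have "D' n *\<^sub>v (y *\<^sub>v (D (Suc n) *\<^sub>v w)) = 0\<^sub>v (b' n)" if w: "w \<in> free_module d (b (Suc (Suc n)))" for w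
    proof -
      have Dw: "D (Suc n) *\<^sub>v w \<in> free_module d (b (Suc n))" by (rule free_module_mult_mat[OF c p w])
      note Dwc = free_module_carrier[OF Dw]
      have z: "D n *\<^sub>v (D (Suc n) *\<^sub>v w) = 0\<^sub>v (b n)" using res_exact[OF R Dw] w by blast
      have "D' n *\<^sub>v (y *\<^sub>v (D (Suc n) *\<^sub>v w)) = x *\<^sub>v (D n *\<^sub>v (D (Suc n) *\<^sub>v w))"
        unfolding assoc_mult_mat_vec[OF c' y(1) Dwc, symmetric] y(3) by (rule assoc_mult_mat_vec[OF x(1) c Dwc])
      also have "\<dots> = 0\<^sub>v (b' n)" unfolding z by (rule mult_mat_zero_vec[OF x(1)])
      finally show ?thesis .
    qed
    then have "P (Suc n) y" using y unfolding P_def K_def by simp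
    then show "\<exists>y. P (Suc n) y \<and> D' n * y = x * D n" using y(3) by blast
  qed
  then obtain f where "\<And>n. P n (f n)" "\<And>n. D' n * f (Suc n) = f n * D n" by blast
  then show ?thesis using that[of f] unfolding P_def by blast
qed

text \<open>A chain map \<theta> over the zero map of the module is null homotopic. The homotopy
  relation is recorded in the positive degrees, those of the Betti numbers with
  \<open>i \<ge> 1\<close>.\<close>

lemma null_homotopy:
  assumes R: "res B b \<gamma> D"
    and \<theta>: "\<And>i. \<theta> i \<in> carrier_mat (b i) (b i)" "\<And>i. pmat d (\<theta> i)"
    and \<theta>0: "\<And>j. j < b 0 \<Longrightarrow> lam ev \<gamma> (b 0) (col (\<theta> 0) j) \<in> Z"
    and comm: "\<And>i. D i * \<theta> (Suc i) = \<theta> i * D i"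
  obtains s where "\<And>i. s i \<in> carrier_mat (b (Suc i)) (b i)"
    "\<And>i. D (Suc i) * s (Suc i) = \<theta> (Suc i) - s i * D i"
proof -
  note c = res_carrier[OF R] and p = res_pmat[OF R]
  \<comment> \<open>The last clause says that the columns of
    \<open>\<theta> (Suc n) - x * D n\<close> are cycles, so that they can be lifted once
    more.\<close>
  define P where "P n x \<longleftrightarrow> x \<in> carrier_mat (b (Suc n)) (b n) \<and> pmat d x \<and>
      D n * (\<theta> (Suc n) - x * D n) = 0\<^sub>m (b n) (b (Suc n))" for n x
  have "\<exists>f. \<forall>n. P n (f n) \<and> D (Suc n) * f (Suc n) = \<theta> (Suc n) - f n * D n"
  proof (rule dependent_nat_choice)
    obtain x where x: "x \<in> carrier_mat (b (Suc 0)) (b 0)" "pmat d x" "D 0 * x = \<theta> 0"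
    proof (rule lift_matrix[OF \<theta>(1) c])
      fix j assume j: "j < b 0"
      show "\<exists>w\<in>free_module d (b (Suc 0)). col (\<theta> 0) j = D 0 *\<^sub>v w"
        using res_exact_0[OF R pmat_col[OF \<theta> j]] \<theta>0[OF j] by simp
    qed
    have xD: "x * D 0 \<in> carrier_mat (b (Suc 0)) (b (Suc 0))" by (rule mult_carrier_mat[OF x(1) c])
    have "D 0 * (\<theta> (Suc 0) - x * D 0) = \<theta> 0 * D 0 - \<theta> 0 * D 0"
      unfolding mult_minus_distrib_mat[OF c \<theta>(1) xD] comm assoc_mult_mat[OF c x(1) c, symmetric] x(3) ..
    also have "\<dots> = 0\<^sub>m (b 0) (b (Suc 0))" using mult_carrier_mat[OF \<theta>(1) c, of 0] by simp
    finally show "\<exists>x. P 0 x" using x unfolding P_def by blast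
  next
    fix x n assume "P n x"
    then have x: "x \<in> carrier_mat (b (Suc n)) (b n)" "pmat d x"
      and z: "D n * (\<theta> (Suc n) - x * D n) = 0\<^sub>m (b n) (b (Suc n))"
      unfolding P_def by blast+
    define M where "M = \<theta> (Suc n) - x * D n"
    have xD: "x * D n \<in> carrier_mat (b (Suc n)) (b (Suc n))" by (rule mult_carrier_mat[OF x(1) c])
    have M: "M \<in> carrier_mat (b (Suc n)) (b (Suc n))" unfolding M_def by (rule minus_carrier_mat[OF xD])
    have pM: "pmat d M"
      unfolding M_def
      by (rule pmat_diff[OF \<theta>(2) pmat_mult[OF x(2) p]])
         (use x(1) c[of n] \<theta>(1)[of "Suc n"] in auto)
    obtain y where y: "y \<in> carrier_mat (b (Suc (Suc n))) (b (Suc n))" "pmat d y" "D (Suc n) * y = M"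
    proof (rule lift_matrix[OF M c])
      fix j assume j: "j < b (Suc n)"
      have "D n *\<^sub>v col M j = col (D n * M) j" by (rule col_mult2[OF c M j, symmetric])
      also have "\<dots> = 0\<^sub>v (b n)" using z j unfolding M_def by simp
      finally show "\<exists>w\<in>free_module d (b (Suc (Suc n))). col M j = D (Suc n) *\<^sub>v w"
        using res_exact[OF R pmat_col[OF M pM j]] by simp
    qed
    have "D (Suc n) * (\<theta> (Suc (Suc n)) - y * D (Suc n)) = 0\<^sub>m (b (Suc n)) (b (Suc (Suc n)))"
      by (rule null_homotopy_step[OF c c x(1) y(1) \<theta>(1) \<theta>(1) res_DD[OF R] comm])
         (simp add: y(3) M_def)
    then show "\<exists>y. P (Suc n) y \<and> D (Suc n) * y = \<theta> (Suc n) - x * D n"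
      using y unfolding P_def M_def by blast
  qed
  then obtain f where "\<And>n. P n (f n)" "\<And>n. D (Suc n) * f (Suc n) = \<theta> (Suc n) - f n * D n" by blast
  then show ?thesis using that[of f] unfolding P_def by blast
qed

end

section \<open>Reduction modulo the variables and uniqueness of the Betti numbers\<close>

lemma tensor_k_carrier [simp]: "tensor_k A \<in> carrier_mat r c \<longleftrightarrow> A \<in> carrier_mat r c"
  by (simp add: tensor_k_def)

lemma tensor_k_mult:
  fixes A C :: "'k::field mpoly mat"
  assumes "A \<in> carrier_mat r s" "C \<in> carrier_mat s c"
  shows "tensor_k (A * C) = tensor_k A * tensor_k C"
proof -
  interpret comm_ring_hom "\<lambda>p :: 'k mpoly. lookup p 0" by (rule const_term_hom)
  show ?thesis unfolding tensor_k_def by (rule mat_hom_mult[OF assms])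
qed

lemma tensor_k_diff:
  "A \<in> carrier_mat r c \<Longrightarrow> C \<in> carrier_mat r c \<Longrightarrow> tensor_k (A - C) = tensor_k A - tensor_k C"
  for A C :: "'k::field mpoly mat"
  unfolding tensor_k_def by (intro eq_matI) (auto simp: lookup_minus)

lemma tensor_k_one: "tensor_k (1\<^sub>m r) = (1\<^sub>m r :: 'k::field mat)"
  unfolding tensor_k_def by (intro eq_matI) auto

lemma tensor_k_zero: "tensor_k (0\<^sub>m r c) = (0\<^sub>m r c :: 'k::field mat)"
  unfolding tensor_k_def by (intro eq_matI) auto

context eval_module
begin

text \<open>Chain maps in both directions compose to a map homotopic to the identity. Taking
  constant terms is a ring homomorphism, so the homotopy survives tensoring and \<phi> is injective
  on the homology there.\<close>

lemma tor_dim_le: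
  assumes R: "res B b \<gamma> D" and R': "res B b' \<gamma>' D'"
  shows "kernel_dim (tensor_k (D n)) + vec_space.rank (b' (Suc n)) (tensor_k (D' (Suc n)))
    \<le> kernel_dim (tensor_k (D' n)) + vec_space.rank (b (Suc n)) (tensor_k (D (Suc n)))"
proof -
  let ?T = "tensor_k :: 'k mpoly mat \<Rightarrow> _"
  note c = res_carrier[OF R] and p = res_pmat[OF R] and c' = res_carrier[OF R'] and p' = res_pmat[OF R']
  obtain \<phi> where \<phi>: "\<And>i. \<phi> i \<in> carrier_mat (b' i) (b i)" "\<And>i. pmat d (\<phi> i)"
    and \<phi>0: "\<And>j. j < b 0 \<Longrightarrow> lam ev \<gamma>' (b' 0) (col (\<phi> 0) j) - \<gamma> j \<in> Z"
    and \<phi>c: "\<And>i. D' i * \<phi> (Suc i) = \<phi> i * D i"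
    using comparison[OF R R'] by metis
  obtain \<psi> where \<psi>: "\<And>i. \<psi> i \<in> carrier_mat (b i) (b' i)" "\<And>i. pmat d (\<psi> i)"
    and \<psi>0: "\<And>j. j < b' 0 \<Longrightarrow> lam ev \<gamma> (b 0) (col (\<psi> 0) j) - \<gamma>' j \<in> Z"
    and \<psi>c: "\<And>i. D i * \<psi> (Suc i) = \<psi> i * D' i"
    using comparison[OF R' R] by metis
  define \<theta> where "\<theta> i = \<psi> i * \<phi> i - 1\<^sub>m (b i)" for i
  have \<psi>\<phi>: "\<psi> i * \<phi> i \<in> carrier_mat (b i) (b i)" for i by (rule mult_carrier_mat[OF \<psi>(1) \<phi>(1)])
  have \<theta>: "\<theta> i \<in> carrier_mat (b i) (b i)" for i unfolding \<theta>_def by (rule minus_carrier_mat) simp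
  have p\<theta>: "pmat d (\<theta> i)" for i
    unfolding \<theta>_def by (rule pmat_diff[OF pmat_mult[OF \<psi>(2) \<phi>(2)] pmat_one])
      (use \<psi>(1)[of i] \<phi>(1)[of i] in auto)
  have \<theta>0: "lam ev \<gamma> (b 0) (col (\<theta> 0) j) \<in> Z" if j: "j < b 0" for j
  proof -
    have \<phi>j: "col (\<phi> 0) j \<in> free_module d (b' 0)" by (rule pmat_col[OF \<phi> j])
    have cc: "\<psi> 0 *\<^sub>v col (\<phi> 0) j \<in> carrier_vec (b 0)"
      by (rule mult_mat_vec_carrier[OF \<psi>(1) free_module_carrier[OF \<phi>j]])
    have "col (\<theta> 0) j = \<psi> 0 *\<^sub>v col (\<phi> 0) j - unit_vec (b 0) j"
      unfolding \<theta>_def col_mult2[OF \<psi>(1) \<phi>(1) j, symmetric] by (rule col_diff_one[OF \<psi>\<phi> j])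
    then have "lam ev \<gamma> (b 0) (col (\<theta> 0) j) = lam ev \<gamma> (b 0) (\<psi> 0 *\<^sub>v col (\<phi> 0) j) - \<gamma> j"
      by (simp add: lam_diff[OF cc] lam_unit[OF j])
    also have "\<dots> \<in> Z"
      by (rule Z_diff_trans[OF lam_mult_mat_cong[OF \<psi>(1) \<phi>j \<psi>0] \<phi>0[OF j]])
    finally show ?thesis .
  qed
  have \<theta>c: "D i * \<theta> (Suc i) = \<theta> i * D i" for i
  proof -
    have "D i * \<theta> (Suc i) = D i * (\<psi> (Suc i) * \<phi> (Suc i)) - D i"
      unfolding \<theta>_def mult_minus_distrib_mat[OF c \<psi>\<phi> one_carrier_mat] right_mult_one_mat[OF c] ..
    also have "D i * (\<psi> (Suc i) * \<phi> (Suc i)) = \<psi> i * \<phi> i * D i"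
      unfolding assoc_mult_mat[OF c \<psi>(1) \<phi>(1), symmetric] \<psi>c assoc_mult_mat[OF \<psi>(1) c' \<phi>(1)] \<phi>c
      by (rule assoc_mult_mat[OF \<psi>(1) \<phi>(1) c, symmetric])
    also have "\<psi> i * \<phi> i * D i - D i = \<theta> i * D i"
      unfolding \<theta>_def minus_mult_distrib_mat[OF \<psi>\<phi> one_carrier_mat c] left_mult_one_mat[OF c] ..
    finally show ?thesis .
  qed
  obtain s where s: "\<And>i. s i \<in> carrier_mat (b (Suc i)) (b i)"
    and s_eq: "\<And>i. D (Suc i) * s (Suc i) = \<theta> (Suc i) - s i * D i"
    using null_homotopy[OF R \<theta> p\<theta> \<theta>0 \<theta>c] by metis
  note T = tensor_k_carrier[THEN iffD2]
  show ?thesis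
  proof (rule homology_dim_le[OF T[OF c] T[OF c] T[OF c'] T[OF c'] T[OF \<phi>(1)]])
    show "?T (D n) * ?T (D (Suc n)) = 0\<^sub>m (b n) (b (Suc (Suc n)))"
      unfolding tensor_k_mult[OF c c, symmetric] res_DD[OF R] by (rule tensor_k_zero)
    show "?T (D' n) * ?T (D' (Suc n)) = 0\<^sub>m (b' n) (b' (Suc (Suc n)))"
      unfolding tensor_k_mult[OF c' c', symmetric] res_DD[OF R'] by (rule tensor_k_zero)
    fix v assume "v \<in> mat_kernel (?T (D n))"
    from mat_kernelD[OF T[OF c] this] have v: "v \<in> carrier_vec (b (Suc n))" "?T (D n) *\<^sub>v v = 0\<^sub>v (b n)" .
    show "?T (\<phi> (Suc n)) *\<^sub>v v \<in> mat_kernel (?T (D' n))"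
    proof (rule mat_kernelI[OF T[OF c'] mult_mat_vec_carrier[OF T[OF \<phi>(1)] v(1)]])
      have "?T (D' n) *\<^sub>v (?T (\<phi> (Suc n)) *\<^sub>v v) = ?T (\<phi> n) *\<^sub>v (?T (D n) *\<^sub>v v)"
        unfolding assoc_mult_mat_vec[OF T[OF c'] T[OF \<phi>(1)] v(1), symmetric]
          assoc_mult_mat_vec[OF T[OF \<phi>(1)] T[OF c] v(1), symmetric]
          tensor_k_mult[OF c' \<phi>(1), symmetric] tensor_k_mult[OF \<phi>(1) c, symmetric] \<phi>c ..
      then show "?T (D' n) *\<^sub>v (?T (\<phi> (Suc n)) *\<^sub>v v) = 0\<^sub>v (b' n)"
        unfolding v(2) mult_mat_zero_vec[OF T[OF \<phi>(1)]] .
    qed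
    fix w assume w: "w \<in> carrier_vec (b' (Suc (Suc n)))"
      and eq: "?T (\<phi> (Suc n)) *\<^sub>v v = ?T (D' (Suc n)) *\<^sub>v w"
    let ?A = "?T (D n)" and ?B = "?T (D (Suc n))" and ?s = "?T (s (Suc n))" and ?t = "?T (s n)"
    note Tc = T[OF c] T[OF s] T[OF \<psi>(1)] T[OF \<phi>(1)]
    have sv: "?s *\<^sub>v v \<in> carrier_vec (b (Suc (Suc n)))" by (rule mult_mat_vec_carrier[OF T[OF s] v(1)])
    have \<psi>w: "?T (\<psi> (Suc (Suc n))) *\<^sub>v w \<in> carrier_vec (b (Suc (Suc n)))"
      by (rule mult_mat_vec_carrier[OF T[OF \<psi>(1)] w])
    \<comment> \<open>The homotopy relation after tensoring. Applied to the cycle \<open>v\<close>,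
      it shows that \<open>v\<close> is the boundary of
      \<open>?T (\<psi> (Suc (Suc n))) w - ?s v\<close>.\<close>
    have "?B * ?s = ?T (\<theta> (Suc n) - s n * D n)"
      unfolding tensor_k_mult[OF c s, symmetric] s_eq ..
    also have "\<dots> = (?T (\<psi> (Suc n)) * ?T (\<phi> (Suc n)) - 1\<^sub>m (b (Suc n))) - ?t * ?A"
      unfolding \<theta>_def tensor_k_diff[OF minus_carrier_mat[OF one_carrier_mat] mult_carrier_mat[OF s c]]
        tensor_k_diff[OF \<psi>\<phi> one_carrier_mat] tensor_k_one tensor_k_mult[OF \<psi>(1) \<phi>(1)]
        tensor_k_mult[OF s c] ..
    finally have Bs: "?B * ?s = (?T (\<psi> (Suc n)) * ?T (\<phi> (Suc n)) - 1\<^sub>m (b (Suc n))) - ?t * ?A" .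
    have "?B *\<^sub>v (?s *\<^sub>v v) = (?T (\<psi> (Suc n)) *\<^sub>v (?T (\<phi> (Suc n)) *\<^sub>v v) - v) - ?t *\<^sub>v (?A *\<^sub>v v)"
      unfolding assoc_mult_mat_vec[OF T[OF c] T[OF s] v(1), symmetric] Bs
        minus_mult_distrib_mat_vec[OF minus_carrier_mat[OF one_carrier_mat] mult_carrier_mat[OF T[OF s] T[OF c]] v(1)]
        minus_mult_distrib_mat_vec[OF mult_carrier_mat[OF T[OF \<psi>(1)] T[OF \<phi>(1)]] one_carrier_mat v(1)]
        assoc_mult_mat_vec[OF T[OF \<psi>(1)] T[OF \<phi>(1)] v(1)] assoc_mult_mat_vec[OF T[OF s] T[OF c] v(1)]
        one_mult_mat_vec[OF v(1)] ..
    also have "?t *\<^sub>v (?A *\<^sub>v v) = 0\<^sub>v (b (Suc n))" unfolding v(2) by (rule mult_mat_zero_vec[OF T[OF s]])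
    also have "?T (\<psi> (Suc n)) *\<^sub>v (?T (\<phi> (Suc n)) *\<^sub>v v) = ?B *\<^sub>v (?T (\<psi> (Suc (Suc n))) *\<^sub>v w)"
      unfolding eq assoc_mult_mat_vec[OF T[OF \<psi>(1)] T[OF c'] w, symmetric]
        assoc_mult_mat_vec[OF T[OF c] T[OF \<psi>(1)] w, symmetric]
        tensor_k_mult[OF \<psi>(1) c', symmetric] tensor_k_mult[OF c \<psi>(1), symmetric] \<psi>c ..
    finally have "?B *\<^sub>v (?s *\<^sub>v v) = ?B *\<^sub>v (?T (\<psi> (Suc (Suc n))) *\<^sub>v w) - v - 0\<^sub>v (b (Suc n))" .
    then have "v = ?B *\<^sub>v (?T (\<psi> (Suc (Suc n))) *\<^sub>v w) - ?B *\<^sub>v (?s *\<^sub>v v)"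
      using v(1) mult_mat_vec_carrier[OF T[OF c] \<psi>w] by (intro eq_vecI) auto
    also have "\<dots> = ?B *\<^sub>v (?T (\<psi> (Suc (Suc n))) *\<^sub>v w - ?s *\<^sub>v v)"
      by (rule mult_minus_distrib_mat_vec[OF T[OF c] \<psi>w sv, symmetric])
    finally show "\<exists>u\<in>carrier_vec (b (Suc (Suc n))). v = ?B *\<^sub>v u"
      using minus_carrier_vec[OF \<psi>w sv] by blast
  qed
qed

text \<open>The two inequalities between sums give equality of the sums, hence of the
  differences.\<close>

lemma tor_dim_unique:
  assumes R: "res B b \<gamma> D" and R': "res B b' \<gamma>' D'" and "i \<ge> 1"
  shows "tor_dim b D i = tor_dim b' D' i"
proof -
  obtain n where i: "i = Suc n" using \<open>i \<ge> 1\<close> by (cases i) auto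
  show ?thesis
    using tor_dim_le[OF R R', of n] tor_dim_le[OF R' R, of n] unfolding i tor_dim_def by simp
qed

end

lemma tensor_k_uminus: "tensor_k (- A) = - tensor_k A" for A :: "'k::field mpoly mat"
  unfolding tensor_k_def by (intro eq_matI) auto

lemma tensor_k_four_block:
  fixes A :: "'k::field mpoly mat"
  assumes "A \<in> carrier_mat r1 c1" "B \<in> carrier_mat r1 c2" "C \<in> carrier_mat r2 c1" "D \<in> carrier_mat r2 c2"
  shows "tensor_k (four_block_mat A B C D)
    = four_block_mat (tensor_k A) (tensor_k B) (tensor_k C) (tensor_k D)"
  unfolding tensor_k_def by (rule map_four_block_mat[OF assms])

lemma tensor_k_koszul_act:
  fixes Y Y' :: "'k::field mpoly mat"
  assumes Y: "Y \<in> carrier_mat m m" "Y' \<in> carrier_mat m m" "tensor_k Y = tensor_k Y'"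
  shows "tensor_k (koszul_act m Y j i) = tensor_k (koszul_act m Y' j i)"
proof (induction j arbitrary: i)
  case 0
  then show ?case using Y(3) by simp
next
  case (Suc j)
  show ?case
  proof (cases i)
    case 0
    then show ?thesis by simp
  next
    case (Suc i')
    show ?thesis
      unfolding Suc koszul_act.simps
        tensor_k_four_block[OF koszul_act_carrier[OF Y(1)] zero_carrier_mat zero_carrier_mat koszul_act_carrier[OF Y(1)]]
        tensor_k_four_block[OF koszul_act_carrier[OF Y(2)] zero_carrier_mat zero_carrier_mat koszul_act_carrier[OF Y(2)]]
        Suc.IH ..
  qed
qed

lemma tensor_k_koszul_diff:
  fixes X X' :: "nat \<Rightarrow> 'k::field mpoly mat"
  assumes X: "\<And>l. X l \<in> carrier_mat m m" "\<And>l. X' l \<in> carrier_mat m m"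
    "\<And>l. tensor_k (X l) = tensor_k (X' l)"
  shows "tensor_k (koszul_diff m mvar X j i) = tensor_k (koszul_diff m mvar X' j i)"
proof (induction j arbitrary: i)
  case 0
  show ?case by simp
next
  case (Suc j)
  have p: "tensor_k (koszul_map m mvar X j l i) = tensor_k (koszul_map m mvar X' j l i)" for l i
    unfolding koszul_map_def
      tensor_k_diff[OF smult_carrier_mat[OF one_carrier_mat] koszul_act_carrier[OF X(1)]]
      tensor_k_diff[OF smult_carrier_mat[OF one_carrier_mat] koszul_act_carrier[OF X(2)]]
      tensor_k_koszul_act[OF X] ..
  show ?case
  proof (cases i)
    case 0
    then show ?thesis by simp
  next
    case (Suc i')
    show ?thesis
      unfolding Suc koszul_diff.simps
        tensor_k_four_block[OF koszul_diff_carrier[of X, OF X(1)] koszul_map_carrier[of X, OF X(1)] zero_carrier_mat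
          uminus_carrier_mat[OF koszul_diff_carrier[of X, OF X(1)]]]
        tensor_k_four_block[OF koszul_diff_carrier[of X', OF X(2)] koszul_map_carrier[of X', OF X(2)] zero_carrier_mat
          uminus_carrier_mat[OF koszul_diff_carrier[of X', OF X(2)]]]
        tensor_k_uminus Suc.IH p ..
  qed
qed

text \<open>The shift by one drops the zero module at index 0, so that indices become homological
  degrees.\<close>

lemma (in koszul) koszul_res:
  assumes gen: "\<And>j. j < m \<Longrightarrow> \<gamma> j \<in> B"
    and surj: "\<And>F. F \<in> B \<Longrightarrow> \<exists>v\<in>free_module d m. lam ev \<gamma> m v - F \<in> Z"
  shows "res B (\<lambda>i. koszul_rank m d (Suc i)) \<gamma> (\<lambda>i. koszul_diff m mvar X d (Suc i))"
  unfolding res_def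
proof (intro conjI allI ballI iffI impI)
  fix v :: "'a mpoly vec"
  assume "v \<in> free_module d (koszul_rank m d (Suc 0))" "lam ev \<gamma> (koszul_rank m d (Suc 0)) v \<in> Z"
  then show "\<exists>w\<in>free_module d (koszul_rank m d (Suc 1)). v = koszul_diff m mvar X d (Suc 0) *\<^sub>v w"
    using koszul_exact[OF order.refl] by simp
next
  fix v :: "'a mpoly vec"
  assume "\<exists>w\<in>free_module d (koszul_rank m d (Suc 1)). v = koszul_diff m mvar X d (Suc 0) *\<^sub>v w"
  then show "lam ev \<gamma> (koszul_rank m d (Suc 0)) v \<in> Z"
    using lam_koszul_diff[OF order.refl] by (auto simp: numeral_2_eq_2)
next
  fix i and v :: "'a mpoly vec"
  assume "v \<in> free_module d (koszul_rank m d (Suc (Suc i)))" "koszul_diff m mvar X d (Suc i) *\<^sub>v v = 0\<^sub>v (koszul_rank m d (Suc i))"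
  then show "\<exists>w\<in>free_module d (koszul_rank m d (Suc (Suc (Suc i)))). v = koszul_diff m mvar X d (Suc (Suc i)) *\<^sub>v w"
    using koszul_exact[OF order.refl] by blast
next
  fix i and v :: "'a mpoly vec"
  assume "\<exists>w\<in>free_module d (koszul_rank m d (Suc (Suc (Suc i)))). v = koszul_diff m mvar X d (Suc (Suc i)) *\<^sub>v w"
  then show "koszul_diff m mvar X d (Suc i) *\<^sub>v v = 0\<^sub>v (koszul_rank m d (Suc i))"
    using koszul_diff_koszul_diff_vec[OF free_module_carrier] by blast
qed (use gen surj koszul_diff_carrier' koszul_diff_pmat' in auto)

subsection \<open>Semigroups generated by generalized arithmetic sequences\<close>

text \<open>The least number of summands from \<open>1..d\<close> with sum \<open>W\<close>.\<close>

definition cl :: "nat \<Rightarrow> nat \<Rightarrow> nat" where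
  "cl d W = (W + d - 1) div d"

context
  fixes d :: nat
  assumes d: "d > 0"
begin

lemma cl_0: "cl d 0 = 0" using d by (simp add: cl_def)

text \<open>Adjunction between rounded-up division and multiplication by \<open>d\<close>;
  monotonicity and subadditivity follow from it.\<close>

lemma cl_le_iff: "cl d W \<le> k \<longleftrightarrow> W \<le> k * d"
proof -
  have "cl d W \<le> k \<longleftrightarrow> (W + d - 1) div d < Suc k" by (auto simp: cl_def)
  also have "\<dots> \<longleftrightarrow> W + d - 1 < Suc k * d" by (rule div_less_iff_less_mult[OF d])
  also have "\<dots> \<longleftrightarrow> W \<le> k * d" using d by auto
  finally show ?thesis .
qed

lemma cl_mono: "V \<le> W \<Longrightarrow> cl d V \<le> cl d W"
  using cl_le_iff[of V "cl d W"] cl_le_iff[of W "cl d W"] by simp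

lemma cl_add: "cl d (V + W) \<le> cl d V + cl d W"
  using cl_le_iff[of "V + W" "cl d V + cl d W"] cl_le_iff[of V "cl d V"] cl_le_iff[of W "cl d W"]
  by (simp add: algebra_simps)

lemma cl_1: "1 \<le> i \<Longrightarrow> i \<le> d \<Longrightarrow> cl d i = 1"
  using cl_le_iff[of i 1] cl_le_iff[of i 0] by simp

lemma cl_eq_0: "cl d W = 0 \<longleftrightarrow> W = 0"
  using cl_le_iff[of W 0] by simp

lemma cl_add_d: "cl d (W + d) = cl d W + 1"
proof -
  have "W + d + d - 1 = W + d - 1 + d" using d by simp
  then show ?thesis unfolding cl_def using d by (metis Suc_eq_plus1 div_add_self2 less_not_refl)
qed

text \<open>The greedy choice is optimal: the largest admissible summand can be taken off
  first.\<close>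

lemma cl_step: "1 \<le> W \<Longrightarrow> cl d W = cl d (W - min d W) + 1"
proof (cases "W \<le> d")
  case True
  then show "1 \<le> W \<Longrightarrow> ?thesis" using cl_1[of W] by (simp add: cl_0)
next
  case False
  then show ?thesis using cl_add_d[of "W - d"] by simp
qed

end

locale gen_arith_semigroup =
  fixes h t d :: nat and n :: "nat \<Rightarrow> nat" and S :: "nat set"
  assumes n0: "n 0 > 0" and h: "h > 0" and t: "t > 0" and d: "d > 0"
    and n: "\<And>i. 1 \<le> i \<Longrightarrow> i \<le> d \<Longrightarrow> n i = h * n 0 + i * t"
    and S: "numerical_semigroup S"
    and gen: "S = generated_submonoid n {..d}"
begin

abbreviation N where "N \<equiv> n 0"

text \<open>The \<open>ap W\<close> with \<open>W < N\<close> are the elements of the Apery set with respect to \<open>N\<close>, and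
  \<open>cl d W\<close>, that is \<open>W / d\<close> rounded up, is the order of \<open>ap W\<close>.\<close>

definition ap :: "nat \<Rightarrow> nat" where "ap W = h * cl d W * N + W * t"

lemma S_0: "0 \<in> S" and S_add: "a \<in> S \<Longrightarrow> b \<in> S \<Longrightarrow> a + b \<in> S"
  using S by (auto simp: numerical_semigroup_def)

lemma S_mult: "a \<in> S \<Longrightarrow> c * a \<in> S"
  by (induction c) (auto intro: S_0 S_add)

lemma n_in_S: "i \<le> d \<Longrightarrow> n i \<in> S"
  unfolding gen generated_submonoid_def
  by (rule range_eqI[of _ _ "\<lambda>j. if j = i then 1 else 0"]) (simp add: if_distrib[of "\<lambda>x. x * _"] cong: if_cong)

lemma n_pos: "i \<le> d \<Longrightarrow> n i > 0"
  using n[of i] n0 h by (cases "i = 0") auto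

lemma ap_0: "ap 0 = 0" by (simp add: ap_def cl_0[OF d])

text \<open>Iterated, this is a factorization of \<open>ap W\<close> into \<open>cl d W\<close>
  generators.\<close>

lemma ap_step:
  assumes "1 \<le> W"
  shows "ap W = n (min d W) + ap (W - min d W)"
proof -
  have 1: "n (min d W) = h * N + min d W * t" using assms d by (intro n) auto
  have 2: "W * t = min d W * t + (W - min d W) * t"
    by (simp flip: add_mult_distrib)
  have 3: "h * (k + 1) * N + (x + y) = h * N + x + (h * k * N + y)" for k x y
    by (simp add: algebra_simps)
  show ?thesis
    unfolding ap_def cl_step[OF d assms] 1 by (subst 2) (rule 3)
qed

lemma ap_in_S: "ap W \<in> S"
proof (induction W rule: less_induct)
  case (less W)
  show ?case
  proof (cases "W = 0")
    case False
    then have "1 \<le> W" by simp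
    then show ?thesis
      unfolding ap_step[OF \<open>1 \<le> W\<close>] using d by (intro S_add n_in_S less) auto
  qed (simp add: ap_0 S_0)
qed

text \<open>Lowering the index by \<open>q * N\<close> frees \<open>q * t\<close> copies of
  \<open>N\<close>, and each of the \<open>a + b - cl d U\<close> summands saved frees
  \<open>h\<close> copies.\<close>

lemma ap_add:
  assumes "V + W = U + q * N" and "cl d U \<le> a + b" and "a = cl d V" "b = cl d W"
  shows "ap V + ap W = ap U + (h * (a + b - cl d U) + q * t) * N"
proof -
  define e where "e = h * (a + b - cl d U)"
  have "h * (a + b) = h * cl d U + e"
    using assms(2) unfolding e_def by (simp flip: add_mult_distrib2)
  then have "h * a * N + h * b * N = h * cl d U * N + e * N"
    by (metis add_mult_distrib add_mult_distrib2)
  moreover have "V * t + W * t = U * t + q * N * t"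
    using assms(1) by (simp flip: add_mult_distrib)
  ultimately show ?thesis unfolding ap_def e_def[symmetric] assms(3,4) by (simp add: algebra_simps)
qed

text \<open>The gcd divides all generators, hence all of \<open>S\<close>; but \<open>S\<close> is
  cofinite and contains two consecutive numbers.\<close>

lemma coprime_N_t: "coprime N t"
proof -
  let ?g = "gcd N t"
  have dvd: "?g dvd s" if "s \<in> S" for s
  proof -
    have dn: "?g dvd n i" if "i \<le> d" for i
    proof (cases "i = 0")
      case False
      then have "n i = h * N + i * t" using n[of i] that by simp
      then show ?thesis by simp
    qed simp
    obtain c where s: "s = (\<Sum>i\<in>{..d}. c i * n i)"
      using \<open>s \<in> S\<close> unfolding gen generated_submonoid_def by blast
    show ?thesis unfolding s by (intro dvd_sum dvd_mult dn) simp
  qed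
  have "finite (UNIV - S)" using S by (simp add: numerical_semigroup_def)
  then obtain M where M: "\<forall>s\<in>UNIV - S. s \<le> M" unfolding finite_nat_set_iff_bounded_le by blast
  have "Suc M \<in> S" "Suc (Suc M) \<in> S" using bspec[OF M, of "Suc M"] bspec[OF M, of "Suc (Suc M)"] by auto
  from dvd_diff_nat[OF dvd[OF this(2)] dvd[OF this(1)]] have "?g dvd 1" by simp
  then show ?thesis by (simp add: coprime_iff_gcd_eq_1)
qed

lemma ap_mod: "(ap V + a * N) mod N = (V * t) mod N"
  by (simp add: ap_def)

lemma mult_t_mod_inj:
  assumes "(V * t) mod N = (W * t) mod N" "V \<le> W" "W < N"
  shows "V = W"
proof -
  have "N dvd W * t - V * t" using assms(1,2) by (simp add: mod_eq_dvd_iff_nat[symmetric])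
  then have "N dvd (W - V) * t" by (simp add: diff_mult_distrib)
  then have "N dvd W - V" using coprime_N_t by (simp add: coprime_dvd_mult_left_iff)
  then show ?thesis using assms(2,3) by (auto dest: dvd_imp_le)
qed

text \<open>Modulo \<open>N\<close> both sides are multiples of \<open>t\<close>, a unit, so the
  indices agree.\<close>

lemma ap_unique:
  assumes "ap V + a * N = ap W + b * N" "V < N" "W < N"
  shows "V = W \<and> a = b"
proof -
  have "(V * t) mod N = (W * t) mod N" using assms(1) ap_mod by metis
  then have "V = W"
    using mult_t_mod_inj[of V W] mult_t_mod_inj[of W V] assms(2,3) by (cases "V \<le> W") auto
  then show ?thesis using assms(1) n0 by simp
qed

text \<open>The normal form with respect to the Apery set. The set \<open>A\<close> of all normal
  forms is closed under addition by \<open>ap_add\<close> and contains the generators.\<close>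

lemma S_rep: "s \<in> S \<longleftrightarrow> (\<exists>W<N. \<exists>c. s = ap W + c * N)"
proof
  assume "\<exists>W<N. \<exists>c. s = ap W + c * N"
  then show "s \<in> S" using ap_in_S S_add S_mult n_in_S[of 0] by blast
next
  define A where "A = {ap W + c * N | W c. W < N}"
  have A_0: "0 \<in> A" unfolding A_def using n0 ap_0 by force
  have A_add: "x + y \<in> A" if x: "x \<in> A" and y: "y \<in> A" for x y
  proof -
    obtain V a W b where xy: "x = ap V + a * N" "y = ap W + b * N"
      using x y by (auto simp: A_def)
    let ?U = "(V + W) mod N" and ?q = "(V + W) div N"
    have "cl d ?U \<le> cl d V + cl d W"
      using cl_mono[OF d, of ?U "V + W"] cl_add[OF d, of V W] by simp
    from ap_add[of V W ?U ?q, OF _ this refl refl]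
    have "x + y = ap ?U + (h * (cl d V + cl d W - cl d ?U) + ?q * t + a + b) * N"
      unfolding xy by (simp add: algebra_simps)
    moreover have "?U < N" using n0 by simp
    ultimately show ?thesis unfolding A_def by blast
  qed
  have A_n: "n i \<in> A" if "i \<le> d" for i
  proof (cases "i = 0")
    case True
    then have "n i = ap 0 + 1 * N" by (simp add: ap_0)
    then show ?thesis unfolding A_def using n0 by blast
  next
    case False
    then have i: "1 \<le> i" by simp
    have api: "n i = ap i" using n[OF i that] cl_1[OF d i that] by (simp add: ap_def)
    \<comment> \<open>\<open>i < N\<close> is not assumed, so the index has to be reduced here as
      well.\<close>
    let ?U = "i mod N" and ?q = "i div N"
    have "cl d ?U \<le> cl d i + cl d 0" using cl_mono[OF d, of ?U i] by simp
    from ap_add[of i 0 ?U ?q, OF _ this refl refl]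
    have "n i = ap ?U + (h * (cl d i + cl d 0 - cl d ?U) + ?q * t) * N"
      by (simp add: api ap_0)
    moreover have "?U < N" using n0 by simp
    ultimately show ?thesis unfolding A_def by blast
  qed
  have A_mult: "c * x \<in> A" if "x \<in> A" for c x
    using that by (induction c) (auto intro: A_0 A_add)
  have "(\<Sum>i\<in>I. c i * n i) \<in> A" if "finite I" "I \<subseteq> {..d}" for c I
    using that by (induction I) (auto intro: A_0 A_add A_mult A_n)
  then have "S \<subseteq> A" unfolding gen generated_submonoid_def by auto
  moreover assume "s \<in> S"
  ultimately show "\<exists>W<N. \<exists>c. s = ap W + c * N" unfolding A_def by blast
qed

text \<open>This is the largest length of a factorization of \<open>s\<close>; the description is unambiguous by
  \<open>ap_unique\<close>.\<close>

definition order :: "nat \<Rightarrow> nat" where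
  "order s = (THE j. \<exists>W<N. \<exists>c. s = ap W + c * N \<and> j = cl d W + c)"

lemma order_ap: "W < N \<Longrightarrow> order (ap W + c * N) = cl d W + c"
  unfolding order_def by (rule the_equality) (use ap_unique in blast)+

text \<open>Each summand saved in the addition of the indices lowers \<open>cl\<close> by one but
  returns as \<open>h \<ge> 1\<close> copies of \<open>N\<close>, each of order one. This is what
  makes \<open>rees\<close> closed under multiplication.\<close>

lemma order_add:
  assumes "x \<in> S" "y \<in> S"
  shows "order x + order y \<le> order (x + y)"
proof -
  obtain V a W b where xy: "x = ap V + a * N" "y = ap W + b * N" and VW: "V < N" "W < N"
    using assms by (auto simp: S_rep)
  let ?U = "(V + W) mod N" and ?q = "(V + W) div N"
  have U: "?U < N" using n0 by simp
  have le: "cl d ?U \<le> cl d V + cl d W"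
    using cl_mono[OF d, of ?U "V + W"] cl_add[OF d, of V W] by simp
  from ap_add[of V W ?U ?q, OF _ this refl refl]
  have "x + y = ap ?U + (h * (cl d V + cl d W - cl d ?U) + ?q * t + a + b) * N"
    unfolding xy by (simp add: algebra_simps)
  then have "order (x + y) = cl d ?U + (h * (cl d V + cl d W - cl d ?U) + ?q * t + a + b)"
    by (simp only: order_ap[OF U])
  moreover have "cl d V + cl d W - cl d ?U \<le> h * (cl d V + cl d W - cl d ?U)" using h by simp
  ultimately show ?thesis unfolding xy order_ap[OF VW(1)] order_ap[OF VW(2)] using le by linarith
qed

lemma order_pos: "s \<in> S \<Longrightarrow> s \<noteq> 0 \<Longrightarrow> 1 \<le> order s"
proof -
  assume "s \<in> S" "s \<noteq> 0"
  then obtain W c where s: "s = ap W + c * N" "W < N" by (auto simp: S_rep)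
  have "W \<noteq> 0 \<or> c \<noteq> 0" using s \<open>s \<noteq> 0\<close> ap_0 by (cases "W = 0") auto
  then show ?thesis unfolding s(1) order_ap[OF s(2)] using cl_eq_0[OF d, of W] by linarith
qed

text \<open>A copy of \<open>N\<close> is removed if there is one, and otherwise the greedy
  generator of \<open>ap W\<close>. The powers of the generator ideal are computed with
  this.\<close>

lemma order_split:
  assumes "s \<in> S" "Suc j \<le> order s"
  obtains i s' where "i \<le> d" "s' \<in> S" "s = n i + s'" "j \<le> order s'"
proof -
  obtain W c where s: "s = ap W + c * N" "W < N" using assms(1) by (auto simp: S_rep)
  have o: "Suc j \<le> cl d W + c" using assms(2) unfolding s(1) order_ap[OF s(2)] .
  show ?thesis
  proof (cases c)
    case (Suc c')
    show ?thesis
    proof (rule that[of 0 "ap W + c' * N"])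
      show "ap W + c' * N \<in> S" using S_rep s(2) by blast
      show "j \<le> order (ap W + c' * N)" unfolding order_ap[OF s(2)] using o Suc by simp
    qed (use s Suc in auto)
  next
    case 0
    then have "cl d W \<noteq> 0" using o by simp
    then have W: "1 \<le> W" using cl_eq_0[OF d, of W] by simp
    let ?V = "W - min d W"
    have V: "?V < N" using s(2) by simp
    show ?thesis
    proof (rule that[of "min d W" "ap ?V"])
      show "s = n (min d W) + ap ?V" using s(1) 0 ap_step[OF W] by simp
      have "order (ap ?V) = cl d ?V" using order_ap[OF V, of 0] by simp
      then show "j \<le> order (ap ?V)" using o 0 cl_step[OF d W] by simp
    qed (use ap_in_S in auto)
  qed
qed

text \<open>Index of the Apery element congruent to \<open>n i + ap W\<close> for
  \<open>1 \<le> i \<le> d\<close>.\<close>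

definition nxt :: "nat \<Rightarrow> nat \<Rightarrow> nat" where "nxt i W = (W + i) mod N"

text \<open>The number of copies of \<open>N\<close> by which \<open>n i + ap W\<close> exceeds that
  Apery element, hence the exponent of \<open>x_0\<close> in the matrix: \<open>h\<close> for each
  unit of order saved and \<open>t\<close> for each wrap of the index past \<open>N\<close>.\<close>

definition ex :: "nat \<Rightarrow> nat \<Rightarrow> nat" where
  "ex i W = h * (cl d W + 1 - cl d (nxt i W)) + (W + i) div N * t"

lemma nxt_less: "nxt i W < N" using n0 by (simp add: nxt_def)

lemma cl_nxt: "i \<le> d \<Longrightarrow> cl d (nxt i W) \<le> cl d W + 1"
  using cl_mono[OF d, of "nxt i W" "W + i"] cl_mono[OF d, of "W + i" "W + d"] cl_add_d[OF d, of W]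
  by (simp add: nxt_def)

lemma n_add_ap:
  assumes i: "1 \<le> i" "i \<le> d"
  shows "n i + ap W = ap (nxt i W) + ex i W * N"
proof -
  have "n i = ap i" using n[OF i] cl_1[OF d i] by (simp add: ap_def)
  moreover have "cl d (nxt i W) \<le> cl d W + 1" by (rule cl_nxt[OF i(2)])
  moreover have "W + i = nxt i W + (W + i) div N * N" by (simp add: nxt_def)
  ultimately show ?thesis
    using ap_add[of W i "nxt i W" "(W + i) div N", OF _ _ refl cl_1[OF d i, symmetric]]
    by (simp add: ex_def)
qed

lemma order_n_add_ap:
  assumes i: "1 \<le> i" "i \<le> d"
  shows "order (n i + ap W) = cl d (nxt i W) + ex i W"
  unfolding n_add_ap[OF i] by (rule order_ap[OF nxt_less])

text \<open>Both summands of \<open>ex\<close> vanish, and as \<open>h > 0\<close> the first one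
  leaves no room for a saved unit of order.\<close>

lemma ex_eq_0:
  assumes i: "1 \<le> i" "i \<le> d" and "ex i W = 0"
  shows "cl d (nxt i W) = cl d W + 1"
  using assms(3) h cl_nxt[OF i(2), of W] by (simp add: ex_def)

end

lemma lookup_mvar_power_0: "lookup (mvar i ^ k :: 'k::field mpoly) 0 = (if k = 0 then 1 else 0)"
proof -
  interpret comm_ring_hom "\<lambda>p :: 'k mpoly. lookup p 0" by (rule const_term_hom)
  have "single i 1 \<noteq> (0 :: nat \<Rightarrow>\<^sub>0 nat)"
    by (metis lookup_single_eq lookup_zero one_neq_zero)
  then have "lookup (mvar i :: 'k mpoly) 0 = 0" by (simp add: mvar_def lookup_single)
  then show ?thesis by (simp add: hom_power power_0_left)
qed

subsection \<open>The Rees-type ring and its two quotients\<close>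

text \<open>In \<open>'k poly poly\<close> the outer variable is the \<open>u\<close> and the inner
  variable the \<open>t\<close> of the Rees-type ring; \<open>cf F j s\<close> belongs to
  \<open>t^s u^j\<close>.\<close>

abbreviation cf :: "'k::field poly poly \<Rightarrow> nat \<Rightarrow> nat \<Rightarrow> 'k" where
  "cf F j s \<equiv> coeff (coeff F j) s"

lemma cf_monom: "cf (monom (monom a s') j') j s = (if j' = j \<and> s' = s then a else 0)"
  by simp

lemma cf_mult_nonzero:
  assumes "cf (F * G) j s \<noteq> 0"
  obtains i r where "i \<le> j" "r \<le> s" "cf F i r \<noteq> 0" "cf G (j - i) (s - r) \<noteq> 0"
proof -
  have "cf (F * G) j s = (\<Sum>i\<le>j. \<Sum>r\<le>s. cf F i r * cf G (j - i) (s - r))"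
    by (simp add: coeff_mult coeff_sum)
  then have "(\<Sum>i\<le>j. \<Sum>r\<le>s. cf F i r * cf G (j - i) (s - r)) \<noteq> 0" using assms by simp
  then obtain i where i: "i \<in> {..j}" "(\<Sum>r\<le>s. cf F i r * cf G (j - i) (s - r)) \<noteq> 0"
    by (rule sum.not_neutral_contains_not_neutral)
  from i(2) obtain r where "r \<in> {..s}" "cf F i r * cf G (j - i) (s - r) \<noteq> 0"
    by (rule sum.not_neutral_contains_not_neutral)
  then show ?thesis using that[of i r] i(1) by simp
qed

lemma coeff_poly_1: "coeff (poly F 1) s = (\<Sum>j\<le>degree F. cf F j s)" for F :: "'k::field poly poly"
  by (simp add: poly_altdef coeff_sum)

context gen_arith_semigroup
begin

definition rees :: "'k::field poly poly set" where
  "rees = {F. \<forall>j s. cf F j s \<noteq> 0 \<longrightarrow> s \<in> S \<and> j \<le> order s}"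

definition Z_G :: "'k::field poly poly set" where
  "Z_G = {F. \<forall>j s. cf F j s \<noteq> 0 \<longrightarrow> s \<in> S \<and> j < order s}"

definition Z_R :: "'k::field poly poly set" where
  "Z_R = {F. poly F 1 = 0}"

definition xi :: "nat \<Rightarrow> 'k::field poly poly" where "xi i = monom (monom 1 (n i)) 1"

definition eta :: "'k::field \<Rightarrow> 'k poly poly" where "eta c = [:[:c:]:]"

definition ev :: "'k::field mpoly \<Rightarrow> 'k poly poly" where "ev = meval eta xi"

text \<open>The Apery element with the largest power of \<open>u\<close> allowed in
  \<open>rees\<close>, so that it does not vanish in \<open>G(S)\<close>.\<close>

definition gam :: "nat \<Rightarrow> 'k::field poly poly" where "gam W = monom (monom 1 (ap W)) (cl d W)"

lemma eta_hom: "comm_ring_hom eta"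
  by unfold_locales (simp_all add: eta_def one_pCons)

lemma ev_hom: "comm_ring_hom ev"
  unfolding ev_def by (rule meval_hom[OF eta_hom])

interpretation ev: comm_ring_hom ev
  by (rule ev_hom)

lemma eta_0_1 [simp]: "eta 0 = 0" "eta 1 = 1"
  by (simp_all add: eta_def one_pCons)

lemma ev_var: "ev (mvar i) = xi i"
  unfolding ev_def by (rule meval_var) simp_all

lemma ev_const: "ev (mconst c) = eta c"
  unfolding ev_def by (rule meval_const) simp

lemma eta_mult_monom: "eta c * monom (monom a s) j = monom (monom (c * a) s) j"
  by (simp add: eta_def smult_monom)

lemma xi_0_power: "xi 0 ^ k = monom (monom 1 (k * N)) k"
  by (simp add: xi_def monom_power mult.commute)

lemma xi_0_power_gam: "xi 0 ^ k * gam W = monom (monom 1 (ap W + k * N)) (cl d W + k)"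
  unfolding xi_0_power gam_def mult_monom by (simp add: add.commute)

lemma xi_gam: "xi i * gam W = monom (monom 1 (n i + ap W)) (cl d W + 1)"
  unfolding xi_def gam_def mult_monom by simp

lemma rees_add:
  assumes "F \<in> rees" "G \<in> rees"
  shows "F + G \<in> rees"
  unfolding rees_def
proof (intro CollectI allI impI)
  fix j s assume "cf (F + G) j s \<noteq> 0"
  then have "cf F j s \<noteq> 0 \<or> cf G j s \<noteq> 0" by auto
  then show "s \<in> S \<and> j \<le> order s" using assms unfolding rees_def by blast
qed

lemma rees_0: "0 \<in> rees" by (simp add: rees_def)

lemma rees_monom: "s \<in> S \<Longrightarrow> j \<le> order s \<Longrightarrow> monom (monom a s) j \<in> rees"
  unfolding rees_def by (auto simp: cf_monom split: if_splits)

lemma rees_eta: "eta c \<in> rees"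
  using rees_monom[of 0 0 c] by (simp add: eta_def monom_0 S_0)

lemma rees_1: "1 \<in> rees"
  using rees_eta[of 1] by simp

lemma rees_uminus: "F \<in> rees \<Longrightarrow> - F \<in> rees"
  by (simp add: rees_def)

lemma rees_mult:
  assumes "F \<in> rees" "G \<in> rees"
  shows "F * G \<in> rees"
  unfolding rees_def
proof (intro CollectI allI impI)
  fix j s assume "cf (F * G) j s \<noteq> 0"
  then obtain i r where ir: "i \<le> j" "r \<le> s" "cf F i r \<noteq> 0" "cf G (j - i) (s - r) \<noteq> 0"
    by (rule cf_mult_nonzero)
  then have "r \<in> S" "i \<le> order r" "s - r \<in> S" "j - i \<le> order (s - r)"
    using assms unfolding rees_def by blast+
  then show "s \<in> S \<and> j \<le> order s"
    using S_add[of r "s - r"] order_add[of r "s - r"] ir(1,2) by simp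
qed

lemma rees_xi: "i \<le> d \<Longrightarrow> xi i \<in> rees"
  unfolding xi_def using n_in_S n_pos order_pos by (intro rees_monom) (auto simp: Suc_leI)

lemma rees_ev: "p \<in> polys d \<Longrightarrow> ev p \<in> rees"
  unfolding ev_def by (rule meval_closed[OF rees_0 rees_1 rees_add rees_mult rees_eta rees_xi])

lemma rees_gam: "W < N \<Longrightarrow> gam W \<in> rees"
  unfolding gam_def using order_ap[of W 0] by (intro rees_monom ap_in_S) simp

lemma Z_G_mult:
  assumes "F \<in> rees" "G \<in> Z_G"
  shows "F * G \<in> Z_G"
  unfolding Z_G_def
proof (intro CollectI allI impI)
  fix j s assume "cf (F * G) j s \<noteq> 0"
  then obtain i r where ir: "i \<le> j" "r \<le> s" "cf F i r \<noteq> 0" "cf G (j - i) (s - r) \<noteq> 0"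
    by (rule cf_mult_nonzero)
  then have "r \<in> S" "i \<le> order r" "s - r \<in> S" "j - i < order (s - r)"
    using assms unfolding rees_def Z_G_def by blast+
  then show "s \<in> S \<and> j < order s"
    using S_add[of r "s - r"] order_add[of r "s - r"] ir(1,2) by simp
qed

lemma Z_G_add:
  assumes "F \<in> Z_G" "G \<in> Z_G"
  shows "F + G \<in> Z_G"
  unfolding Z_G_def
proof (intro CollectI allI impI)
  fix j s assume "cf (F + G) j s \<noteq> 0"
  then have "cf F j s \<noteq> 0 \<or> cf G j s \<noteq> 0" by auto
  then show "s \<in> S \<and> j < order s" using assms unfolding Z_G_def by blast
qed

lemma eval_module_G: "eval_module ev Z_G d"
  by (intro eval_module.intro ev_hom Z_G_add Z_G_mult rees_ev) (simp add: Z_G_def)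

lemma eval_module_R: "eval_module ev Z_R d"
  by (intro eval_module.intro ev_hom) (simp_all add: Z_R_def)

text \<open>The condition \<open>\<epsilon> l w\<close> says whether the product of \<open>x\<^sub>l\<close> and the \<open>w\<close>-th basis vector is nonzero.\<close>

definition Xm :: "(nat \<Rightarrow> nat \<Rightarrow> bool) \<Rightarrow> nat \<Rightarrow> 'k::field mpoly mat" where
  "Xm \<epsilon> l = (if l \<in> {1..d}
     then mat N N (\<lambda>(r, w). if r = nxt l w \<and> \<epsilon> l w then mvar 0 ^ ex l w else 0)
     else 0\<^sub>m N N)"

lemma Xm_carrier: "Xm \<epsilon> l \<in> carrier_mat N N"
  by (simp add: Xm_def)

lemma Xm_out: "l \<notin> {1..d} \<Longrightarrow> Xm \<epsilon> l = 0\<^sub>m N N"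
  by (simp only: Xm_def if_False)

lemma Xm_pmat: "pmat 0 (Xm \<epsilon> l)"
  unfolding Xm_def pmat_def by (auto intro!: polys_power polys_var)

text \<open>Entries with \<open>ex l w > 0\<close> are divisible by \<open>x_0\<close> and have
  constant term zero whatever \<epsilon> and \<open>\<epsilon>'\<close> say about them.\<close>

lemma Xm_tensor_k:
  assumes "\<And>l w. l \<in> {1..d} \<Longrightarrow> ex l w = 0 \<Longrightarrow> \<epsilon> l w \<longleftrightarrow> \<epsilon>' l w"
  shows "tensor_k (Xm \<epsilon> l) = tensor_k (Xm \<epsilon>' l :: 'k::field mpoly mat)"
proof (cases "l \<in> {1..d}")
  case True
  show ?thesis
  proof (rule eq_matI)
    fix r w
    assume "r < dim_row (tensor_k (Xm \<epsilon>' l :: 'k mpoly mat))" "w < dim_col (tensor_k (Xm \<epsilon>' l :: 'k mpoly mat))"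
    then have "r < N" "w < N" 
      using carrier_matD[OF Xm_carrier[of \<epsilon>' l, where 'a = 'k]] by (simp_all add: tensor_k_def)
    then show "tensor_k (Xm \<epsilon> l) $$ (r, w) = tensor_k (Xm \<epsilon>' l :: 'k mpoly mat) $$ (r, w)"
      using assms[OF True, of w] True by (simp add: tensor_k_def Xm_def lookup_mvar_power_0)
  qed (simp_all add: tensor_k_def Xm_def)
next
  case False
  then show ?thesis by (simp only: Xm_def if_False)
qed

lemma lam_Xm:
  assumes l: "l \<in> {1..d}" and w: "w < N"
  shows "lam ev gam N (col (Xm \<epsilon> l :: 'k::field mpoly mat) w) =
    (if \<epsilon> l w then monom (monom 1 (n l + ap w)) (cl d (nxt l w) + ex l w) else 0)"
proof -
  have "lam ev gam N (col (Xm \<epsilon> l :: 'k mpoly mat) w)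
      = (\<Sum>r<N. if r = nxt l w then (if \<epsilon> l w then xi 0 ^ ex l w * gam r else 0) else 0)"
    unfolding lam_def
  proof (rule sum.cong[OF refl])
    fix r assume "r \<in> {..<N}"
    then have cr: "col (Xm \<epsilon> l :: 'k mpoly mat) w $ r = (if r = nxt l w \<and> \<epsilon> l w then mvar 0 ^ ex l w else 0)"
      using l w by (simp add: Xm_def)
    show "ev (col (Xm \<epsilon> l :: 'k mpoly mat) w $ r) * gam r
        = (if r = nxt l w then (if \<epsilon> l w then xi 0 ^ ex l w * gam r else 0) else 0)"
      unfolding cr by (simp add: ev.hom_power ev_var)
  qed
  also have "\<dots> = (if \<epsilon> l w then xi 0 ^ ex l w * gam (nxt l w) else 0)"
    using nxt_less by simp
  finally show ?thesis using l by (simp add: xi_0_power_gam n_add_ap)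
qed

section \<open>The Apery elements form a basis over \<open>k[x_0]\<close> of both quotients\<close>

lemma mon_xi_0: "p \<in> polys 0 \<Longrightarrow> m \<in> keys p \<Longrightarrow> mon xi m = xi 0 ^ lookup m 0"
  using mon_superset[of "{0}" m xi] polysD[of p 0 m] by auto

lemma ev_polys_0_gam:
  assumes "p \<in> polys 0"
  shows "ev p * gam W = (\<Sum>m\<in>keys p. monom (monom (lookup p m) (ap W + lookup m 0 * N)) (cl d W + lookup m 0))"
proof -
  have "ev p * gam W = (\<Sum>m\<in>keys p. eta (lookup p m) * (xi 0 ^ lookup m 0 * gam W))"
    unfolding ev_def meval_def sum_distrib_right
    by (intro sum.cong refl) (simp add: mon_xi_0[OF assms] mult.assoc)
  then show ?thesis by (simp add: xi_0_power_gam eta_mult_monom)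
qed

lemma cf_lam:
  assumes v: "v \<in> free_module 0 N"
  shows "cf (lam ev gam N v) j s = (\<Sum>w<N. \<Sum>m\<in>keys (v $ w).
    if cl d w + lookup m 0 = j \<and> ap w + lookup m 0 * N = s then lookup (v $ w) m else 0)"
proof -
  have "lam ev gam N v = (\<Sum>w<N. \<Sum>m\<in>keys (v $ w).
      monom (monom (lookup (v $ w) m) (ap w + lookup m 0 * N)) (cl d w + lookup m 0))"
    unfolding lam_def by (intro sum.cong refl ev_polys_0_gam free_moduleD[OF v]) simp
  then show ?thesis by (simp only: coeff_sum cf_monom)
qed

text \<open>Multiplication by \<open>x_0\<close> raises both the power of \<open>u\<close> and the
  order by one, so combinations over \<open>k[x_0]\<close> stay on the diagonal
  \<open>j = order s\<close>.\<close>

lemma lam_diagonal: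
  assumes v: "v \<in> free_module 0 N" and nz: "cf (lam ev gam N v) j s \<noteq> 0"
  shows "s \<in> S \<and> j = order s"
proof -
  obtain w where w': "w \<in> {..<N}" and "(\<Sum>m\<in>keys (v $ w).
      if cl d w + lookup m 0 = j \<and> ap w + lookup m 0 * N = s then lookup (v $ w) m else 0) \<noteq> 0"
    using nz unfolding cf_lam[OF v] by (rule sum.not_neutral_contains_not_neutral)
  from this(2) obtain m where "m \<in> keys (v $ w)" and mn: "(if cl d w + lookup m 0 = j \<and> ap w + lookup m 0 * N = s
      then lookup (v $ w) m else 0) \<noteq> 0"
    by (rule sum.not_neutral_contains_not_neutral)
  from w' have w: "w < N" by simp
  from mn have "j = cl d w + lookup m 0" "s = ap w + lookup m 0 * N" by (auto split: if_splits)
  moreover have "ap w + lookup m 0 * N \<in> S" using S_rep w by blast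
  ultimately show ?thesis using order_ap[OF w, of "lookup m 0"] by simp
qed

text \<open>By \<open>ap_unique\<close> a single term of the double sum contributes.\<close>

lemma cf_lam_ap:
  assumes v: "v \<in> free_module 0 N" and W: "W < N"
  shows "cf (lam ev gam N v) (cl d W + c) (ap W + c * N) = lookup (v $ W) (single 0 c)"
proof -
  have key: "(if cl d w + lookup m 0 = cl d W + c \<and> ap w + lookup m 0 * N = ap W + c * N
        then lookup (v $ w) m else 0)
      = (if w = W then (if m = single 0 c then lookup (v $ W) m else 0) else 0)"
    if w: "w < N" and m: "m \<in> keys (v $ w)" for w m
  proof -
    have "keys m \<subseteq> {0}" using polysD[OF free_moduleD[OF v w] m] by simp
    then have m0: "m = single 0 (lookup m 0)"
      by (intro poly_mapping_eqI) (auto simp: lookup_single when_def in_keys_iff)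
    then have "m = single 0 c \<longleftrightarrow> lookup m 0 = c" by (metis lookup_single_eq)
    then show ?thesis using ap_unique[OF _ w W, of "lookup m 0" c] by auto
  qed
  have "cf (lam ev gam N v) (cl d W + c) (ap W + c * N) = (\<Sum>w<N. \<Sum>m\<in>keys (v $ w).
      if w = W then (if m = single 0 c then lookup (v $ W) m else 0) else 0)"
    unfolding cf_lam[OF v] by (intro sum.cong refl key) auto
  also have "\<dots> = (\<Sum>w<N. if w = W then (\<Sum>m\<in>keys (v $ w). if m = single 0 c then lookup (v $ W) m else 0) else 0)"
    by (intro sum.cong refl) simp
  also have "\<dots> = lookup (v $ W) (single 0 c)"
    using W by (simp add: in_keys_iff)
  finally show ?thesis .
qed

lemma lam_eq_0_imp:
  assumes v: "v \<in> free_module 0 N" and z: "lam ev gam N v = 0"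
  shows "v = 0\<^sub>v N"
proof (rule eq_vecI)
  fix W assume "W < dim_vec (0\<^sub>v N :: 'a mpoly vec)"
  then have W: "W < N" by simp
  have "v $ W = 0"
  proof (rule poly_mapping_eqI)
    fix m
    show "lookup (v $ W) m = lookup 0 m"
    proof (cases "m \<in> keys (v $ W)")
      case True
      have "keys m \<subseteq> {0}" using polysD[OF free_moduleD[OF v W] True] by simp
      then have "m = single 0 (lookup m 0)"
        by (intro poly_mapping_eqI) (auto simp: lookup_single when_def in_keys_iff)
      then show ?thesis using cf_lam_ap[OF v W, of "lookup m 0"] z by simp
    qed (simp add: in_keys_iff)
  qed
  then show "v $ W = 0\<^sub>v N $ W" using W by simp
qed (use free_module_dim[OF v] in simp)

text \<open>Elements of \<open>Z_G\<close> are supported strictly below the diagonal, those of the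
  span of \<open>gam\<close> over \<open>k[x_0]\<close> on it.\<close>

lemma free_G:
  assumes v: "v \<in> free_module 0 N" and z: "lam ev gam N v \<in> Z_G"
  shows "v = 0\<^sub>v N"
proof (rule lam_eq_0_imp[OF v])
  have "cf (lam ev gam N v) j s = 0" for j s
    using lam_diagonal[OF v, of j s] z unfolding Z_G_def by blast
  then show "lam ev gam N v = 0" by (simp add: poly_eq_iff)
qed

text \<open>On the diagonal each \<open>t^s\<close> occurs with one power of \<open>u\<close> only,
  so nothing cancels at \<open>u = 1\<close>.\<close>

lemma free_R:
  assumes v: "v \<in> free_module 0 N" and z: "lam ev gam N v \<in> Z_R"
  shows "v = 0\<^sub>v N"
proof (rule lam_eq_0_imp[OF v])
  let ?F = "lam ev gam N v"
  have "cf ?F j s = 0" for j s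
  proof (rule ccontr)
    assume nz: "cf ?F j s \<noteq> 0"
    have js: "j = order s" using lam_diagonal[OF v nz] by simp
    have other: "cf ?F i s = 0" if "i \<noteq> j" for i
      using lam_diagonal[OF v, of i s] that js by blast
    have "j \<le> degree ?F" using nz by (metis coeff_0 le_degree)
    have "coeff (poly ?F 1) s = (\<Sum>i\<le>degree ?F. if i = j then cf ?F j s else 0)"
      unfolding coeff_poly_1 using other by (intro sum.cong) auto
    also have "\<dots> = cf ?F j s" using \<open>j \<le> degree ?F\<close> by simp
    finally show False using nz z by (simp add: Z_R_def)
  qed
  then show "?F = 0" by (simp add: poly_eq_iff)
qed

text \<open>The normal form of \<open>s\<close> writes \<open>t^s u^(order s)\<close> as
  \<open>x_0^c\<close> times some \<open>gam W\<close>.\<close>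

lemma diagonal_in_image:
  assumes "finite A" "A \<subseteq> S"
  shows "\<exists>v\<in>free_module d N. lam ev gam N v = (\<Sum>s\<in>A. monom (monom (a s) s) (order s))"
  using assms
proof (induction A)
  case empty
  have "lam ev gam N (0\<^sub>v N) = 0" by (rule eval_module.lam_zero[OF eval_module_R])
  then show ?case using free_module_zero by fastforce
next
  case (insert s A)
  obtain v where v: "v \<in> free_module d N" "lam ev gam N v = (\<Sum>s\<in>A. monom (monom (a s) s) (order s))"
    using insert by auto
  obtain W c where s: "s = ap W + c * N" and W: "W < N" using insert.prems by (auto simp: S_rep)
  define u where "u = (mconst (a s) * mvar 0 ^ c) \<cdot>\<^sub>v unit_vec N W"
  have u: "u \<in> free_module d N"
    unfolding u_def by (intro free_module_smult free_module_unit polys_mult polys_power) auto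
  have "lam ev gam N u = ev (mconst (a s) * mvar 0 ^ c) * gam W"
    unfolding u_def eval_module.lam_smult[OF eval_module_R unit_vec_carrier]
      eval_module.lam_unit[OF eval_module_R W] ..
  also have "\<dots> = monom (monom (a s) s) (order s)"
    unfolding ev.hom_mult ev.hom_power ev_const ev_var mult.assoc xi_0_power_gam eta_mult_monom
      s order_ap[OF W] by simp
  finally have "lam ev gam N (u + v) = (\<Sum>s\<in>insert s A. monom (monom (a s) s) (order s))"
    unfolding eval_module.lam_add[OF eval_module_R free_module_carrier[OF u] free_module_carrier[OF v(1)]] v(2)
    using insert.hyps by simp
  then show ?case using free_module_add[OF u v(1)] by blast
qed

text \<open>Modulo \<open>Z_G\<close> only the diagonal part of \<open>F\<close> counts.\<close>

lemma surj_G: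
  assumes F: "F \<in> rees"
  shows "\<exists>v\<in>free_module d N. lam ev gam N v - F \<in> Z_G"
proof -
  \<comment> \<open>A bound for all exponents of \<open>t\<close> in \<open>F\<close>, which makes
    the set \<open>A\<close> finite.\<close>
  define M where "M = (\<Sum>j\<le>degree F. degree (coeff F j))"
  have bound: "s \<le> M" if "cf F j s \<noteq> 0" for j s
  proof -
    have "coeff F j \<noteq> 0" using that by auto
    then have "j \<le> degree F" by (rule le_degree)
    then have "degree (coeff F j) \<le> M" unfolding M_def by (intro member_le_sum) auto
    then show ?thesis using le_degree[OF that] by simp
  qed
  define A where "A = {s \<in> S. s \<le> M}"
  have A: "finite A" "A \<subseteq> S" unfolding A_def by auto
  obtain v where v: "v \<in> free_module d N"
    "lam ev gam N v = (\<Sum>s\<in>A. monom (monom (cf F (order s) s) s) (order s))"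
    using diagonal_in_image[OF A, of "\<lambda>s. cf F (order s) s"] by blast
  have cfv: "cf (lam ev gam N v) j s = (if s \<in> A \<and> j = order s then cf F j s else 0)" for j s
  proof -
    have "cf (lam ev gam N v) j s = (\<Sum>r\<in>A. if r = s then (if order r = j then cf F j s else 0) else 0)"
      unfolding v(2) coeff_sum cf_monom by (intro sum.cong) auto
    also have "\<dots> = (if s \<in> A \<and> j = order s then cf F j s else 0)"
      using A(1) by auto
    finally show ?thesis .
  qed
  have "lam ev gam N v - F \<in> Z_G"
    unfolding Z_G_def
  proof (intro CollectI allI impI)
    fix j s assume "cf (lam ev gam N v - F) j s \<noteq> 0"
    then have nz: "cf F j s \<noteq> 0" "\<not> (s \<in> A \<and> j = order s)"
      unfolding coeff_diff cfv by (auto split: if_splits)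
    then have "s \<in> S" "j \<le> order s" using F unfolding rees_def by blast+
    moreover have "s \<in> A" using bound[OF nz(1)] \<open>s \<in> S\<close> by (simp add: A_def)
    ultimately show "s \<in> S \<and> j < order s" using nz(2) by auto
  qed
  then show ?thesis using v(1) by blast
qed

lemma rees_poly_1:
  assumes "F \<in> rees" "coeff (poly F 1) s \<noteq> 0"
  shows "s \<in> S"
proof -
  obtain j where "cf F j s \<noteq> 0"
    using assms(2) unfolding coeff_poly_1 by (rule sum.not_neutral_contains_not_neutral)
  then show ?thesis using assms(1) unfolding rees_def by blast
qed

text \<open>The value at \<open>u = 1\<close> does not change when every monomial is moved up to the
  diagonal.\<close>

lemma surj_R:
  assumes F: "F \<in> rees"
  shows "\<exists>v\<in>free_module d N. lam ev gam N v - F \<in> Z_R"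
proof -
  let ?f = "poly F 1"
  define A where "A = {s \<in> S. s \<le> degree ?f}"
  have A: "finite A" "A \<subseteq> S" unfolding A_def by auto
  obtain v where v: "v \<in> free_module d N"
    "lam ev gam N v = (\<Sum>s\<in>A. monom (monom (coeff ?f s) s) (order s))"
    using diagonal_in_image[OF A, of "coeff ?f"] by blast
  have "poly (lam ev gam N v) 1 = (\<Sum>s\<in>A. monom (coeff ?f s) s)"
    unfolding v(2) by (simp add: poly_sum poly_monom)
  also have "\<dots> = (\<Sum>s\<le>degree ?f. monom (coeff ?f s) s)"
    using rees_poly_1[OF F] by (intro sum.mono_neutral_left) (auto simp: A_def)
  also have "\<dots> = ?f" by (rule poly_as_sum_of_monoms)
  finally have "lam ev gam N v - F \<in> Z_R" by (simp add: Z_R_def)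
  then show ?thesis using v(1) by blast
qed

section \<open>The Koszul resolutions of the two quotients\<close>

definition eps_R :: "nat \<Rightarrow> nat \<Rightarrow> bool" where "eps_R l w = True"

text \<open>The left side is the order of \<open>n l + ap w\<close> and the right side the power of
  \<open>u\<close> in \<open>xi l * gam w\<close>: the product is again on the diagonal.\<close>

definition eps_G :: "nat \<Rightarrow> nat \<Rightarrow> bool" where
  "eps_G l w \<longleftrightarrow> cl d (nxt l w) + ex l w = cl d w + 1"

text \<open>At \<open>u = 1\<close> both sides of the relation become the same power of
  \<open>t\<close>, whatever their powers of \<open>u\<close>.\<close>

lemma koszul_R: "koszul ev Z_R d N (Xm eps_R) gam"
proof (intro koszul.intro koszul_axioms.intro eval_module_R Xm_carrier Xm_pmat Xm_out free_R)
  fix l w assume l: "l \<in> {1..d}" and w: "w < N"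
  show "lam ev gam N (col (Xm eps_R l) w) - ev (mvar l) * gam w \<in> Z_R"
    unfolding lam_Xm[OF l w] ev_var xi_gam by (simp add: Z_R_def eps_R_def poly_monom)
qed

text \<open>If \<open>xi l * gam w\<close> falls below the diagonal, it lies in \<open>Z_G\<close>
  itself, in accordance with the zero column of \<open>Xm\<close>.\<close>

lemma koszul_G: "koszul ev Z_G d N (Xm eps_G) gam"
proof (intro koszul.intro koszul_axioms.intro eval_module_G Xm_carrier Xm_pmat Xm_out free_G)
  fix l w assume l: "l \<in> {1..d}" and w: "w < N"
  show "lam ev gam N (col (Xm eps_G l) w) - ev (mvar l) * gam w \<in> Z_G"
  proof (cases "eps_G l w")
    case True
    then show ?thesis
      unfolding lam_Xm[OF l w] ev_var xi_gam by (simp add: Z_G_def eps_G_def)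
  next
    case False
    have "xi l * gam w \<in> rees" using l w by (intro rees_mult rees_xi rees_gam) auto
    have S: "n l + ap w \<in> S" using l by (intro S_add n_in_S ap_in_S) auto
    have "cf (xi l * gam w) (cl d w + 1) (n l + ap w) \<noteq> 0" unfolding xi_gam by simp
    then have "cl d w + 1 \<le> order (n l + ap w)"
      using \<open>xi l * gam w \<in> rees\<close> unfolding rees_def by blast
    moreover have "order (n l + ap w) = cl d (nxt l w) + ex l w"
      using l by (intro order_n_add_ap) auto
    ultimately have "cl d w + 1 < order (n l + ap w)" using False by (simp add: eps_G_def)
    then have "- (xi l * gam w) \<in> Z_G"
      unfolding xi_gam Z_G_def using S by (auto simp: cf_monom split: if_splits)
    then show ?thesis unfolding lam_Xm[OF l w] ev_var using False by simp
  qed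
qed

abbreviation koszul_ranks :: "nat \<Rightarrow> nat" where "koszul_ranks \<equiv> \<lambda>i. koszul_rank N d (Suc i)"

lemma res_R: "eval_module.res ev Z_R d rees koszul_ranks gam (\<lambda>i. koszul_diff N mvar (Xm eps_R) d (Suc i))"
  by (rule koszul.koszul_res[OF koszul_R rees_gam surj_R])

lemma res_G: "eval_module.res ev Z_G d rees koszul_ranks gam (\<lambda>i. koszul_diff N mvar (Xm eps_G) d (Suc i))"
  by (rule koszul.koszul_res[OF koszul_G rees_gam surj_G])

lemma tensor_k_R_G:
  "tensor_k (koszul_diff N mvar (Xm eps_R) d i) = tensor_k (koszul_diff N mvar (Xm eps_G) d i :: 'k::field mpoly mat)"
  by (intro tensor_k_koszul_diff Xm_carrier Xm_tensor_k) (use ex_eq_0 in \<open>auto simp: eps_R_def eps_G_def\<close>)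

end

subsection \<open>Transfer to the modules of the statement\<close>

lemma finsum_restrict_scalars:
  "finsum (restrict_scalars d A \<eta> a) f I = finsum A f I"
  by (simp add: restrict_scalars_def finsum_def finprod_def)

text \<open>Common interface to the semigroup ring and the associated graded ring, which are records
  with a carrier: each is the image of \<open>rees\<close> under a map with kernel
  \<open>Z \<inter> rees\<close>, required to be multiplicative and additive on
  \<open>rees\<close>.\<close>

locale rees_image = gen_arith_semigroup h t d n S
  for h t d n S +
  fixes A :: "'c ring" and \<Psi> :: "'k::field poly poly \<Rightarrow> 'c" and Z :: "'k poly poly set"
  assumes closed: "F \<in> rees \<Longrightarrow> \<Psi> F \<in> carrier A"
    and add: "F \<in> rees \<Longrightarrow> G \<in> rees \<Longrightarrow> \<Psi> (F + G) = \<Psi> F \<oplus>\<^bsub>A\<^esub> \<Psi> G"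
    and mult: "F \<in> rees \<Longrightarrow> G \<in> rees \<Longrightarrow> \<Psi> (F * G) = \<Psi> F \<otimes>\<^bsub>A\<^esub> \<Psi> G"
    and one: "\<Psi> 1 = \<one>\<^bsub>A\<^esub>"
    and surj: "x \<in> carrier A \<Longrightarrow> \<exists>F\<in>rees. \<Psi> F = x"
    and kernel: "F \<in> rees \<Longrightarrow> \<Psi> F = \<zero>\<^bsub>A\<^esub> \<longleftrightarrow> F \<in> Z"
    and evm: "eval_module ev Z d"
begin

interpretation eval_module ev Z d by (rule evm)

lemma zero: "\<Psi> 0 = \<zero>\<^bsub>A\<^esub>"
  using kernel[OF rees_0] Z_0 by simp

text \<open>The ring axioms are carried over from \<open>rees\<close> along the surjection, which
  for the associated graded ring avoids arguing with its coset operations.\<close>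

lemma cring_A: "cring A"
proof (rule cringI)
  show "abelian_group A"
  proof (rule abelian_groupI)
    fix x assume "x \<in> carrier A"
    then obtain F where F: "F \<in> rees" "\<Psi> F = x" using surj by blast
    have "\<Psi> (- F) \<oplus>\<^bsub>A\<^esub> x = \<zero>\<^bsub>A\<^esub>" using add[OF rees_uminus[OF F(1)] F(1)] F(2) zero by simp
    then show "\<exists>y\<in>carrier A. y \<oplus>\<^bsub>A\<^esub> x = \<zero>\<^bsub>A\<^esub>" using closed[OF rees_uminus[OF F(1)]] by blast
    show "\<zero>\<^bsub>A\<^esub> \<oplus>\<^bsub>A\<^esub> x = x" using add[OF rees_0 F(1)] F(2) zero by simp
  next
    show "\<zero>\<^bsub>A\<^esub> \<in> carrier A" using closed[OF rees_0] zero by simp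
  next
    fix x y assume "x \<in> carrier A" "y \<in> carrier A"
    then obtain F G where FG: "F \<in> rees" "\<Psi> F = x" "G \<in> rees" "\<Psi> G = y" using surj by blast
    show "x \<oplus>\<^bsub>A\<^esub> y \<in> carrier A" using add[OF FG(1,3)] closed[OF rees_add[OF FG(1,3)]] FG by simp
    show "x \<oplus>\<^bsub>A\<^esub> y = y \<oplus>\<^bsub>A\<^esub> x" using add[OF FG(1,3)] add[OF FG(3,1)] FG by (simp add: add.commute)
    fix z assume "z \<in> carrier A"
    then obtain H where H: "H \<in> rees" "\<Psi> H = z" using surj by blast
    show "x \<oplus>\<^bsub>A\<^esub> y \<oplus>\<^bsub>A\<^esub> z = x \<oplus>\<^bsub>A\<^esub> (y \<oplus>\<^bsub>A\<^esub> z)"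
      using add[OF rees_add[OF FG(1,3)] H(1)] add[OF FG(1) rees_add[OF FG(3) H(1)]]
        add[OF FG(1,3)] add[OF FG(3) H(1)] FG H by (simp add: add.assoc)
  qed
  show "comm_monoid A"
  proof (rule comm_monoidI)
    show "\<one>\<^bsub>A\<^esub> \<in> carrier A" using closed[OF rees_1] one by simp
  next
    fix x assume "x \<in> carrier A"
    then obtain F where F: "F \<in> rees" "\<Psi> F = x" using surj by blast
    show "\<one>\<^bsub>A\<^esub> \<otimes>\<^bsub>A\<^esub> x = x" using mult[OF rees_1 F(1)] F(2) one by simp
  next
    fix x y assume "x \<in> carrier A" "y \<in> carrier A"
    then obtain F G where FG: "F \<in> rees" "\<Psi> F = x" "G \<in> rees" "\<Psi> G = y" using surj by blast
    show "x \<otimes>\<^bsub>A\<^esub> y \<in> carrier A" using mult[OF FG(1,3)] closed[OF rees_mult[OF FG(1,3)]] FG by simp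
    show "x \<otimes>\<^bsub>A\<^esub> y = y \<otimes>\<^bsub>A\<^esub> x" using mult[OF FG(1,3)] mult[OF FG(3,1)] FG by (simp add: mult.commute)
    fix z assume "z \<in> carrier A"
    then obtain H where H: "H \<in> rees" "\<Psi> H = z" using surj by blast
    show "x \<otimes>\<^bsub>A\<^esub> y \<otimes>\<^bsub>A\<^esub> z = x \<otimes>\<^bsub>A\<^esub> (y \<otimes>\<^bsub>A\<^esub> z)"
      using mult[OF rees_mult[OF FG(1,3)] H(1)] mult[OF FG(1) rees_mult[OF FG(3) H(1)]]
        mult[OF FG(1,3)] mult[OF FG(3) H(1)] FG H by (simp add: mult.assoc)
  qed
  fix x y z assume "x \<in> carrier A" "y \<in> carrier A" "z \<in> carrier A"
  then obtain F G H where FGH: "F \<in> rees" "\<Psi> F = x" "G \<in> rees" "\<Psi> G = y" "H \<in> rees" "\<Psi> H = z"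
    using surj by metis
  show "(x \<oplus>\<^bsub>A\<^esub> y) \<otimes>\<^bsub>A\<^esub> z = x \<otimes>\<^bsub>A\<^esub> z \<oplus>\<^bsub>A\<^esub> y \<otimes>\<^bsub>A\<^esub> z"
    using mult[OF rees_add[OF FGH(1,3)] FGH(5)] add[OF FGH(1,3)] mult[OF FGH(1,5)] mult[OF FGH(3,5)]
      add[OF rees_mult[OF FGH(1,5)] rees_mult[OF FGH(3,5)]] FGH by (simp add: distrib_right)
qed

interpretation A: cring A by (rule cring_A)

lemma rees_sum: "(\<And>i. i \<in> I \<Longrightarrow> f i \<in> rees) \<Longrightarrow> sum f I \<in> rees"
  by (induction I rule: infinite_finite_induct) (auto intro: rees_0 rees_add)

lemma rees_prod: "(\<And>i. i \<in> I \<Longrightarrow> f i \<in> rees) \<Longrightarrow> prod f I \<in> rees"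
  by (induction I rule: infinite_finite_induct) (auto intro: rees_1 rees_mult)

lemma rees_power: "F \<in> rees \<Longrightarrow> F ^ k \<in> rees"
  by (induction k) (auto intro: rees_1 rees_mult)

lemma image_sum:
  assumes "finite I" "\<And>i. i \<in> I \<Longrightarrow> f i \<in> rees"
  shows "\<Psi> (sum f I) = finsum A (\<lambda>i. \<Psi> (f i)) I"
  using assms
proof (induction I)
  case empty
  then show ?case by (simp add: zero)
next
  case (insert i I)
  have "finsum A (\<lambda>i. \<Psi> (f i)) (insert i I) = \<Psi> (f i) \<oplus>\<^bsub>A\<^esub> finsum A (\<lambda>i. \<Psi> (f i)) I"
    using insert by (intro A.finsum_insert) (auto intro: closed)
  moreover have "\<Psi> (sum f (insert i I)) = \<Psi> (f i) \<oplus>\<^bsub>A\<^esub> \<Psi> (sum f I)"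
    unfolding sum.insert[OF insert.hyps]
    by (rule add) (use insert.prems in \<open>auto intro: rees_sum\<close>)
  ultimately show ?case using insert by simp
qed

lemma image_prod:
  assumes "finite I" "\<And>i. i \<in> I \<Longrightarrow> f i \<in> rees"
  shows "\<Psi> (prod f I) = finprod A (\<lambda>i. \<Psi> (f i)) I"
  using assms
proof (induction I)
  case empty
  then show ?case by (simp add: one)
next
  case (insert i I)
  have "finprod A (\<lambda>i. \<Psi> (f i)) (insert i I) = \<Psi> (f i) \<otimes>\<^bsub>A\<^esub> finprod A (\<lambda>i. \<Psi> (f i)) I"
    using insert by (intro A.finprod_insert) (auto intro: closed)
  moreover have "\<Psi> (prod f (insert i I)) = \<Psi> (f i) \<otimes>\<^bsub>A\<^esub> \<Psi> (prod f I)"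
    unfolding prod.insert[OF insert.hyps]
    by (rule mult) (use insert.prems in \<open>auto intro: rees_prod\<close>)
  ultimately show ?case using insert by simp
qed

lemma image_power: "F \<in> rees \<Longrightarrow> \<Psi> (F ^ k) = \<Psi> F [^]\<^bsub>A\<^esub> k"
proof (induction k)
  case (Suc k)
  have "\<Psi> (F ^ Suc k) = \<Psi> (F ^ k) \<otimes>\<^bsub>A\<^esub> \<Psi> F"
    unfolding power_Suc2 by (rule mult[OF rees_power[OF Suc.prems] Suc.prems])
  then show ?case using Suc by simp
qed (simp add: one)

text \<open>Identifies the action of \<open>P\<close> in the statement with multiplication by
  \<open>ev p\<close> in the Rees-type ring.\<close>

lemma eval_at_image:
  assumes p: "p \<in> polys d"
  shows "eval_at d A (\<lambda>c. \<Psi> (eta c)) (\<lambda>i. \<Psi> (xi i)) p = \<Psi> (ev p)"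
proof -
  have tm: "\<Psi> (eta (lookup p m)) \<otimes>\<^bsub>A\<^esub> finprod A (\<lambda>i. \<Psi> (xi i) [^]\<^bsub>A\<^esub> lookup m i) {..d}
      = \<Psi> (eta (lookup p m) * mon xi m)"
    and mem: "eta (lookup p m) * mon xi m \<in> rees" if m: "m \<in> keys p" for m
  proof -
    have mon: "mon xi m = (\<Prod>i\<in>{..d}. xi i ^ lookup m i)"
      by (rule mon_superset) (use polysD[OF p m] in auto)
    have r: "(\<Prod>i\<in>{..d}. xi i ^ lookup m i) \<in> rees"
      by (intro rees_prod rees_power rees_xi) auto
    have "\<Psi> (\<Prod>i\<in>{..d}. xi i ^ lookup m i) = finprod A (\<lambda>i. \<Psi> (xi i ^ lookup m i)) {..d}"
      by (intro image_prod rees_power rees_xi) auto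
    also have "\<dots> = finprod A (\<lambda>i. \<Psi> (xi i) [^]\<^bsub>A\<^esub> lookup m i) {..d}"
      by (rule A.finprod_cong') (auto intro!: A.nat_pow_closed closed rees_xi image_power)
    finally show "\<Psi> (eta (lookup p m)) \<otimes>\<^bsub>A\<^esub> finprod A (\<lambda>i. \<Psi> (xi i) [^]\<^bsub>A\<^esub> lookup m i) {..d}
      = \<Psi> (eta (lookup p m) * mon xi m)"
      unfolding mon mult[OF rees_eta r] by simp
    show "eta (lookup p m) * mon xi m \<in> rees" unfolding mon by (rule rees_mult[OF rees_eta r])
  qed
  have "\<Psi> (ev p) = finsum A (\<lambda>m. \<Psi> (eta (lookup p m) * mon xi m)) (keys p)"
    unfolding ev_def meval_def by (rule image_sum) (simp_all add: mem)
  also have "\<dots> = eval_at d A (\<lambda>c. \<Psi> (eta c)) (\<lambda>i. \<Psi> (xi i)) p"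
    unfolding eval_at_def by (rule A.finsum_cong') (auto simp: tm intro!: closed mem)
  finally show ?thesis ..
qed

definition M where
  "M = restrict_scalars d A (\<lambda>c. \<Psi> (eta c)) (\<lambda>i. \<Psi> (xi i))"

lemma M_simps: "carrier M = carrier A" "\<zero>\<^bsub>M\<^esub> = \<zero>\<^bsub>A\<^esub>"
  by (simp_all add: M_def restrict_scalars_def)

lemma lam_rees:
  assumes "v \<in> free_module d r" "\<And>j. j < r \<Longrightarrow> \<gamma> j \<in> rees"
  shows "lam ev \<gamma> r v \<in> rees"
  unfolding lam_def using assms by (intro rees_sum rees_mult rees_ev free_moduleD) auto

lemma augmentation_image:
  assumes v: "v \<in> free_module d r" and \<gamma>: "\<And>j. j < r \<Longrightarrow> \<gamma> j \<in> rees"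
    and g: "\<And>j. j < r \<Longrightarrow> g j = \<Psi> (\<gamma> j)"
  shows "augmentation M r g v = \<Psi> (lam ev \<gamma> r v)"
proof -
  have mem: "ev (v $ j) * \<gamma> j \<in> rees" if "j < r" for j
    using that by (intro rees_mult rees_ev free_moduleD[OF v] \<gamma>)
  have "augmentation M r g v = finsum A (\<lambda>j. (v $ j) \<odot>\<^bsub>M\<^esub> g j) {..<r}"
    unfolding augmentation_def M_def finsum_restrict_scalars ..
  also have "\<dots> = finsum A (\<lambda>j. \<Psi> (ev (v $ j) * \<gamma> j)) {..<r}"
  proof (rule A.finsum_cong')
    fix j assume "j \<in> {..<r}"
    then have j: "j < r" by simp
    have "(v $ j) \<odot>\<^bsub>M\<^esub> g j = eval_at d A (\<lambda>c. \<Psi> (eta c)) (\<lambda>i. \<Psi> (xi i)) (v $ j) \<otimes>\<^bsub>A\<^esub> g j"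
      by (simp add: M_def restrict_scalars_def)
    also have "\<dots> = \<Psi> (ev (v $ j)) \<otimes>\<^bsub>A\<^esub> \<Psi> (\<gamma> j)"
      unfolding eval_at_image[OF free_moduleD[OF v j]] g[OF j] ..
    also have "\<dots> = \<Psi> (ev (v $ j) * \<gamma> j)"
      by (rule mult[symmetric, OF rees_ev[OF free_moduleD[OF v j]] \<gamma>[OF j]])
    finally show "(v $ j) \<odot>\<^bsub>M\<^esub> g j = \<Psi> (ev (v $ j) * \<gamma> j)" .
  qed (auto intro: closed mem)
  also have "\<dots> = \<Psi> (lam ev \<gamma> r v)"
    unfolding lam_def by (rule image_sum[symmetric]) (simp_all add: mem)
  finally show ?thesis .
qed

lemma image_eq_iff:
  assumes "F \<in> rees" "G \<in> rees"
  shows "\<Psi> F = \<Psi> G \<longleftrightarrow> F - G \<in> Z"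
proof -
  have FG: "F - G \<in> rees" using rees_add[OF assms(1) rees_uminus[OF assms(2)]] by simp
  have "\<Psi> F = \<Psi> (F - G) \<oplus>\<^bsub>A\<^esub> \<Psi> G" using add[OF FG assms(2)] by simp
  moreover have "\<Psi> (F - G) = \<Psi> F \<oplus>\<^bsub>A\<^esub> \<Psi> (- G)" "\<Psi> G \<oplus>\<^bsub>A\<^esub> \<Psi> (- G) = \<zero>\<^bsub>A\<^esub>"
    using add[OF assms(1) rees_uminus[OF assms(2)]] add[OF assms(2) rees_uminus[OF assms(2)]] zero by simp_all
  ultimately have "\<Psi> F = \<Psi> G \<longleftrightarrow> \<Psi> (F - G) = \<zero>\<^bsub>A\<^esub>"
    using A.l_zero[OF closed[OF assms(2)]] by metis
  then show ?thesis using kernel[OF FG] by simp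
qed

text \<open>With preimages \<gamma> of the generators chosen, equality in \<open>A\<close> becomes
  congruence modulo \<open>Z\<close>, clause by clause.\<close>

lemma free_resolution_iff:
  assumes \<gamma>: "\<And>j. j < b 0 \<Longrightarrow> \<gamma> j \<in> rees" and g: "\<And>j. j < b 0 \<Longrightarrow> g j = \<Psi> (\<gamma> j)"
  shows "free_resolution d M b g D \<longleftrightarrow> res rees b \<gamma> D"
proof -
  have aug: "augmentation M (b 0) g v = \<Psi> (lam ev \<gamma> (b 0) v)"
    and lr: "lam ev \<gamma> (b 0) v \<in> rees" if "v \<in> free_module d (b 0)" for v
    by (rule augmentation_image[OF that \<gamma> g] lam_rees[OF that \<gamma>]; assumption)+
  have 1: "(\<forall>j<b 0. g j \<in> carrier M) \<longleftrightarrow> (\<forall>j<b 0. \<gamma> j \<in> rees)"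
    using \<gamma> g closed by (simp add: M_simps)
  have 3: "augmentation M (b 0) g ` free_module d (b 0) = carrier M \<longleftrightarrow>
      (\<forall>F\<in>rees. \<exists>v\<in>free_module d (b 0). lam ev \<gamma> (b 0) v - F \<in> Z)"
  proof
    assume im: "augmentation M (b 0) g ` free_module d (b 0) = carrier M"
    show "\<forall>F\<in>rees. \<exists>v\<in>free_module d (b 0). lam ev \<gamma> (b 0) v - F \<in> Z"
    proof
      fix F :: "'k poly poly" assume F: "F \<in> rees"
      then have "\<Psi> F \<in> augmentation M (b 0) g ` free_module d (b 0)"
        unfolding im M_simps by (rule closed)
      then obtain v where v: "v \<in> free_module d (b 0)" "\<Psi> F = augmentation M (b 0) g v" by blast
      then have "\<Psi> (lam ev \<gamma> (b 0) v) = \<Psi> F" using aug[OF v(1)] by simp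
      then show "\<exists>v\<in>free_module d (b 0). lam ev \<gamma> (b 0) v - F \<in> Z"
        using image_eq_iff[OF lr[OF v(1)] F] v(1) by blast
    qed
  next
    assume sur: "\<forall>F\<in>rees. \<exists>v\<in>free_module d (b 0). lam ev \<gamma> (b 0) v - F \<in> Z"
    show "augmentation M (b 0) g ` free_module d (b 0) = carrier M"
    proof (intro equalityI subsetI)
      fix x assume "x \<in> augmentation M (b 0) g ` free_module d (b 0)"
      then show "x \<in> carrier M" using aug closed[OF lr] by (auto simp: M_simps)
    next
      fix x assume "x \<in> carrier M"
      then obtain F where F: "F \<in> rees" "\<Psi> F = x" using surj unfolding M_simps by blast
      then obtain v where v: "v \<in> free_module d (b 0)" "lam ev \<gamma> (b 0) v - F \<in> Z" using sur by blast
      then have "augmentation M (b 0) g v = x"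
        using image_eq_iff[OF lr[OF v(1)] F(1)] F(2) aug[OF v(1)] by simp
      then show "x \<in> augmentation M (b 0) g ` free_module d (b 0)" using v(1) by blast
    qed
  qed
  have ker: "augmentation M (b 0) g v = \<zero>\<^bsub>M\<^esub> \<longleftrightarrow> lam ev \<gamma> (b 0) v \<in> Z" if "v \<in> free_module d (b 0)" for v
    using aug[OF that] kernel[OF lr[OF that]] by (simp add: M_simps)
  \<comment> \<open>Turns the equality of kernel and image into a pointwise equivalence; the image
    lies in the free module because the entries of \<open>E\<close> are in
    \<open>polys d\<close>.\<close>
  have set: "{v \<in> free_module d r. Q v} = (\<lambda>w. E *\<^sub>v w) ` free_module d s \<longleftrightarrow>
      (\<forall>v\<in>free_module d r. Q v \<longleftrightarrow> (\<exists>w\<in>free_module d s. v = E *\<^sub>v w))"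
    if "E \<in> carrier_mat r s" "pmat d E" for Q r s and E :: "'k mpoly mat"
    using free_module_mult_mat[OF that] by blast
  show ?thesis
    unfolding free_resolution_def res_def 1 3 elements_mat_subset_polys
    by (intro conj_cong refl) (simp_all add: set ker cong: conj_cong)
qed

text \<open>The definite description in \<open>betti\<close> requires that every resolution gives
  the same value, not only the given one.\<close>

lemma betti_eq_tor_dim:
  assumes R: "res rees b \<gamma> D" and i: "i \<ge> 1"
  shows "betti d M i = tor_dim b D i"
  unfolding betti_def
proof (rule the_equality)
  have "free_resolution d M b (\<lambda>j. \<Psi> (\<gamma> j)) D"
    using free_resolution_iff[of b \<gamma> "\<lambda>j. \<Psi> (\<gamma> j)" D] res_gen[OF R] R by blast
  then show "\<exists>b' g D'. free_resolution d M b' g D' \<and> tor_dim b D i = tor_dim b' D' i" by blast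
next
  fix \<beta> assume "\<exists>b' g D'. free_resolution d M b' g D' \<and> \<beta> = tor_dim b' D' i"
  then obtain b' g D' where F: "free_resolution d M b' g D'" and \<beta>: "\<beta> = tor_dim b' D' i" by blast
  \<comment> \<open>The generators of an arbitrary resolution are lifted to \<open>rees\<close>,
    where the comparison of resolutions applies.\<close>
  have "\<forall>j<b' 0. \<exists>F\<in>rees. g j = \<Psi> F"
    using F surj unfolding free_resolution_def M_simps by metis
  then obtain \<gamma>' where \<gamma>': "\<And>j. j < b' 0 \<Longrightarrow> \<gamma>' j \<in> rees" "\<And>j. j < b' 0 \<Longrightarrow> g j = \<Psi> (\<gamma>' j)"
    by metis
  have "res rees b' \<gamma>' D'" using free_resolution_iff[of b' \<gamma>' g D'] \<gamma>' F by blast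
  from tor_dim_unique[OF this R i] show "\<beta> = tor_dim b D i" unfolding \<beta> .
qed

end

section \<open>The semigroup ring and the powers of its generator ideal\<close>

context gen_arith_semigroup
begin

abbreviation SR :: "'k::field poly ring" where "SR \<equiv> semigroup_ring S"

lemma SR_simps [simp]:
  "f \<in> carrier SR \<longleftrightarrow> (\<forall>s. coeff f s \<noteq> 0 \<longrightarrow> s \<in> S)"
  "mult SR = (*)" "\<one>\<^bsub>SR\<^esub> = 1" "\<zero>\<^bsub>SR\<^esub> = 0" "add SR = (+)"
  by (simp_all add: semigroup_ring_def)

lemma rees_image_R: "rees_image h t d n S (SR :: 'k::field poly ring) (\<lambda>F. poly F 1) Z_R"
proof (intro rees_image.intro rees_image_axioms.intro gen_arith_semigroup_axioms eval_module_R)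
  fix F :: "'k poly poly" assume "F \<in> rees"
  then show "poly F 1 \<in> carrier SR" unfolding SR_simps by (blast intro: rees_poly_1)
next
  fix x :: "'k poly" assume "x \<in> carrier SR"
  then have "[:x:] \<in> rees" unfolding rees_def by (auto simp: coeff_pCons split: nat.splits)
  then show "\<exists>F\<in>rees. poly F 1 = x" by (rule bexI[rotated]) simp
qed (simp_all add: Z_R_def)

lemma cring_SR: "cring (SR :: 'k::field poly ring)"
  by (rule rees_image.cring_A[OF rees_image_R])

text \<open>The span of the \<open>t^s\<close> with order at least \<open>j\<close>; by
  \<open>ideal_power_eq\<close> it is the \<open>j\<close>-th power of the generator ideal.\<close>

definition Pw :: "nat \<Rightarrow> 'k::field poly set" where
  "Pw j = {f. \<forall>s. coeff f s \<noteq> 0 \<longrightarrow> s \<in> S \<and> j \<le> order s}"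

lemma rees_iff: "F \<in> rees \<longleftrightarrow> (\<forall>j. coeff F j \<in> Pw j)"
  by (auto simp: rees_def Pw_def)

lemma Z_G_iff: "F \<in> Z_G \<longleftrightarrow> (\<forall>j. coeff F j \<in> Pw (Suc j))"
  by (auto simp: Z_G_def Pw_def Suc_le_eq)

lemma Pw_0: "0 \<in> Pw j" by (simp add: Pw_def)

lemma Pw_add:
  assumes "f \<in> Pw j" "g \<in> Pw j"
  shows "f + g \<in> Pw j"
  unfolding Pw_def
proof (intro CollectI allI impI)
  fix s assume "coeff (f + g) s \<noteq> 0"
  then have "coeff f s \<noteq> 0 \<or> coeff g s \<noteq> 0" by auto
  then show "s \<in> S \<and> j \<le> order s" using assms unfolding Pw_def by blast
qed

lemma Pw_uminus: "f \<in> Pw j \<Longrightarrow> - f \<in> Pw j"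
  by (simp add: Pw_def)

lemma Pw_mult:
  assumes "f \<in> Pw i" "g \<in> Pw j"
  shows "f * g \<in> Pw (i + j)"
  unfolding Pw_def
proof (intro CollectI allI impI)
  fix s assume "coeff (f * g) s \<noteq> 0"
  then have "(\<Sum>r\<le>s. coeff f r * coeff g (s - r)) \<noteq> 0" by (simp add: coeff_mult)
  then obtain r where r: "r \<in> {..s}" "coeff f r * coeff g (s - r) \<noteq> 0"
    by (rule sum.not_neutral_contains_not_neutral)
  then have "r \<in> S" "i \<le> order r" "s - r \<in> S" "j \<le> order (s - r)"
    using assms unfolding Pw_def by auto
  then show "s \<in> S \<and> i + j \<le> order s"
    using S_add[of r "s - r"] order_add[of r "s - r"] r(1) by simp
qed

lemma Pw_mono: "f \<in> Pw j \<Longrightarrow> i \<le> j \<Longrightarrow> f \<in> Pw i"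
  unfolding Pw_def by fastforce

lemma Pw_carrier: "carrier SR = Pw 0"
  by (auto simp: Pw_def)

lemma Pw_monom: "s \<in> S \<Longrightarrow> j \<le> order s \<Longrightarrow> monom c s \<in> Pw j"
  by (auto simp: Pw_def split: if_splits)

lemma Pw_least:
  assumes f: "f \<in> Pw j" and "0 \<in> Q" and "\<And>f g. f \<in> Q \<Longrightarrow> g \<in> Q \<Longrightarrow> f + g \<in> Q"
    and monom: "\<And>c s. s \<in> S \<Longrightarrow> j \<le> order s \<Longrightarrow> monom c s \<in> Q"
  shows "f \<in> Q"
proof -
  have "monom (coeff f s) s \<in> Q" for s
  proof (cases "coeff f s = 0")
    case False
    then show ?thesis using f by (intro monom) (auto simp: Pw_def)
  qed (simp add: assms(2))
  then have "(\<Sum>s\<in>I. monom (coeff f s) s) \<in> Q" for I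
    by (induction I rule: infinite_finite_induct) (simp_all add: assms(2,3))
  then have "(\<Sum>s\<le>degree f. monom (coeff f s) s) \<in> Q" .
  then show ?thesis by (simp only: poly_as_sum_of_monoms)
qed

lemma Pw_ideal: "ideal (Pw j :: 'k::field poly set) SR"
proof -
  interpret R: cring "SR :: 'k poly ring" by (rule cring_SR)
  show ?thesis
  proof (rule idealI[OF R.ring_axioms])
    show "subgroup (Pw j :: 'k poly set) (add_monoid SR)"
    proof (rule R.add.subgroupI)
      show "Pw j \<subseteq> (carrier SR :: 'k poly set)" unfolding Pw_carrier by (blast intro: Pw_mono)
      show "Pw j \<noteq> ({} :: 'k poly set)" by (blast intro: Pw_0)
    next
      fix a :: "'k poly" assume a: "a \<in> Pw j"
      then have "- a \<oplus>\<^bsub>SR\<^esub> a = \<zero>\<^bsub>SR\<^esub>" "a \<in> carrier SR" "- a \<in> carrier SR"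
        using Pw_mono[OF a, of 0] Pw_mono[OF Pw_uminus[OF a], of 0] unfolding Pw_carrier by simp_all
      then have "\<ominus>\<^bsub>SR\<^esub> a = - a" by (rule R.minus_equality)
      then show "\<ominus>\<^bsub>SR\<^esub> a \<in> Pw j" using Pw_uminus[OF a] by simp
    next
      fix a b :: "'k poly" assume "a \<in> Pw j" "b \<in> Pw j"
      then show "a \<oplus>\<^bsub>SR\<^esub> b \<in> Pw j" using Pw_add by simp
    qed
  next
    fix a x :: "'k poly" assume "a \<in> Pw j" "x \<in> carrier SR"
    then show "x \<otimes>\<^bsub>SR\<^esub> a \<in> Pw j" "a \<otimes>\<^bsub>SR\<^esub> x \<in> Pw j"
      using Pw_mult[of x 0 a j] Pw_mult[of a j x 0] unfolding Pw_carrier by simp_all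
  qed
qed

text \<open>A monomial of positive order is divisible by some generator, by
  \<open>order_split\<close>.\<close>

lemma generator_ideal_eq: "generator_ideal d n S = (Pw 1 :: 'k::field poly set)"
proof
  interpret R: cring "SR :: 'k poly ring" by (rule cring_SR)
  let ?gens = "(\<lambda>i. monom 1 (n i)) ` {..d} :: 'k poly set"
  have gens: "?gens \<subseteq> Pw 1"
    using n_in_S n_pos order_pos by (auto intro!: Pw_monom simp: Suc_le_eq)
  then show "generator_ideal d n S \<subseteq> (Pw 1 :: 'k poly set)"
    unfolding generator_ideal_def by (rule R.genideal_minimal[OF Pw_ideal])
  have "?gens \<subseteq> carrier SR" using gens Pw_mono[of _ 1 0] unfolding Pw_carrier by blast
  then interpret I: ideal "genideal SR ?gens" "SR :: 'k poly ring" by (rule R.genideal_ideal)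
  have self: "?gens \<subseteq> genideal SR ?gens" by (rule R.genideal_self[OF \<open>?gens \<subseteq> carrier SR\<close>])
  show "(Pw 1 :: 'k poly set) \<subseteq> generator_ideal d n S"
    unfolding generator_ideal_def
  proof
    fix f :: "'k poly" assume "f \<in> Pw 1"
    then show "f \<in> genideal SR ?gens"
    proof (rule Pw_least)
      show "(0 :: 'k poly) \<in> genideal SR ?gens" using I.zero_closed by simp
      show "f + g \<in> genideal SR ?gens" if "f \<in> genideal SR ?gens" "g \<in> genideal SR ?gens" for f g :: "'k poly"
        using I.a_closed[OF that] by simp
      fix c :: 'k and s assume s: "s \<in> S" "1 \<le> order s"
      then obtain i s' where i: "i \<le> d" "s' \<in> S" "s = n i + s'" using order_split[of s 0] by auto
      have "monom c s' \<in> carrier SR" using Pw_monom[OF i(2), of 0] unfolding Pw_carrier by simp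
      then have "monom c s' \<otimes>\<^bsub>SR\<^esub> monom 1 (n i) \<in> genideal SR ?gens"
        using self i(1) by (intro I.I_l_closed) auto
      then show "monom c s \<in> genideal SR ?gens" by (simp add: mult_monom i(3) add.commute)
    qed
  qed
qed

text \<open>One inclusion is superadditivity of the order; for the other, \<open>order_split\<close>
  takes off one generator while the rest keeps order at least \<open>j\<close>.\<close>

lemma ideal_power_eq: "ideal_power SR (generator_ideal d n S) j = (Pw j :: 'k::field poly set)"
proof (induction j)
  case 0
  then show ?case by (simp add: Pw_carrier del: SR_simps)
next
  case (Suc j)
  have "ideal_prod SR (Pw 1) (Pw j) = (Pw (Suc j) :: 'k poly set)"
  proof (intro equalityI subsetI)
    fix f :: "'k poly" assume "f \<in> ideal_prod SR (Pw 1) (Pw j)"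
    then show "f \<in> Pw (Suc j)"
    proof (induction rule: ideal_prod.induct)
      case (prod i f)
      then show ?case using Pw_mult[of i 1 f j] by simp
    next
      case (sum f g)
      then show ?case using Pw_add by simp
    qed
  next
    fix f :: "'k poly" assume "f \<in> Pw (Suc j)"
    then show "f \<in> ideal_prod SR (Pw 1) (Pw j)"
    proof (rule Pw_least)
      show "(0 :: 'k poly) \<in> ideal_prod SR (Pw 1) (Pw j)"
        using ideal_prod.prod[of "0 :: 'k poly" "Pw 1" 0 "Pw j" SR] by (simp add: Pw_0)
      show "f + g \<in> ideal_prod SR (Pw 1) (Pw j)"
        if "f \<in> ideal_prod SR (Pw 1) (Pw j)" "g \<in> ideal_prod SR (Pw 1) (Pw j)" for f g :: "'k poly"
        using ideal_prod.sum[OF that] by simp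
      fix c :: 'k and s assume s: "s \<in> S" "Suc j \<le> order s"
      then obtain i s' where i: "i \<le> d" "s' \<in> S" "s = n i + s'" "j \<le> order s'" by (rule order_split)
      have "monom 1 (n i) \<in> (Pw 1 :: 'k poly set)"
        using n_in_S[OF i(1)] n_pos[OF i(1)] order_pos by (intro Pw_monom) auto
      from ideal_prod.prod[OF this Pw_monom[OF i(2,4)], of SR c]
      show "monom c s \<in> ideal_prod SR (Pw 1) (Pw j)" by (simp add: mult_monom i(3))
    qed
  qed
  then show ?case unfolding ideal_power.simps(2) Suc.IH unfolding generator_ideal_eq .
qed

section \<open>Cosets and the associated graded ring\<close>

abbreviation coset :: "nat \<Rightarrow> 'k::field poly \<Rightarrow> 'k poly set" where
  "coset j a \<equiv> Pw j +>\<^bsub>SR\<^esub> a"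

lemma coset_def': "coset j a = (\<lambda>x. x + a) ` Pw j"
  by (auto simp: a_r_coset_def r_coset_def)

lemma coset_self: "a \<in> coset j a"
  unfolding coset_def' by (rule image_eqI[of _ _ 0]) (simp_all add: Pw_0)

lemma coset_eq_iff:
  fixes a b :: "'k::field poly"
  shows "coset j a = coset j b \<longleftrightarrow> a - b \<in> Pw j"
proof
  assume "coset j a = coset j b"
  moreover have "a \<in> coset j a" by (rule coset_self)
  ultimately show "a - b \<in> Pw j" unfolding coset_def' by auto
next
  have sub: "coset j a \<subseteq> coset j b" if "a - b \<in> Pw j" for a b :: "'k poly"
  proof
    fix x assume "x \<in> coset j a"
    then obtain y where y: "y \<in> Pw j" "x = y + a" unfolding coset_def' by blast
    then have "x = (y + (a - b)) + b" "y + (a - b) \<in> Pw j" using Pw_add[OF y(1) that] by simp_all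
    then show "x \<in> coset j b" unfolding coset_def' by blast
  qed
  assume ab: "a - b \<in> Pw j"
  then have "b - a \<in> Pw j" using Pw_uminus[OF ab] by simp
  then show "coset j a = coset j b" using sub ab by blast
qed

lemma coset_0: "coset j 0 = Pw j"
  by (simp add: coset_def')

lemma coset_add:
  fixes a b :: "'k::field poly"
  shows "coset j a <+>\<^bsub>SR\<^esub> coset j b = coset j (a + b)"
proof -
  have *: "A <+>\<^bsub>SR\<^esub> B = {x + y | x y. x \<in> A \<and> y \<in> B}" for A B :: "'k poly set"
    by (auto simp: set_add_def set_mult_def)
  show ?thesis
  proof (intro equalityI subsetI)
    fix x assume "x \<in> coset j a <+>\<^bsub>SR\<^esub> coset j b"
    then obtain y z where "y \<in> Pw j" "z \<in> Pw j" "x = (y + a) + (z + b)"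
      unfolding * coset_def' by auto
    then have "x = (y + z) + (a + b)" "y + z \<in> Pw j" using Pw_add by simp_all
    then show "x \<in> coset j (a + b)" unfolding coset_def' by blast
  next
    fix x assume "x \<in> coset j (a + b)"
    then obtain y where "y \<in> Pw j" "x = (y + a) + b" unfolding coset_def' by (auto simp: add.assoc)
    then have "x = (y + a) + b" "y + a \<in> coset j a" unfolding coset_def' by auto
    then show "x \<in> coset j a <+>\<^bsub>SR\<^esub> coset j b" unfolding * using coset_self[of b j] by blast
  qed
qed

text \<open>Changing representatives by \<open>p\<close> and \<open>q\<close> changes the product by
  \<open>p * q + p * b + a * q\<close>, and each term has order at least
  \<open>Suc j\<close>.\<close>

lemma coset_mult:
  assumes ij: "i \<le> j" and a: "a \<in> Pw i" and b: "b \<in> Pw (j - i)"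
  shows "rcoset_mult SR (Pw (Suc j)) (coset (Suc i) a) (coset (Suc (j - i)) b) = coset (Suc j) (a * b)"
proof -
  have "coset (Suc j) (x * y) = coset (Suc j) (a * b)"
    if "x \<in> coset (Suc i) a" "y \<in> coset (Suc (j - i)) b" for x y
  proof -
    obtain p q where p: "p \<in> Pw (Suc i)" "x = p + a" and q: "q \<in> Pw (Suc (j - i))" "y = q + b"
      using \<open>x \<in> _\<close> \<open>y \<in> _\<close> unfolding coset_def' by blast
    have "p * q \<in> Pw (Suc j)" using Pw_mult[OF p(1) q(1)] ij by (elim Pw_mono) simp
    moreover have "p * b \<in> Pw (Suc j)" using Pw_mult[OF p(1) b] ij by simp
    moreover have "a * q \<in> Pw (Suc j)" using Pw_mult[OF a q(1)] ij by simp
    ultimately have "p * q + p * b + a * q \<in> Pw (Suc j)" by (intro Pw_add)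
    then show ?thesis unfolding coset_eq_iff p(2) q(2) by (simp add: algebra_simps)
  qed
  then show ?thesis unfolding rcoset_mult_def SR_simps using coset_self[of a "Suc i"] coset_self[of b "Suc (j - i)"] by blast
qed

lemma coset_sum:
  fixes f :: "'b \<Rightarrow> 'k::field poly"
  assumes "finite I" "\<And>i. i \<in> I \<Longrightarrow> f i \<in> carrier SR"
  shows "finsum (SR Quot Pw j) (\<lambda>i. coset j (f i)) I = coset j (sum f I)"
proof -
  interpret ideal "Pw j" "SR :: 'k poly ring" by (rule Pw_ideal)
  interpret Q: ring "SR Quot Pw j :: 'k poly set ring" by (rule quotient_is_ring)
  have mem: "coset j x \<in> carrier (SR Quot Pw j)" if "x \<in> carrier SR" for x :: "'k poly"
    unfolding FactRing_def using that by (simp add: a_rcosetsI[OF a_subset that] del: SR_simps)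
  show ?thesis
    using assms
  proof (induction I)
    case empty
    have "\<zero>\<^bsub>SR Quot Pw j\<^esub> = (Pw j :: 'k poly set)" by (simp add: FactRing_def)
    then show ?case by (simp add: coset_0)
  next
    case (insert i I)
    have "finsum (SR Quot Pw j) (\<lambda>i. coset j (f i)) (insert i I)
        = coset j (f i) \<oplus>\<^bsub>SR Quot Pw j\<^esub> finsum (SR Quot Pw j) (\<lambda>i. coset j (f i)) I"
      using insert.hyps insert.prems by (intro Q.finsum_insert mem) (auto simp del: SR_simps intro!: mem)
    also have "\<dots> = coset j (f i) <+>\<^bsub>SR\<^esub> coset j (sum f I)"
      using insert by (simp add: FactRing_def del: SR_simps)
    finally show ?case using insert.hyps by (simp add: coset_add)
  qed
qed

abbreviation GR :: "(nat \<Rightarrow> 'k::field poly set) ring" where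
  "GR \<equiv> assoc_graded SR (generator_ideal d n S)"

text \<open>The map from \<open>rees\<close> onto \<open>G(S)\<close>: the coefficient of
  \<open>u^j\<close> is read as a class in \<open>I^j / I^(j+1)\<close>.\<close>

definition init :: "'k::field poly poly \<Rightarrow> nat \<Rightarrow> 'k poly set" where
  "init F = (\<lambda>j. coset (Suc j) (coeff F j))"

lemma init_eq_iff: "init F = init G \<longleftrightarrow> F - G \<in> Z_G"
  unfolding init_def Z_G_iff by (simp add: fun_eq_iff coset_eq_iff)

lemma GR_zero: "\<zero>\<^bsub>GR\<^esub> = init 0"
  unfolding assoc_graded_def ideal_power_eq init_def by (simp add: coset_0)

lemma GR_carrier:
  "x \<in> carrier GR \<longleftrightarrow>
    (\<forall>j. \<exists>a\<in>Pw j. x j = coset (Suc j) a) \<and> finite {j. x j \<noteq> Pw (Suc j)}"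
  unfolding assoc_graded_def ideal_power_eq by simp

lemma init_closed:
  assumes F: "F \<in> rees"
  shows "init F \<in> carrier GR"
  unfolding GR_carrier
proof (intro conjI allI)
  fix j
  have "coeff F j \<in> Pw j" using F[unfolded rees_iff] by (rule spec)
  moreover have "init F j = coset (Suc j) (coeff F j)" by (simp only: init_def)
  ultimately show "\<exists>a\<in>Pw j. init F j = coset (Suc j) a"
    using bexI[of "\<lambda>a. init F j = coset (Suc j) a" "coeff F j" "Pw j"] by simp
next
  have "{j. init F j \<noteq> Pw (Suc j)} \<subseteq> {..degree F}"
  proof
    fix j assume "j \<in> {j. init F j \<noteq> Pw (Suc j)}"
    moreover have "init F j = Pw (Suc j)" if "coeff F j = 0" by (simp only: init_def that coset_0)
    ultimately have "coeff F j \<noteq> 0" by blast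
    then show "j \<in> {..degree F}" by (simp add: le_degree)
  qed
  then show "finite {j. init F j \<noteq> Pw (Suc j)}" by (rule finite_subset) simp
qed

lemma init_surj:
  assumes "x \<in> carrier GR"
  shows "\<exists>F\<in>rees. init F = x"
proof -
  have x: "\<And>j. \<exists>a\<in>Pw j. x j = coset (Suc j) a" and fin: "finite {j. x j \<noteq> Pw (Suc j)}"
    using assms unfolding GR_carrier by simp_all
  obtain a where a: "\<And>j. a j \<in> Pw j" "\<And>j. x j = coset (Suc j) (a j)" using x by metis
  let ?J = "{j. x j \<noteq> Pw (Suc j)}"
  \<comment> \<open>Only the finitely many nonzero components are lifted; elsewhere the coefficient
    0 represents the component.\<close>
  define F where "F = (\<Sum>j\<in>?J. monom (a j) j)"
  have cF: "coeff F j = (if j \<in> ?J then a j else 0)" for j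
    unfolding F_def coeff_sum using fin by (simp del: mem_Collect_eq)
  have "F \<in> rees" unfolding rees_iff cF using a(1) by (simp add: Pw_0)
  moreover have "init F j = x j" for j
  proof (cases "j \<in> ?J")
    case True
    then show ?thesis by (simp only: init_def cF if_True a(2)[symmetric])
  next
    case False
    then have "x j = Pw (Suc j)" by simp
    moreover have "init F j = Pw (Suc j)" by (simp only: init_def cF False if_False coset_0)
    ultimately show ?thesis by (simp only:)
  qed
  then have "init F = x" by (rule ext)
  ultimately show ?thesis by (rule bexI[rotated])
qed

lemma init_mult:
  fixes F G :: "'k::field poly poly"
  assumes F: "F \<in> rees" and G: "G \<in> rees"
  shows "init (F * G) = init F \<otimes>\<^bsub>GR\<^esub> init G"
proof
  fix j
  have mem: "coeff F i * coeff G (j - i) \<in> carrier SR" for i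
    unfolding Pw_carrier
    by (rule Pw_mono[OF Pw_mult[OF F[unfolded rees_iff, THEN spec] G[unfolded rees_iff, THEN spec]] le0])
  have mem': "coset (Suc j) (coeff F i * coeff G (j - i)) \<in> carrier (SR Quot Pw (Suc j))" for i
    by (rule ring_hom_closed[OF ideal.rcos_ring_hom[OF Pw_ideal] mem])
  interpret Q: ring "SR Quot Pw (Suc j) :: 'k poly set ring" by (rule ideal.quotient_is_ring[OF Pw_ideal])
  have "(init F \<otimes>\<^bsub>GR\<^esub> init G) j = finsum (SR Quot Pw (Suc j))
      (\<lambda>i. rcoset_mult SR (Pw (Suc j)) (init F i) (init G (j - i))) {..j}"
    unfolding assoc_graded_def ideal_power_eq by simp
  also have "\<dots> = finsum (SR Quot Pw (Suc j)) (\<lambda>i. coset (Suc j) (coeff F i * coeff G (j - i))) {..j}"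
  proof (rule Q.finsum_cong')
    fix i assume "i \<in> {..j}"
    then show "rcoset_mult SR (Pw (Suc j)) (init F i) (init G (j - i))
        = coset (Suc j) (coeff F i * coeff G (j - i))"
      unfolding init_def
      by (intro coset_mult F[unfolded rees_iff, THEN spec] G[unfolded rees_iff, THEN spec]) simp
  qed (use mem' in auto)
  also have "\<dots> = init (F * G) j"
    unfolding init_def coeff_mult by (rule coset_sum) (simp_all only: finite_atMost mem)
  finally show "init (F * G) j = (init F \<otimes>\<^bsub>GR\<^esub> init G) j" ..
qed

lemma rees_image_G: "rees_image h t d n S (GR :: (nat \<Rightarrow> 'k::field poly set) ring) init Z_G"
proof (intro rees_image.intro rees_image_axioms.intro gen_arith_semigroup_axioms eval_module_G
    init_closed init_mult init_surj)
  fix F G :: "'k poly poly"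
  show "init (F + G) = init F \<oplus>\<^bsub>GR\<^esub> init G"
    unfolding assoc_graded_def by (simp add: init_def coset_add fun_eq_iff del: SR_simps)
next
  fix F :: "'k poly poly"
  show "init F = \<zero>\<^bsub>GR\<^esub> \<longleftrightarrow> F \<in> Z_G" unfolding GR_zero init_eq_iff by simp
next
  show "init 1 = \<one>\<^bsub>GR :: (nat \<Rightarrow> 'k poly set) ring\<^esub>"
    unfolding assoc_graded_def ideal_power_eq
    by (rule ext) (simp add: init_def coset_0 coeff_pCons one_pCons split: nat.split)
qed

section \<open>The Betti numbers of both modules through the Koszul resolutions\<close>

lemma betti_R:
  "i \<ge> 1 \<Longrightarrow> betti d (semigroup_ring_module d n S :: ('k::field mpoly, 'k poly) module) i
    = tor_dim koszul_ranks (\<lambda>i. koszul_diff N mvar (Xm eps_R) d (Suc i) :: 'k mpoly mat) i"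
proof -
  assume i: "i \<ge> 1"
  interpret R: rees_image h t d n S "SR :: 'k poly ring" "\<lambda>F. poly F 1" Z_R by (rule rees_image_R)
  have "R.M = semigroup_ring_module d n S"
    unfolding R.M_def semigroup_ring_module_def by (simp add: eta_def xi_def poly_monom)
  then show ?thesis using R.betti_eq_tor_dim[OF res_R i] by simp
qed

lemma betti_G:
  "i \<ge> 1 \<Longrightarrow> betti d (tangent_cone_module d n S :: ('k::field mpoly, nat \<Rightarrow> 'k poly set) module) i
    = tor_dim koszul_ranks (\<lambda>i. koszul_diff N mvar (Xm eps_G) d (Suc i) :: 'k mpoly mat) i"
proof -
  assume i: "i \<ge> 1"
  interpret G: rees_image h t d n S "GR :: (nat \<Rightarrow> 'k poly set) ring" init Z_G by (rule rees_image_G)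
  have "init (eta c) = graded_class SR (generator_ideal d n S) 0 [:c:]" for c :: 'k
    unfolding graded_class_def ideal_power_eq
    by (rule ext) (simp add: init_def eta_def coset_0 coeff_pCons split: nat.split)
  moreover have "init (xi i) = graded_class SR (generator_ideal d n S) 1 (monom 1 (n i) :: 'k poly)" for i
    unfolding graded_class_def ideal_power_eq
    by (rule ext) (simp add: init_def xi_def coset_0)
  ultimately have "G.M = tangent_cone_module d n S"
    unfolding G.M_def tangent_cone_module_def Let_def by simp
  then show ?thesis using G.betti_eq_tor_dim[OF res_G i] by simp
qed

end

theorem corollary3p20:
  fixes h t d :: nat and n :: "nat \<Rightarrow> nat" and S :: "nat set"
  assumes "n 0 > 0" and "h > 0" and "t > 0" and "d > 0"
    and "\<And>i. 1 \<le> i \<Longrightarrow> i \<le> d \<Longrightarrow> n i = h * n 0 + i * t"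
    and "numerical_semigroup S"
    and "minimally_generated S d n"
  shows "homogeneous_type TYPE('k::field) d n S"
proof -
  interpret gen_arith_semigroup h t d n S
    using assms by unfold_locales (auto simp: minimally_generated_def)
  show ?thesis
    unfolding homogeneous_type_def
  proof (intro allI impI)
    fix i :: nat assume "1 \<le> i"
    show "betti d (semigroup_ring_module d n S :: ('k mpoly, 'k poly) module) i
        = betti d (tangent_cone_module d n S :: ('k mpoly, nat \<Rightarrow> 'k poly set) module) i"
      \<comment> \<open>\<open>tor_dim\<close> sees the differentials only through
        \<open>tensor_k\<close>, and the ranks are the same on both sides.\<close>
      unfolding betti_R[OF \<open>1 \<le> i\<close>] betti_G[OF \<open>1 \<le> i\<close>] tor_dim_def tensor_k_R_G ..
  qed
qed

end
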